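(* There exist absolute constants $K,K'>0$ such that the following holds. Let $n\ge1$, $\epsilon\ge0$, $\delta>0$ with $\delta\ge K\sqrt{\epsilon}$, and let $f\colon S_n\to\mathbb{R}$ be linear with $\mathbb{E}[\operatorname{dist}(f,\{0,1\})^2]\le\epsilon$ and $\delta\le\mathbb{E}[f]\le1-\delta$. Then there is a dictator $g$ with $\mathbb{E}[(f-g)^2]\le K'\epsilon/\delta$.
   Context: $S_n$ is the symmetric group on $[n]$; expectations are over uniformly random $\pi\in S_n$. $x_{i,j}(\pi)=1$ if $\pi(i)=j$ and $0$ otherwise; $f$ is linear if $f=\sum_{i,j}c_{i,j}x_{i,j}$ for reals $c_{i,j}$. $\operatorname{dist}(y,\{0,1\})=\min(|y|,|y-1|)$. A dictator is a function of the form $\sum_{(i,j)\in\mathcal{C}}x_{i,j}$ where all elements of $\mathcal{C}\subseteq[n]^2$ share the same first coordinate or all share the same second coordinate. *)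

theory Defs
  imports "HOL-Probability.Probability" "HOL-Combinatorics.Permutations"
begin

text \<open>
  An element of \<open>Sn n\<close> is a function on all of \<^typ>\<open>nat\<close> that fixes every point outside
  \<open>{1..n}\<close>. A function on \<open>Sn n\<close> is represented by a function on \<^typ>\<open>nat \<Rightarrow> nat\<close> of which
  only the values on \<open>Sn n\<close> matter.
\<close>

definition Sn :: "nat \<Rightarrow> (nat \<Rightarrow> nat) set"
  where "Sn n = {\<pi>. \<pi> permutes {1..n}}"

definition expect :: "nat \<Rightarrow> ((nat \<Rightarrow> nat) \<Rightarrow> real) \<Rightarrow> real"
  where "expect n f = measure_pmf.expectation (pmf_of_set (Sn n)) f"

definition perm_ind :: "nat \<Rightarrow> nat \<Rightarrow> (nat \<Rightarrow> nat) \<Rightarrow> real"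
  where "perm_ind i j \<pi> = (if \<pi> i = j then 1 else 0)"

definition linear_on_Sn :: "nat \<Rightarrow> ((nat \<Rightarrow> nat) \<Rightarrow> real) \<Rightarrow> bool"
  where "linear_on_Sn n f \<longleftrightarrow>
    (\<exists>c :: nat \<Rightarrow> nat \<Rightarrow> real. \<forall>\<pi>\<in>Sn n. f \<pi> = (\<Sum>i\<in>{1..n}. \<Sum>j\<in>{1..n}. c i j * perm_ind i j \<pi>))"

definition dist01 :: "real \<Rightarrow> real"
  where "dist01 y = min \<bar>y\<bar> \<bar>y - 1\<bar>"

definition dictator :: "nat \<Rightarrow> ((nat \<Rightarrow> nat) \<Rightarrow> real) \<Rightarrow> bool"
  where "dictator n g \<longleftrightarrow>
    (\<exists>C \<subseteq> {1..n} \<times> {1..n}.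
      ((\<forall>p\<in>C. \<forall>q\<in>C. fst p = fst q) \<or> (\<forall>p\<in>C. \<forall>q\<in>C. snd p = snd q)) \<and>
      (\<forall>\<pi>\<in>Sn n. g \<pi> = (\<Sum>(i, j)\<in>C. perm_ind i j \<pi>)))"

end

theory Submission
  imports Defs
begin

text \<open>
  Write \<open>f(\<pi>) = \<Sum>i. c i (\<pi> i)\<close>. Exchanging two values of \<open>\<pi>\<close> changes \<open>f\<close> by a mixed second difference
  \<open>c i j + c k l - c i l - c k j\<close>, and the variance of \<open>f\<close>, also after restricting to a block
  \<open>I \<times> J\<close> of the matrix, is a multiple of the sum of the squares of these differences (the mass of the block).

  Split the rows and the columns at random into halves. Given the split, \<open>f\<close> is a sum \<open>A + B\<close> of two
  independent variables, and if \<open>A\<close> and \<open>B\<close> both vary then one of the four values \<open>A + B\<close>, \<open>A' + B\<close>,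
  \<open>A + B'\<close>, \<open>A' + B'\<close> is far from \<open>{0, 1}\<close>. Hence \<open>Var A * Var B\<close> is \<open>O(\<epsilon>)\<close> on average, which means that
  the total mass of pairs of differences that share no row and no column is \<open>O(n\<^sup>6 \<epsilon>)\<close>.

  The whole mass is at least of order \<open>n\<^sup>3 \<delta>\<close>. If \<open>n \<delta>\<close> is large, then no single entry of the matrix matters,
  so the mass must be carried by one line, and the mass that avoids this line is \<open>O(n\<^sup>3 \<epsilon> / \<delta>)\<close>.
  If \<open>n \<delta>\<close> is bounded, then \<open>n\<^sup>2 \<epsilon>\<close> is tiny; relative to a typical entry the matrix is then close to an integer
  matrix with boundedly many nonzero entries, any two of which are in a common line. Finally, for bounded \<open>n\<close>,
  \<open>f\<close> is pointwise close to a Boolean function, and looking at three and four rows at a time gives the line.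
  In all cases conditioning on the value of \<open>\<pi>\<close> along the line and rounding yields the dictator.
\<close>

section \<open>Averages over permutations\<close>

text \<open>The function f determines its matrix only up to adding a row function and a column
  function with cancelling totals. Mixed differences do not see this freedom, so masses are built
  from them alone. Averages run over arbitrary sets of rows, because halves of a split and the rows
  left after conditioning are treated like \<open>{1..n}\<close>.

  The case distinction comes from single entries: the differences through one entry may have mass
  about 2 n^2, against a total of order n^3 \<delta>. If n \<delta> is bounded, a heavy row and a
  heavy column may be heavy because of one common entry, so entries are rounded instead. That needs
  many rows and columns without large entries, which leaves finitely many n. For these, each
  permutation has probability 1 / n!, so a small mean error is small at every permutation, at the
  price of a factorial in the constant.

  The given \<delta> may be far below the distance of the mean from {0, 1}. The upper bound on the
  variance needs that distance, so the argument runs with the minimum of E f and 1 - E f and returns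
  to \<delta> at the very end.\<close>

definition perm_avg :: "nat set \<Rightarrow> ((nat \<Rightarrow> nat) \<Rightarrow> real) \<Rightarrow> real"
  where "perm_avg R F = (\<Sum>p | p permutes R. F p) / fact (card R)"

definition lin :: "(nat \<Rightarrow> nat \<Rightarrow> real) \<Rightarrow> nat set \<Rightarrow> (nat \<Rightarrow> nat) \<Rightarrow> real"
  where "lin c R p = (\<Sum>i\<in>R. c i (p i))"

text \<open>The arguments are two rows, then two columns. All values on a set vanish exactly when
  \<open>c\<close> is there a row function plus a column function, that is, when
  \<open>lin c\<close> is constant on the permutations.\<close>

definition mixed_diff :: "(nat \<Rightarrow> nat \<Rightarrow> real) \<Rightarrow> nat \<Rightarrow> nat \<Rightarrow> nat \<Rightarrow> nat \<Rightarrow> real"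
  where "mixed_diff c i k j l = c i j + c k l - c i l - c k j"

text \<open>Pairs are ordered, so two distinct rows and two distinct columns are counted four times;
  coinciding indices contribute 0.\<close>

definition block_mass :: "(nat \<Rightarrow> nat \<Rightarrow> real) \<Rightarrow> nat set \<Rightarrow> nat set \<Rightarrow> real"
  where "block_mass c I J = (\<Sum>i\<in>I. \<Sum>k\<in>I. \<Sum>j\<in>J. \<Sum>l\<in>J. (mixed_diff c i k j l)\<^sup>2)"

text \<open>For a concrete \<open>k\<close> this unfolds into \<open>k\<close> nested sums over
  shrinking sets, the form in which the second and fourth order averages below are
  evaluated.\<close>

fun distinct_sum :: "nat \<Rightarrow> 'a set \<Rightarrow> ('a list \<Rightarrow> real) \<Rightarrow> real" where
  "distinct_sum 0 R \<phi> = \<phi> []"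
| "distinct_sum (Suc k) R \<phi> = (\<Sum>x\<in>R. distinct_sum k (R - {x}) (\<lambda>xs. \<phi> (x # xs)))"

lemma distinct_sum_reindex:
  assumes "bij_betw t A B"
  shows "distinct_sum k B \<phi> = distinct_sum k A (\<lambda>xs. \<phi> (map t xs))"
  using assms
proof (induction k arbitrary: A B \<phi>)
  case (Suc k)
  have inj: "inj_on t A" and im: "t ` A = B" using Suc.prems by (auto simp: bij_betw_def)
  have "bij_betw t (A - {x}) (B - {t x})" if "x \<in> A" for x
    using inj im that by (auto simp: bij_betw_def inj_on_def)
  note bij = this
  have "distinct_sum (Suc k) B \<phi> = (\<Sum>x\<in>A. distinct_sum k (B - {t x}) (\<lambda>xs. \<phi> (t x # xs)))"
    by (simp add: sum.reindex_bij_betw[OF Suc.prems, symmetric])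
  also have "\<dots> = distinct_sum (Suc k) A (\<lambda>xs. \<phi> (map t xs))"
    by (simp, intro sum.cong refl Suc.IH bij)
  finally show ?case .
qed simp

text \<open>Every permutation of \<open>R\<close> is uniquely a transposition of \<open>a\<close>
  and \<open>b\<close>, after a permutation that fixes \<open>a\<close>; here \<open>b\<close> is
  the value at \<open>a\<close>. The transposition maps \<open>R - {a}\<close> onto
  \<open>R - {b}\<close> and so carries the induction hypothesis to the values that remain.\<close>

lemma sum_permutations_map:
  assumes "finite R" "distinct xs" "set xs \<subseteq> R"
  shows "(\<Sum>p | p permutes R. \<phi> (map p xs)) =
    fact (card R - length xs) * distinct_sum (length xs) R \<phi>"
  using assms
proof (induction xs arbitrary: R \<phi>)
  case Nil
  then show ?case by (simp add: card_permutations)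
next
  case (Cons a xs)
  let ?R = "R - {a}"
  have R: "R = insert a ?R" and fin: "finite ?R" and a: "a \<notin> ?R"
    using Cons.prems by auto
  have "(\<Sum>p | p permutes R. \<phi> (map p (a # xs))) =
      (\<Sum>b\<in>R. \<Sum>q | q permutes ?R. \<phi> (map (Transposition.transpose a b \<circ> q) (a # xs)))"
    using sum_over_permutations_insert[OF fin a, of "\<lambda>p. \<phi> (map p (a # xs))"] R by simp
  also have "\<dots> = (\<Sum>b\<in>R. \<Sum>q | q permutes ?R. \<phi> (b # map (Transposition.transpose a b) (map q xs)))"
  proof (intro sum.cong refl)
    fix b q assume "q \<in> {q. q permutes ?R}"
    then have "q a = a" using permutes_not_in[of q ?R a] by auto
    then show "\<phi> (map (Transposition.transpose a b \<circ> q) (a # xs)) = \<phi> (b # map (Transposition.transpose a b) (map q xs))"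
      by simp
  qed
  also have "\<dots> = (\<Sum>b\<in>R. fact (card ?R - length xs) * distinct_sum (length xs) ?R
      (\<lambda>ys. \<phi> (b # map (Transposition.transpose a b) ys)))"
  proof (intro sum.cong refl)
    fix b
    show "(\<Sum>q | q permutes ?R. \<phi> (b # map (Transposition.transpose a b) (map q xs))) =
      fact (card ?R - length xs) * distinct_sum (length xs) ?R
      (\<lambda>ys. \<phi> (b # map (Transposition.transpose a b) ys))"
      using Cons.prems by (intro Cons.IH[where \<phi> = "\<lambda>ys. \<phi> (b # map (Transposition.transpose a b) ys)"]) auto
  qed
  also have "\<dots> = (\<Sum>b\<in>R. fact (card ?R - length xs) * distinct_sum (length xs) (R - {b}) (\<lambda>ys. \<phi> (b # ys)))"
  proof (intro sum.cong refl)
    fix b assume b: "b \<in> R"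
    have "bij_betw (Transposition.transpose a b) ?R (R - {b})"
      using b Cons.prems by (intro bij_betwI[where g = "Transposition.transpose a b"])
        (auto simp: Transposition.transpose_def)
    from distinct_sum_reindex[OF this]
    show "fact (card ?R - length xs) * distinct_sum (length xs) ?R
      (\<lambda>ys. \<phi> (b # map (Transposition.transpose a b) ys)) =
      fact (card ?R - length xs) * distinct_sum (length xs) (R - {b}) (\<lambda>ys. \<phi> (b # ys))"
      by simp
  qed
  finally show ?case using Cons.prems by (simp add: sum_distrib_left)
qed

lemma perm_avg_mono:
  assumes "\<And>p. p permutes R \<Longrightarrow> F p \<le> G p"
  shows "perm_avg R F \<le> perm_avg R G"
  unfolding perm_avg_def using assms by (intro divide_right_mono sum_mono) auto

lemma perm_avg_cong:
  assumes "\<And>p. p permutes R \<Longrightarrow> F p = G p"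
  shows "perm_avg R F = perm_avg R G"
  unfolding perm_avg_def using assms by (auto intro!: sum.cong)

lemma perm_avg_add: "perm_avg R (\<lambda>p. F p + G p) = perm_avg R F + perm_avg R G"
  by (simp add: perm_avg_def sum.distrib add_divide_distrib)

lemma perm_avg_diff: "perm_avg R (\<lambda>p. F p - G p) = perm_avg R F - perm_avg R G"
  by (simp add: perm_avg_def sum_subtractf diff_divide_distrib)

lemma perm_avg_cmult: "perm_avg R (\<lambda>p. a * F p) = a * perm_avg R F"
  by (simp add: perm_avg_def sum_distrib_left)

lemma perm_avg_const: "finite R \<Longrightarrow> perm_avg R (\<lambda>p. a) = a"
  by (simp add: perm_avg_def card_permutations)

lemma perm_avg_sum: "perm_avg R (\<lambda>p. \<Sum>x\<in>X. F x p) = (\<Sum>x\<in>X. perm_avg R (F x))"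
  unfolding perm_avg_def by (subst sum.swap) (simp add: sum_divide_distrib)

lemma perm_avg_nonneg: "(\<And>p. p permutes R \<Longrightarrow> 0 \<le> F p) \<Longrightarrow> 0 \<le> perm_avg R F"
  unfolding perm_avg_def by (intro divide_nonneg_nonneg sum_nonneg) auto

lemma perm_avg_compose_right:
  assumes "q permutes R"
  shows "perm_avg R (\<lambda>p. F (p \<circ> q)) = perm_avg R F"
proof -
  have "bij_betw (\<lambda>p. p \<circ> q) {p. p permutes R} {p. p permutes R}"
    using assms by (intro bij_betwI[where g = "\<lambda>p. p \<circ> inv q"])
      (auto simp: permutes_compose permutes_inv comp_assoc permutes_inv_o)
  from sum.reindex_bij_betw[OF this, of F]
  show ?thesis by (simp add: perm_avg_def)
qed

lemma perm_avg_inv: "perm_avg R (\<lambda>p. F (inv p)) = perm_avg R F"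
proof -
  have "bij_betw inv {p. p permutes R} {p. p permutes R}"
    by (intro bij_betwI[where g = inv]) (auto simp: permutes_inv permutes_inv_inv)
  from sum.reindex_bij_betw[OF this, of F] show ?thesis by (simp add: perm_avg_def)
qed

lemma expect_eq_perm_avg: "expect n F = perm_avg {1..n} F"
proof -
  have "finite (Sn n)" unfolding Sn_def by (rule finite_permutations) simp
  moreover have "Sn n \<noteq> {}" unfolding Sn_def using permutes_id[of "{1..n}"] by blast
  moreover have "card (Sn n) = fact n" unfolding Sn_def by (rule card_permutations) auto
  ultimately show ?thesis
    by (simp add: expect_def perm_avg_def integral_pmf_of_set) (simp add: Sn_def)
qed

lemma perm_avg_one:
  assumes "finite R" "a \<in> R"
  shows "perm_avg R (\<lambda>p. \<phi> (p a)) = (\<Sum>x\<in>R. \<phi> x) / card R"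
proof -
  have "card R > 0" using assms by (auto simp: card_gt_0_iff)
  then obtain m where m: "card R = Suc m" by (metis Suc_pred)
  show ?thesis
    using sum_permutations_map[of R "[a]" "\<lambda>xs. \<phi> (hd xs)"] assms m
    by (simp add: perm_avg_def)
qed

lemma perm_avg_two:
  assumes "finite R" "a \<in> R" "b \<in> R" "a \<noteq> b"
  shows "perm_avg R (\<lambda>p. \<phi> (p a) (p b)) =
    (\<Sum>x\<in>R. \<Sum>y\<in>R - {x}. \<phi> x y) / (card R * (card R - 1))"
proof -
  have "card {a, b} \<le> card R" using assms by (intro card_mono) auto
  then have "card R \<ge> 2" using assms by simp
  then obtain m where m: "card R = Suc (Suc m)" by (metis Suc_le_D numeral_2_eq_2 Suc_le_mono)
  show ?thesis
    using sum_permutations_map[of R "[a, b]" "\<lambda>xs. \<phi> (xs ! 0) (xs ! 1)"] assms m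
    by (simp add: perm_avg_def) (simp add: algebra_simps)
qed

section \<open>The variance of a linear function\<close>

lemma sum_square_centered_pairs:
  fixes a :: "nat \<Rightarrow> real"
  assumes "(\<Sum>x\<in>R. a x) = 0"
  shows "(\<Sum>x\<in>R. \<Sum>y\<in>R. (a x - a y)\<^sup>2) = 2 * card R * (\<Sum>x\<in>R. (a x)\<^sup>2)"
proof -
  have "(\<Sum>x\<in>R. \<Sum>y\<in>R. (a x - a y)\<^sup>2) =
    (\<Sum>x\<in>R. \<Sum>y\<in>R. (a x)\<^sup>2) + (\<Sum>x\<in>R. \<Sum>y\<in>R. (a y)\<^sup>2) - 2 * (\<Sum>x\<in>R. \<Sum>y\<in>R. a x * a y)"
    by (simp add: power2_diff sum.distrib sum_subtractf sum_distrib_left mult.assoc)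
  moreover have "(\<Sum>x\<in>R. \<Sum>y\<in>R. a x * a y) = 0"
    using assms by (simp add: sum_distrib_left[symmetric])
  ultimately show ?thesis by (simp add: sum_distrib_left mult.assoc)
qed

text \<open>The identity for centered pairs is used twice: along the columns for the difference of
  two rows, then along the rows for each fixed column.\<close>

lemma block_mass_centered:
  fixes a :: "nat \<Rightarrow> nat \<Rightarrow> real"
  assumes row: "\<And>i. i \<in> R \<Longrightarrow> (\<Sum>j\<in>R. a i j) = 0"
    and col: "\<And>j. j \<in> R \<Longrightarrow> (\<Sum>i\<in>R. a i j) = 0"
  shows "block_mass a R R = 4 * (card R)\<^sup>2 * (\<Sum>i\<in>R. \<Sum>j\<in>R. (a i j)\<^sup>2)"
proof -
  have "block_mass a R R = (\<Sum>i\<in>R. \<Sum>k\<in>R. \<Sum>j\<in>R. \<Sum>l\<in>R. ((a i j - a k j) - (a i l - a k l))\<^sup>2)"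
    by (simp add: block_mass_def mixed_diff_def algebra_simps)
  also have "\<dots> = (\<Sum>i\<in>R. \<Sum>k\<in>R. 2 * card R * (\<Sum>j\<in>R. (a i j - a k j)\<^sup>2))"
    by (intro sum.cong refl sum_square_centered_pairs) (simp add: sum_subtractf row)
  also have "\<dots> = 2 * card R * (\<Sum>j\<in>R. \<Sum>i\<in>R. \<Sum>k\<in>R. (a i j - a k j)\<^sup>2)"
  proof -
    have "(\<Sum>i\<in>R. \<Sum>k\<in>R. \<Sum>j\<in>R. (a i j - a k j)\<^sup>2) = (\<Sum>i\<in>R. \<Sum>j\<in>R. \<Sum>k\<in>R. (a i j - a k j)\<^sup>2)"
      by (intro sum.cong refl sum.swap)
    also have "\<dots> = (\<Sum>j\<in>R. \<Sum>i\<in>R. \<Sum>k\<in>R. (a i j - a k j)\<^sup>2)"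
      by (rule sum.swap)
    finally show ?thesis by (simp add: sum_distrib_left[symmetric])
  qed
  also have "\<dots> = 2 * card R * (\<Sum>j\<in>R. 2 * card R * (\<Sum>i\<in>R. (a i j)\<^sup>2))"
    by (intro arg_cong2[where f = "(*)"] sum.cong refl sum_square_centered_pairs col)
  also have "\<dots> = 4 * (card R)\<^sup>2 * (\<Sum>i\<in>R. \<Sum>j\<in>R. (a i j)\<^sup>2)"
    using sum.swap[of "\<lambda>i j. (a i j)\<^sup>2" R R] by (simp add: sum_distrib_left[symmetric] power2_eq_square)
  finally show ?thesis .
qed

text \<open>Two different rows \<open>i\<close>, \<open>k\<close> have covariance minus their inner
  product divided by m (m - 1), because row \<open>k\<close> sums to 0. Summed over all
  \<open>k\<close> other than \<open>i\<close>, vanishing column sums turn the inner products into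
  minus the squared norm of row \<open>i\<close>, so the cross terms are positive in total.\<close>

lemma variance_lin_centered:
  fixes a :: "nat \<Rightarrow> nat \<Rightarrow> real"
  assumes fin: "finite R" and m: "card R \<ge> 2"
    and row: "\<And>i. i \<in> R \<Longrightarrow> (\<Sum>j\<in>R. a i j) = 0"
    and col: "\<And>j. j \<in> R \<Longrightarrow> (\<Sum>i\<in>R. a i j) = 0"
  shows "perm_avg R (\<lambda>p. (lin a R p)\<^sup>2) = (\<Sum>i\<in>R. \<Sum>j\<in>R. (a i j)\<^sup>2) / (card R - 1)"
proof -
  let ?m = "card R" and ?T = "\<Sum>i\<in>R. \<Sum>j\<in>R. (a i j)\<^sup>2"
  have two: "perm_avg R (\<lambda>p. a i (p i) * a k (p k)) = - (\<Sum>x\<in>R. a i x * a k x) / (?m * (?m - 1))"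
    if "i \<in> R" "k \<in> R - {i}" for i k
  proof -
    have "perm_avg R (\<lambda>p. a i (p i) * a k (p k)) =
      (\<Sum>x\<in>R. \<Sum>y\<in>R - {x}. a i x * a k y) / (?m * (?m - 1))"
      using perm_avg_two[OF fin, of i k "\<lambda>x y. a i x * a k y"] that by auto
    moreover have "(\<Sum>y\<in>R - {x}. a i x * a k y) = - (a i x * a k x)" if x: "x \<in> R" for x
      using row[of k] \<open>k \<in> R - {i}\<close> fin x by (simp add: sum_diff1 sum_distrib_left[symmetric])
    ultimately show ?thesis by (simp add: sum_negf)
  qed
  have one: "perm_avg R (\<lambda>p. a i (p i) * a i (p i)) = (\<Sum>x\<in>R. (a i x)\<^sup>2) / ?m" if "i \<in> R" for i
    using perm_avg_one[OF fin that, of "\<lambda>x. a i x * a i x"] by (simp add: power2_eq_square)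
  have "perm_avg R (\<lambda>p. (lin a R p)\<^sup>2) = (\<Sum>i\<in>R. \<Sum>k\<in>R. perm_avg R (\<lambda>p. a i (p i) * a k (p k)))"
    by (simp add: lin_def power2_eq_square sum_product perm_avg_sum)
  also have "\<dots> = (\<Sum>i\<in>R. perm_avg R (\<lambda>p. a i (p i) * a i (p i)) +
      (\<Sum>k\<in>R - {i}. perm_avg R (\<lambda>p. a i (p i) * a k (p k))))"
    using fin by (intro sum.cong refl sum.remove) auto
  also have "\<dots> = (\<Sum>i\<in>R. (\<Sum>x\<in>R. (a i x)\<^sup>2) / ?m +
      (\<Sum>k\<in>R - {i}. - (\<Sum>x\<in>R. a i x * a k x) / (?m * (?m - 1))))"
    by (intro sum.cong refl arg_cong2[where f = "(+)"]) (simp_all add: one two)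
  also have "\<dots> = (\<Sum>i\<in>R. (\<Sum>x\<in>R. (a i x)\<^sup>2) / ?m + (\<Sum>x\<in>R. (a i x)\<^sup>2) / (?m * (?m - 1)))"
  proof (intro sum.cong refl arg_cong2[where f = "(+)"])
    fix i assume i: "i \<in> R"
    have "(\<Sum>k\<in>R - {i}. \<Sum>x\<in>R. a i x * a k x) = (\<Sum>x\<in>R. a i x * (\<Sum>k\<in>R - {i}. a k x))"
      by (subst sum.swap) (simp add: sum_distrib_left)
    also have "\<dots> = (\<Sum>x\<in>R. - (a i x)\<^sup>2)"
      using fin i by (intro sum.cong refl) (simp add: sum_diff1 col power2_eq_square)
    finally have "(\<Sum>k\<in>R - {i}. \<Sum>x\<in>R. a i x * a k x) = - (\<Sum>x\<in>R. (a i x)\<^sup>2)"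
      by (simp add: sum_negf)
    then show "(\<Sum>k\<in>R - {i}. - (\<Sum>x\<in>R. a i x * a k x) / (?m * (?m - 1))) =
        (\<Sum>x\<in>R. (a i x)\<^sup>2) / (?m * (?m - 1))"
      by (simp add: sum_divide_distrib[symmetric] sum_negf)
  qed
  also have "\<dots> = ?T / ?m + ?T / (?m * (?m - 1))"
    by (simp add: sum.distrib sum_divide_distrib)
  also have "\<dots> = ?T / (?m - 1)"
    using m by (simp add: field_simps of_nat_diff)
  finally show ?thesis .
qed

text \<open>For \<open>card R \<le> 1\<close> both sides are \<open>0\<close>, the right one because \<open>x / 0 = 0\<close>.\<close>

lemma variance_lin:
  assumes fin: "finite R"
  shows "perm_avg R (\<lambda>p. (lin c R p - perm_avg R (lin c R))\<^sup>2) =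
    block_mass c R R / (4 * (card R)\<^sup>2 * (card R - 1))"
proof (cases "card R \<ge> 2")
  case False
  then consider "R = {}" | x where "R = {x}"
    using fin by (metis One_nat_def Suc_leI card_0_eq card_1_singletonE le_antisym not_less_eq_eq numeral_2_eq_2 zero_less_iff_neq_zero not_le)
  then show ?thesis
  proof cases
    case 1
    then show ?thesis by (simp add: perm_avg_def lin_def block_mass_def)
  next
    case 2
    then show ?thesis by (simp add: perm_avg_def lin_def block_mass_def mixed_diff_def permutes_sing)
  qed
next
  case True
  define m where "m = real (card R)"
  have m: "m \<ge> 2" using True by (simp add: m_def)
  define r where "r i = (\<Sum>j\<in>R. c i j) / m" for i
  define s where "s j = (\<Sum>i\<in>R. c i j) / m" for j
  define t where "t = (\<Sum>i\<in>R. r i) / m"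
  \<comment> \<open>Double centering: subtracting row and column means leaves mixed differences
    unchanged and shifts \<open>lin\<close> by a constant, which is the mean.\<close>
  define a where "a i j = c i j - r i - s j + t" for i j
  have t': "t = (\<Sum>j\<in>R. s j) / m"
    unfolding t_def r_def s_def by (simp add: sum_divide_distrib[symmetric]) (rule disjI2, rule sum.swap)
  have row: "(\<Sum>j\<in>R. a i j) = 0" for i
    using m t' by (simp add: a_def sum.distrib sum_subtractf r_def m_def[symmetric])
  have col: "(\<Sum>i\<in>R. a i j) = 0" for j
    using m t_def by (simp add: a_def sum.distrib sum_subtractf s_def m_def[symmetric])
  have lin: "lin c R p = lin a R p + m * t" if "p permutes R" for p
  proof -
    have "(\<Sum>i\<in>R. s (p i)) = (\<Sum>i\<in>R. s i)"
      using sum.permute[OF that, of s] by (simp add: o_def)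
    then show ?thesis
      using m t' t_def by (simp add: lin_def a_def sum.distrib sum_subtractf m_def[symmetric])
  qed
  have zero: "perm_avg R (lin a R) = 0"
    unfolding lin_def by (simp add: perm_avg_sum perm_avg_one[OF fin] row)
  have "perm_avg R (lin c R) = perm_avg R (\<lambda>p. lin a R p + m * t)"
    by (intro perm_avg_cong lin)
  then have mean: "perm_avg R (lin c R) = m * t"
    by (simp add: perm_avg_add perm_avg_const fin zero)
  have "perm_avg R (\<lambda>p. (lin c R p - perm_avg R (lin c R))\<^sup>2) = perm_avg R (\<lambda>p. (lin a R p)\<^sup>2)"
    unfolding mean by (intro perm_avg_cong) (simp add: lin)
  also have "\<dots> = (\<Sum>i\<in>R. \<Sum>j\<in>R. (a i j)\<^sup>2) / (card R - 1)"
    by (rule variance_lin_centered[OF fin True row col])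
  also have "\<dots> = block_mass a R R / (4 * (card R)\<^sup>2 * (card R - 1))"
    using block_mass_centered[of R a] row col m by (simp add: m_def)
  also have "block_mass a R R = block_mass c R R"
    by (simp add: block_mass_def mixed_diff_def a_def algebra_simps)
  finally show ?thesis .
qed

section \<open>Elementary inequalities for the distance to {0, 1}\<close>

lemma dist01_nonneg: "0 \<le> dist01 y"
  by (simp add: dist01_def)

text \<open>
  The four points are \<open>m \<plusminus> p / 2 \<plusminus> q / 2\<close>; if \<open>\<bar>p\<bar> \<le> \<bar>q\<bar>\<close>, they form two disjoint pairs of points at
  distance \<open>\<bar>p\<bar>\<close>, and at most one of the pairs can be separated by \<open>1 / 2\<close>.
\<close>

lemma dist01_four_point:
  "min \<bar>p\<bar> \<bar>q\<bar> \<le> dist01 a + dist01 (a + p) + dist01 (a + q) + dist01 (a + p + q)"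
proof -
  have d: "dist01 y = (if y \<le> 1/2 then \<bar>y\<bar> else \<bar>y - 1\<bar>)" for y
    by (auto simp: dist01_def min_def)
  show ?thesis
    unfolding d by (cases "a \<le> 1/2"; cases "a + p \<le> 1/2"; cases "a + q \<le> 1/2"; cases "a + p + q \<le> 1/2"; simp; linarith)
qed

text \<open>The four-point bound controls only the smaller of the two displacements. Truncation at 1
  makes a product out of it: the larger factor is bounded by 1, the smaller by its square.\<close>

lemma dist01_four_point_square:
  "min (p\<^sup>2) 1 * min (q\<^sup>2) 1 \<le>
    4 * ((dist01 a)\<^sup>2 + (dist01 (a + p))\<^sup>2 + (dist01 (a + q))\<^sup>2 + (dist01 (a + p + q))\<^sup>2)"
proof -
  define s where "s = dist01 a + dist01 (a + p) + dist01 (a + q) + dist01 (a + p + q)"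
  have s: "min \<bar>p\<bar> \<bar>q\<bar> \<le> s" unfolding s_def by (rule dist01_four_point)
  have "min (p\<^sup>2) 1 * min (q\<^sup>2) 1 \<le> (min \<bar>p\<bar> \<bar>q\<bar>)\<^sup>2"
  proof (cases "\<bar>p\<bar> \<le> \<bar>q\<bar>")
    case True
    then show ?thesis using mult_mono[of "min (p\<^sup>2) 1" "p\<^sup>2" "min (q\<^sup>2) 1" 1] by simp
  next
    case False
    then show ?thesis using mult_mono[of "min (p\<^sup>2) 1" 1 "min (q\<^sup>2) 1" "q\<^sup>2"] by simp
  qed
  also have "\<dots> \<le> s\<^sup>2" using s by (intro power_mono) auto
  also have "\<dots> \<le> 4 * ((dist01 a)\<^sup>2 + (dist01 (a + p))\<^sup>2 + (dist01 (a + q))\<^sup>2 + (dist01 (a + p + q))\<^sup>2)"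
  proof -
    have "(u + v + w + x)\<^sup>2 \<le> 4 * (u\<^sup>2 + v\<^sup>2 + w\<^sup>2 + x\<^sup>2)" for u v w x :: real
    proof -
      have "4 * (u\<^sup>2 + v\<^sup>2 + w\<^sup>2 + x\<^sup>2) - (u + v + w + x)\<^sup>2 =
        (u - v)\<^sup>2 + (u - w)\<^sup>2 + (u - x)\<^sup>2 + (v - w)\<^sup>2 + (v - x)\<^sup>2 + (w - x)\<^sup>2"
        by (simp add: power2_eq_square algebra_simps)
      then show ?thesis by (smt (verit) zero_le_power2)
    qed
    then show ?thesis unfolding s_def .
  qed
  finally show ?thesis .
qed

lemma abs_diff_le_dist01: "\<bar>x - y\<bar> \<le> 1 + dist01 x + dist01 y"
  unfolding dist01_def min_def by (cases "\<bar>x\<bar> \<le> \<bar>x - 1\<bar>"; cases "\<bar>y\<bar> \<le> \<bar>y - 1\<bar>"; simp; linarith)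

text \<open>This undoes the truncation. A difference above 2 exceeds the gap 1 by at least half of
  itself, so it is paid for by the distances of \<open>x\<close> and \<open>y\<close>.\<close>

lemma square_diff_le_dist01:
  "(x - y)\<^sup>2 \<le> 4 * min ((x - y)\<^sup>2) 1 + 8 * ((dist01 x)\<^sup>2 + (dist01 y)\<^sup>2)"
proof (cases "\<bar>x - y\<bar> \<le> 2")
  case True
  then have "(x - y)\<^sup>2 \<le> 4" using power_mono[of "\<bar>x - y\<bar>" 2 2] by simp
  then show ?thesis using zero_le_power2[of "dist01 x"] zero_le_power2[of "dist01 y"]
    zero_le_power2[of "x - y"] by (smt (verit))
next
  case False
  then have "\<bar>x - y\<bar> \<le> 2 * (dist01 x + dist01 y)" using abs_diff_le_dist01[of x y] by (smt (verit))
  then have "(x - y)\<^sup>2 \<le> (2 * (dist01 x + dist01 y))\<^sup>2" using power_mono[of "\<bar>x - y\<bar>" _ 2] by auto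
  also have "\<dots> \<le> 8 * ((dist01 x)\<^sup>2 + (dist01 y)\<^sup>2)"
    using zero_le_power2[of "dist01 x - dist01 y"] by (simp add: power2_eq_square algebra_simps)
  finally show ?thesis by (smt (verit) zero_le_power2)
qed

section \<open>Splitting into two independent blocks\<close>

lemma perm_avg_mult_right: "perm_avg R (\<lambda>p. F p * a) = perm_avg R F * a"
  using perm_avg_cmult[of R a F] by (simp add: mult.commute)

lemma perm_avg_swap:
  "perm_avg R (\<lambda>p. perm_avg R' (\<lambda>q. H p q)) = perm_avg R' (\<lambda>q. perm_avg R (\<lambda>p. H p q))"
proof -
  have "(\<Sum>p | p permutes R. \<Sum>q | q permutes R'. H p q) = (\<Sum>q | q permutes R'. \<Sum>p | p permutes R. H p q)"
    by (rule sum.swap)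
  then show ?thesis by (simp add: perm_avg_def sum_divide_distrib[symmetric] mult.commute)
qed

lemma perm_avg_square_diff:
  assumes "finite R"
  shows "perm_avg R (\<lambda>p. perm_avg R (\<lambda>q. (F q - F p)\<^sup>2)) =
    2 * perm_avg R (\<lambda>p. (F p - perm_avg R F)\<^sup>2)"
proof -
  define \<mu> where "\<mu> = perm_avg R F"
  have "perm_avg R (\<lambda>p. perm_avg R (\<lambda>q. (F q - F p)\<^sup>2)) =
    perm_avg R (\<lambda>p. perm_avg R (\<lambda>q. (F p - \<mu>)\<^sup>2 + (F q - \<mu>)\<^sup>2 - 2 * ((F p - \<mu>) * (F q - \<mu>))))"
    by (simp add: power2_eq_square algebra_simps)
  also have "\<dots> = 2 * perm_avg R (\<lambda>p. (F p - \<mu>)\<^sup>2)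
      - 2 * perm_avg R (\<lambda>p. (F p - \<mu>) * perm_avg R (\<lambda>q. F q - \<mu>))"
    using assms by (simp add: perm_avg_diff perm_avg_add perm_avg_cmult perm_avg_const)
  also have "perm_avg R (\<lambda>q. F q - \<mu>) = 0"
    using assms by (simp add: perm_avg_diff perm_avg_const \<mu>_def)
  finally show ?thesis using assms by (simp add: perm_avg_const \<mu>_def)
qed

text \<open>With truncated variances \<open>V\<close>, \<open>W\<close> of the two summands, V W
  \<le> 16 e, and A \<le> 2 V + 8 e, B \<le> 2 W + 8 e. Multiplying out and using W \<le> 1 and A
  \<le> C gives 64 + 16 + 8 C.\<close>

lemma variance_product_le:
  fixes F G :: "(nat \<Rightarrow> nat) \<Rightarrow> real"
  assumes fin: "finite R" "finite R'"
  defines "A \<equiv> perm_avg R (\<lambda>p. (F p - perm_avg R F)\<^sup>2)"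
    and "B \<equiv> perm_avg R' (\<lambda>q. (G q - perm_avg R' G)\<^sup>2)"
    and "e \<equiv> perm_avg R (\<lambda>p. perm_avg R' (\<lambda>q. (dist01 (F p + G q))\<^sup>2))"
  assumes A: "A \<le> C"
  shows "A * B \<le> (80 + 8 * C) * e"
proof -
  define V where "V = perm_avg R (\<lambda>p. perm_avg R (\<lambda>p'. min ((F p' - F p)\<^sup>2) 1))"
  define W where "W = perm_avg R' (\<lambda>q. perm_avg R' (\<lambda>q'. min ((G q' - G q)\<^sup>2) 1))"
  have e0: "0 \<le> e" unfolding e_def by (intro perm_avg_nonneg) simp
  have A0: "0 \<le> A" and B0: "0 \<le> B" unfolding A_def B_def by (intro perm_avg_nonneg; simp)+
  have V0: "0 \<le> V" and W0: "0 \<le> W" unfolding V_def W_def by (intro perm_avg_nonneg; simp)+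
  have W1: "W \<le> 1"
  proof -
    have "W \<le> perm_avg R' (\<lambda>q. perm_avg R' (\<lambda>q'. 1))"
      unfolding W_def by (intro perm_avg_mono) simp
    then show ?thesis by (simp add: perm_avg_const fin)
  qed
  have "V * W = perm_avg R (\<lambda>p. perm_avg R (\<lambda>p'. perm_avg R' (\<lambda>q. perm_avg R' (\<lambda>q'.
      min ((F p' - F p)\<^sup>2) 1 * min ((G q' - G q)\<^sup>2) 1))))"
    by (simp only: perm_avg_cmult perm_avg_mult_right V_def W_def)
  also have "\<dots> \<le> perm_avg R (\<lambda>p. perm_avg R (\<lambda>p'. perm_avg R' (\<lambda>q. perm_avg R' (\<lambda>q'.
      4 * ((dist01 (F p + G q))\<^sup>2 + (dist01 (F p' + G q))\<^sup>2 + (dist01 (F p + G q'))\<^sup>2 + (dist01 (F p' + G q'))\<^sup>2)))))"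
  proof (intro perm_avg_mono)
    fix p p' q q'
    show "min ((F p' - F p)\<^sup>2) 1 * min ((G q' - G q)\<^sup>2) 1 \<le>
      4 * ((dist01 (F p + G q))\<^sup>2 + (dist01 (F p' + G q))\<^sup>2 + (dist01 (F p + G q'))\<^sup>2 + (dist01 (F p' + G q'))\<^sup>2)"
      using dist01_four_point_square[of "F p' - F p" "G q' - G q" "F p + G q"]
      by (simp add: algebra_simps)
  qed
  also have "\<dots> = 16 * e"
    by (simp add: perm_avg_cmult perm_avg_add perm_avg_const fin e_def)
  finally have VW: "V * W \<le> 16 * e" .
  have e': "e = perm_avg R' (\<lambda>q. perm_avg R (\<lambda>p. (dist01 (F p + G q))\<^sup>2))"
    unfolding e_def by (rule perm_avg_swap)
  \<comment> \<open>The average over \<open>q\<close> is inserted because a difference of values of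
    \<open>F\<close> is also a difference of values of \<open>F p + G q\<close>, whose distances to
    {0, 1} are controlled only on average over \<open>q\<close>.\<close>
  have "2 * A = perm_avg R' (\<lambda>q. perm_avg R (\<lambda>p. perm_avg R (\<lambda>p'. (F p' - F p)\<^sup>2)))"
    unfolding A_def perm_avg_square_diff[OF fin(1), symmetric]
    by (simp add: perm_avg_const fin)
  also have "\<dots> \<le> perm_avg R' (\<lambda>q. perm_avg R (\<lambda>p. perm_avg R (\<lambda>p'.
      4 * min ((F p' - F p)\<^sup>2) 1 + 8 * ((dist01 (F p' + G q))\<^sup>2 + (dist01 (F p + G q))\<^sup>2))))"
    (is "_ \<le> ?rhs")
  proof (intro perm_avg_mono)
    fix p p' q
    show "(F p' - F p)\<^sup>2 \<le> 4 * min ((F p' - F p)\<^sup>2) 1 +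
        8 * ((dist01 (F p' + G q))\<^sup>2 + (dist01 (F p + G q))\<^sup>2)"
      using square_diff_le_dist01[of "F p' + G q" "F p + G q"] by simp
  qed
  also have "?rhs = 4 * V + 16 * e"
    by (simp add: perm_avg_cmult perm_avg_add perm_avg_const fin e' V_def)
  finally have AV: "A \<le> 2 * V + 8 * e" by simp
  have "2 * B = perm_avg R (\<lambda>p. perm_avg R' (\<lambda>q. perm_avg R' (\<lambda>q'. (G q' - G q)\<^sup>2)))"
    unfolding B_def perm_avg_square_diff[OF fin(2), symmetric]
    by (simp add: perm_avg_const fin)
  also have "\<dots> \<le> perm_avg R (\<lambda>p. perm_avg R' (\<lambda>q. perm_avg R' (\<lambda>q'.
      4 * min ((G q' - G q)\<^sup>2) 1 + 8 * ((dist01 (F p + G q'))\<^sup>2 + (dist01 (F p + G q))\<^sup>2))))"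
    (is "_ \<le> ?rhs")
  proof (intro perm_avg_mono)
    fix p q q'
    show "(G q' - G q)\<^sup>2 \<le> 4 * min ((G q' - G q)\<^sup>2) 1 +
        8 * ((dist01 (F p + G q'))\<^sup>2 + (dist01 (F p + G q))\<^sup>2)"
      using square_diff_le_dist01[of "F p + G q'" "F p + G q"] by simp
  qed
  also have "?rhs = 4 * W + 16 * e"
    by (simp add: perm_avg_cmult perm_avg_add perm_avg_const fin e_def W_def)
  finally have BW: "B \<le> 2 * W + 8 * e" by simp
  have "A * B \<le> A * (2 * W + 8 * e)" using BW A0 by (intro mult_left_mono)
  also have "\<dots> = 2 * (A * W) + 8 * (A * e)" by (simp add: algebra_simps)
  also have "A * W \<le> (2 * V + 8 * e) * W" using AV W0 by (intro mult_right_mono)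
  also have "\<dots> = 2 * (V * W) + 8 * (e * W)" by (simp add: algebra_simps)
  also have "e * W \<le> e * 1" using W1 e0 by (intro mult_left_mono)
  also have "A * e \<le> C * e" using A e0 by (intro mult_right_mono)
  finally show ?thesis using VW by (simp add: algebra_simps)
qed

section \<open>Relabelled blocks and random splits\<close>

lemma block_mass_reindex:
  assumes "bij_betw \<sigma> I I'" "bij_betw \<tau> J J'"
  shows "block_mass (\<lambda>i j. c (\<sigma> i) (\<tau> j)) I J = block_mass c I' J'"
  unfolding block_mass_def
  unfolding sum.reindex_bij_betw[OF assms(1), symmetric] sum.reindex_bij_betw[OF assms(2), symmetric]
      mixed_diff_def ..

lemma block_mass_mono:
  assumes "I \<subseteq> I'" "J \<subseteq> J'" "finite I'" "finite J'"
  shows "block_mass c I J \<le> block_mass c I' J'"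
proof -
  have "block_mass c I J = (\<Sum>x\<in>I \<times> I \<times> J \<times> J. case x of (i, k, j, l) \<Rightarrow> (mixed_diff c i k j l)\<^sup>2)"
    by (simp add: block_mass_def sum.cartesian_product)
  also have "\<dots> \<le> (\<Sum>x\<in>I' \<times> I' \<times> J' \<times> J'. case x of (i, k, j, l) \<Rightarrow> (mixed_diff c i k j l)\<^sup>2)"
    using assms by (intro sum_mono2) auto
  also have "\<dots> = block_mass c I' J'"
    by (simp add: block_mass_def sum.cartesian_product)
  finally show ?thesis .
qed

lemma block_mass_nonneg: "0 \<le> block_mass c I J"
  unfolding block_mass_def by (intro sum_nonneg) simp

lemma mixed_diff_same [simp]: "mixed_diff c i i j l = 0" "mixed_diff c i k j j = 0"
  by (simp_all add: mixed_diff_def)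

text \<open>The images of four points form a uniform injective quadruple. As \<phi> vanishes when
  its first two or its last two arguments agree, only the disjointness of the two pairs has to be
  kept in the sum.\<close>

lemma perm_avg_four_ge:
  assumes fin: "finite S" and dist: "distinct [a, b, c, d]" and sub: "{a, b, c, d} \<subseteq> S"
    and nonneg: "\<And>p q r s. 0 \<le> \<phi> p q r s"
    and zero: "\<And>p r s. \<phi> p p r s = 0" "\<And>p q r. \<phi> p q r r = 0"
  shows "(\<Sum>p\<in>S. \<Sum>q\<in>S. \<Sum>r\<in>S - {p, q}. \<Sum>s\<in>S - {p, q}. \<phi> p q r s) / card S ^ 4
    \<le> perm_avg S (\<lambda>\<sigma>. \<phi> (\<sigma> a) (\<sigma> b) (\<sigma> c) (\<sigma> d))"
proof -
  let ?T = "\<Sum>p\<in>S. \<Sum>q\<in>S. \<Sum>r\<in>S - {p, q}. \<Sum>s\<in>S - {p, q}. \<phi> p q r s"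
  have T0: "0 \<le> ?T" by (intro sum_nonneg nonneg)
  have "card {a, b, c, d} \<le> card S" using fin sub by (intro card_mono) auto
  then have "card S \<ge> 4" using dist by simp
  then obtain m where m: "card S = Suc (Suc (Suc (Suc m)))"
    using le_Suc_ex[of 4 "card S"] by (auto simp: numeral_eq_Suc)
  have "?T = (\<Sum>p\<in>S. \<Sum>q\<in>S - {p}. \<Sum>r\<in>S - {p} - {q}. \<Sum>s\<in>S - {p} - {q} - {r}. \<phi> p q r s)"
  proof (rule sum.cong[OF refl])
    fix p
    have "(\<Sum>q\<in>S. \<Sum>r\<in>S - {p, q}. \<Sum>s\<in>S - {p, q}. \<phi> p q r s) =
      (\<Sum>q\<in>S - {p}. \<Sum>r\<in>S - {p, q}. \<Sum>s\<in>S - {p, q}. \<phi> p q r s)"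
      using fin by (intro sum.mono_neutral_right) (auto simp: zero)
    also have "\<dots> = (\<Sum>q\<in>S - {p}. \<Sum>r\<in>S - {p} - {q}. \<Sum>s\<in>S - {p} - {q} - {r}. \<phi> p q r s)"
    proof (rule sum.cong[OF refl])
      fix q
      have "(\<Sum>s\<in>S - {p, q}. \<phi> p q r s) = (\<Sum>s\<in>S - {p} - {q} - {r}. \<phi> p q r s)" for r
        using fin by (intro sum.mono_neutral_right) (auto simp: zero)
      moreover have "S - {p, q} = S - {p} - {q}" by auto
      ultimately show "(\<Sum>r\<in>S - {p, q}. \<Sum>s\<in>S - {p, q}. \<phi> p q r s) =
          (\<Sum>r\<in>S - {p} - {q}. \<Sum>s\<in>S - {p} - {q} - {r}. \<phi> p q r s)"
        by simp
    qed
    finally show "(\<Sum>q\<in>S. \<Sum>r\<in>S - {p, q}. \<Sum>s\<in>S - {p, q}. \<phi> p q r s) =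
      (\<Sum>q\<in>S - {p}. \<Sum>r\<in>S - {p} - {q}. \<Sum>s\<in>S - {p} - {q} - {r}. \<phi> p q r s)" .
  qed
  then have "distinct_sum 4 S (\<lambda>xs. \<phi> (xs ! 0) (xs ! 1) (xs ! 2) (xs ! 3)) = ?T"
    by (simp add: numeral_eq_Suc)
  then have avg: "perm_avg S (\<lambda>\<sigma>. \<phi> (\<sigma> a) (\<sigma> b) (\<sigma> c) (\<sigma> d)) = fact m * ?T / fact (card S)"
    using sum_permutations_map[OF fin dist, of "\<lambda>xs. \<phi> (xs ! 0) (xs ! 1) (xs ! 2) (xs ! 3)"] sub m
    by (simp add: perm_avg_def numeral_eq_Suc)
  \<comment> \<open>The falling factorial is replaced by the fourth power, which costs equality but
    keeps later formulas simple.\<close>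
  have "(fact (card S) :: real) = (real m + 4) * (real m + 3) * (real m + 2) * (real m + 1) * fact m"
    by (simp add: m algebra_simps)
  also have "\<dots> \<le> (real m + 4) * (real m + 4) * (real m + 4) * (real m + 4) * fact m"
    by (intro mult_right_mono mult_mono) auto
  also have "\<dots> = real (card S) ^ 4 * fact m" by (simp add: m numeral_eq_Suc algebra_simps)
  finally have "fact (card S) \<le> real (card S) ^ 4 * fact m" .
  then have "fact m * ?T / (real (card S) ^ 4 * fact m) \<le> fact m * ?T / fact (card S)"
    using T0 by (intro divide_left_mono mult_nonneg_nonneg) (auto simp: m)
  then show ?thesis using avg by (simp add: mult.commute)
qed

lemma perm_avg_variance:
  assumes "finite R"
  shows "perm_avg R (\<lambda>p. (F p - perm_avg R F)\<^sup>2) = perm_avg R (\<lambda>p. (F p)\<^sup>2) - (perm_avg R F)\<^sup>2"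
proof -
  define \<mu> where "\<mu> = perm_avg R F"
  have "perm_avg R (\<lambda>p. (F p - \<mu>)\<^sup>2) = perm_avg R (\<lambda>p. (F p)\<^sup>2 - 2 * \<mu> * F p + \<mu>\<^sup>2)"
    by (simp add: power2_diff algebra_simps)
  also have "\<dots> = perm_avg R (\<lambda>p. (F p)\<^sup>2) - \<mu>\<^sup>2"
    using assms by (simp add: perm_avg_add perm_avg_diff perm_avg_cmult perm_avg_const \<mu>_def power2_eq_square)
  finally show ?thesis unfolding \<mu>_def .
qed

lemma variance_le_of_dist01:
  assumes fin: "finite R" and e: "perm_avg R (\<lambda>p. (dist01 (F p))\<^sup>2) \<le> \<epsilon>"
  shows "perm_avg R (\<lambda>p. (F p - perm_avg R F)\<^sup>2) \<le> 2 + 2 * \<epsilon>"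
proof -
  have "(F p)\<^sup>2 \<le> 2 + 2 * (dist01 (F p))\<^sup>2" for p
  proof -
    have "\<bar>F p\<bar> \<le> 1 + dist01 (F p)"
      using abs_diff_le_dist01[of "F p" 0] by (simp add: dist01_def)
    then have "(F p)\<^sup>2 \<le> (1 + dist01 (F p))\<^sup>2"
      using power_mono[of "\<bar>F p\<bar>" "1 + dist01 (F p)" 2] by simp
    also have "\<dots> \<le> 2 + 2 * (dist01 (F p))\<^sup>2"
      using zero_le_power2[of "1 - dist01 (F p)"] by (simp add: power2_eq_square algebra_simps)
    finally show ?thesis .
  qed
  then have "perm_avg R (\<lambda>p. (F p)\<^sup>2) \<le> perm_avg R (\<lambda>p. 2 + 2 * (dist01 (F p))\<^sup>2)"
    by (intro perm_avg_mono)
  also have "\<dots> \<le> 2 + 2 * \<epsilon>" using e by (simp add: perm_avg_add perm_avg_cmult perm_avg_const fin)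
  finally show ?thesis unfolding perm_avg_variance[OF fin] using zero_le_power2[of "perm_avg R F"] by linarith
qed

text \<open>The random split is encoded by fixed halves and random relabellings: \<sigma> chooses
  the rows, \<tau> the columns. Independent \<alpha> and \<beta> then form a permutation that maps
  \<sigma>(R) to \<tau>(R) and \<sigma>(R') to \<tau>(R').\<close>

lemma lin_split:
  assumes S: "S = R \<union> R'" "R \<inter> R' = {}" and fin: "finite S"
    and \<sigma>: "\<sigma> permutes S" and \<alpha>: "\<alpha> permutes R" and \<beta>: "\<beta> permutes R'"
  shows "lin (\<lambda>i j. c (\<sigma> i) (\<tau> j)) R \<alpha> + lin (\<lambda>i j. c (\<sigma> i) (\<tau> j)) R' \<beta> =
    lin c S (\<tau> \<circ> (\<alpha> \<circ> \<beta> \<circ> inv \<sigma>))"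
proof -
  have "lin c S (\<tau> \<circ> (\<alpha> \<circ> \<beta> \<circ> inv \<sigma>)) = (\<Sum>i\<in>S. c (\<sigma> i) (\<tau> (\<alpha> (\<beta> (inv \<sigma> (\<sigma> i))))))"
    unfolding lin_def using sum.permute[OF \<sigma>, of "\<lambda>i. c i ((\<tau> \<circ> (\<alpha> \<circ> \<beta> \<circ> inv \<sigma>)) i)"]
    by (simp add: o_def)
  also have "\<dots> = (\<Sum>i\<in>S. c (\<sigma> i) (\<tau> (\<alpha> (\<beta> i))))"
    using permutes_inverses(2)[OF \<sigma>] by simp
  also have "\<dots> = (\<Sum>i\<in>R. c (\<sigma> i) (\<tau> (\<alpha> (\<beta> i)))) + (\<Sum>i\<in>R'. c (\<sigma> i) (\<tau> (\<alpha> (\<beta> i))))"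
    unfolding S(1) using fin S by (intro sum.union_disjoint) auto
  also have "(\<Sum>i\<in>R. c (\<sigma> i) (\<tau> (\<alpha> (\<beta> i)))) = (\<Sum>i\<in>R. c (\<sigma> i) (\<tau> (\<alpha> i)))"
    using S(2) permutes_not_in[OF \<beta>] by (intro sum.cong refl) (metis disjoint_iff)
  also have "(\<Sum>i\<in>R'. c (\<sigma> i) (\<tau> (\<alpha> (\<beta> i)))) = (\<Sum>i\<in>R'. c (\<sigma> i) (\<tau> (\<beta> i)))"
    using S(2) permutes_not_in[OF \<alpha>] permutes_in_image[OF \<beta>]
    by (intro sum.cong refl) (metis disjoint_iff)
  finally show ?thesis by (simp add: lin_def)
qed

lemma permutes_union_compose:
  assumes "\<alpha> permutes R" "\<beta> permutes R'" "\<sigma> permutes R \<union> R'"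
  shows "\<alpha> \<circ> \<beta> \<circ> inv \<sigma> permutes R \<union> R'"
  using assms by (intro permutes_compose permutes_inv) (auto intro: permutes_subset)

text \<open>Conditionally on \<sigma> and \<tau> this is the bound for two independent summands. The
  conditional errors average to the original error, because the recombined permutation is
  uniform.\<close>

lemma split_product_le:
  fixes c :: "nat \<Rightarrow> nat \<Rightarrow> real"
  assumes S: "S = R \<union> R'" "R \<inter> R' = {}" and fin: "finite S"
    and e: "perm_avg S (\<lambda>p. (dist01 (lin c S p))\<^sup>2) \<le> \<epsilon>"
    and C: "\<And>\<sigma> \<tau>. \<sigma> permutes S \<Longrightarrow> \<tau> permutes S \<Longrightarrow>
      block_mass (\<lambda>i j. c (\<sigma> i) (\<tau> j)) R R / (4 * (card R)\<^sup>2 * (card R - 1)) \<le> C"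
    and C0: "0 \<le> C"
  shows "perm_avg S (\<lambda>\<sigma>. perm_avg S (\<lambda>\<tau>.
      (block_mass (\<lambda>i j. c (\<sigma> i) (\<tau> j)) R R / (4 * (card R)\<^sup>2 * (card R - 1))) *
      (block_mass (\<lambda>i j. c (\<sigma> i) (\<tau> j)) R' R' / (4 * (card R')\<^sup>2 * (card R' - 1))))) \<le> (80 + 8 * C) * \<epsilon>"
proof -
  have finR: "finite R" "finite R'" using fin S by auto
  let ?m = "\<lambda>\<sigma> \<tau> i j. c (\<sigma> i) (\<tau> j)"
  let ?e = "\<lambda>\<sigma> \<tau>. perm_avg R (\<lambda>\<alpha>. perm_avg R' (\<lambda>\<beta>. (dist01 (lin (?m \<sigma> \<tau>) R \<alpha> + lin (?m \<sigma> \<tau>) R' \<beta>))\<^sup>2))"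
  have "perm_avg S (\<lambda>\<sigma>. perm_avg S (\<lambda>\<tau>.
      (block_mass (?m \<sigma> \<tau>) R R / (4 * (card R)\<^sup>2 * (card R - 1))) *
      (block_mass (?m \<sigma> \<tau>) R' R' / (4 * (card R')\<^sup>2 * (card R' - 1)))))
    \<le> perm_avg S (\<lambda>\<sigma>. perm_avg S (\<lambda>\<tau>. (80 + 8 * C) * ?e \<sigma> \<tau>))"
    unfolding variance_lin[OF finR(1), symmetric] variance_lin[OF finR(2), symmetric]
    by (intro perm_avg_mono variance_product_le finR) (unfold variance_lin[OF finR(1)], rule C)
  also have "\<dots> = (80 + 8 * C) * perm_avg S (\<lambda>\<sigma>. perm_avg S (\<lambda>\<tau>. ?e \<sigma> \<tau>))"
    by (simp only: perm_avg_cmult)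
  also have "perm_avg S (\<lambda>\<sigma>. perm_avg S (\<lambda>\<tau>. ?e \<sigma> \<tau>)) =
      perm_avg S (\<lambda>\<sigma>. perm_avg S (\<lambda>p. (dist01 (lin c S p))\<^sup>2))"
  proof (rule perm_avg_cong)
    fix \<sigma> assume \<sigma>: "\<sigma> permutes S"
    \<comment> \<open>With \<tau> averaged innermost, the permutation is \<tau> composed with a
      fixed one, hence already uniform for fixed \<sigma>, \<alpha>, \<beta>.\<close>
    have "perm_avg S (\<lambda>\<tau>. ?e \<sigma> \<tau>) = perm_avg R (\<lambda>\<alpha>. perm_avg R' (\<lambda>\<beta>. perm_avg S (\<lambda>\<tau>.
        (dist01 (lin (?m \<sigma> \<tau>) R \<alpha> + lin (?m \<sigma> \<tau>) R' \<beta>))\<^sup>2)))"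
      unfolding perm_avg_swap[of S] perm_avg_swap[of S R'] ..
    also have "\<dots> = perm_avg R (\<lambda>\<alpha>. perm_avg R' (\<lambda>\<beta>. perm_avg S (\<lambda>p. (dist01 (lin c S p))\<^sup>2)))"
    proof (rule perm_avg_cong, rule perm_avg_cong)
      fix \<alpha> \<beta> assume \<alpha>: "\<alpha> permutes R" and \<beta>: "\<beta> permutes R'"
      have q: "\<alpha> \<circ> \<beta> \<circ> inv \<sigma> permutes S"
        using permutes_union_compose[OF \<alpha> \<beta>] \<sigma> S(1) by simp
      show "perm_avg S (\<lambda>\<tau>. (dist01 (lin (?m \<sigma> \<tau>) R \<alpha> + lin (?m \<sigma> \<tau>) R' \<beta>))\<^sup>2) =
        perm_avg S (\<lambda>p. (dist01 (lin c S p))\<^sup>2)"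
        unfolding lin_split[OF S fin \<sigma> \<alpha> \<beta>]
        by (rule perm_avg_compose_right[OF q, of "\<lambda>p. (dist01 (lin c S p))\<^sup>2"])
    qed
    finally show "perm_avg S (\<lambda>\<tau>. ?e \<sigma> \<tau>) = perm_avg S (\<lambda>p. (dist01 (lin c S p))\<^sup>2)"
      by (simp add: perm_avg_const finR)
  qed
  also have "\<dots> \<le> \<epsilon>" using e by (simp add: perm_avg_const fin)
  finally show ?thesis using C0 by (simp add: mult_left_mono)
qed

section \<open>Pairs of differences without a common row or column\<close>

definition off_diag :: "'a set \<Rightarrow> ('a \<times> 'a) set"
  where "off_diag R = {(i, k). i \<in> R \<and> k \<in> R \<and> i \<noteq> k}"

lemma off_diag_alt: "off_diag R = R \<times> R - (\<lambda>x. (x, x)) ` R"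
  by (auto simp: off_diag_def)

lemma card_off_diag:
  assumes "finite R"
  shows "card (off_diag R) = card R * (card R - 1)"
proof -
  have "card (off_diag R) = card (R \<times> R) - card ((\<lambda>x. (x, x)) ` R)"
    unfolding off_diag_alt using assms by (intro card_Diff_subset) auto
  also have "card ((\<lambda>x. (x, x)) ` R) = card R" by (intro card_image) (auto simp: inj_on_def)
  finally show ?thesis by (simp add: card_cartesian_product right_diff_distrib')
qed

lemma block_mass_off_diag:
  assumes "finite I" "finite J"
  shows "block_mass c I J = (\<Sum>x\<in>off_diag I. \<Sum>y\<in>off_diag J. (mixed_diff c (fst x) (snd x) (fst y) (snd y))\<^sup>2)"
proof -
  have pairs: "(\<Sum>x\<in>A. \<Sum>y\<in>A. G x y) = (\<Sum>x\<in>A \<times> A. G (fst x) (snd x))" for A and G :: "nat \<Rightarrow> nat \<Rightarrow> real"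
    by (simp add: sum.cartesian_product split_def)
  have "block_mass c I J = (\<Sum>x\<in>I \<times> I. \<Sum>y\<in>J \<times> J. (mixed_diff c (fst x) (snd x) (fst y) (snd y))\<^sup>2)"
    unfolding block_mass_def pairs ..
  also have "\<dots> = (\<Sum>x\<in>off_diag I. \<Sum>y\<in>J \<times> J. (mixed_diff c (fst x) (snd x) (fst y) (snd y))\<^sup>2)"
    using assms by (intro sum.mono_neutral_right) (auto simp: off_diag_def)
  also have "\<dots> = (\<Sum>x\<in>off_diag I. \<Sum>y\<in>off_diag J. (mixed_diff c (fst x) (snd x) (fst y) (snd y))\<^sup>2)"
    using assms by (intro sum.cong[OF refl] sum.mono_neutral_right) (auto simp: off_diag_def)
  finally show ?thesis .
qed

definition disjoint_mass :: "(nat \<Rightarrow> nat \<Rightarrow> real) \<Rightarrow> nat set \<Rightarrow> real"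
  where "disjoint_mass c S = (\<Sum>i\<in>S. \<Sum>k\<in>S. \<Sum>j\<in>S. \<Sum>l\<in>S.
    (mixed_diff c i k j l)\<^sup>2 * block_mass c (S - {i, k}) (S - {j, l}))"

text \<open>The four-point bound is applied once to the rows and once to the columns; each
  application costs a fourth power of the size of \<open>S\<close>.\<close>

lemma perm_avg_product_ge:
  assumes fin: "finite S"
    and x: "distinct [i, k, i', k']" "{i, k, i', k'} \<subseteq> S"
    and y: "distinct [j, l, j', l']" "{j, l, j', l'} \<subseteq> S"
  shows "disjoint_mass c S / card S ^ 8 \<le> perm_avg S (\<lambda>\<sigma>. perm_avg S (\<lambda>\<tau>.
      (mixed_diff c (\<sigma> i) (\<sigma> k) (\<tau> j) (\<tau> l))\<^sup>2 * (mixed_diff c (\<sigma> i') (\<sigma> k') (\<tau> j') (\<tau> l'))\<^sup>2))"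
proof -
  let ?w = "\<lambda>i k j l. (mixed_diff c i k j l)\<^sup>2"
  let ?\<phi> = "\<lambda>p q r s. \<Sum>u\<in>S. \<Sum>v\<in>S. \<Sum>a\<in>S - {u, v}. \<Sum>b\<in>S - {u, v}. ?w p q u v * ?w r s a b"
  have "(\<Sum>p\<in>S. \<Sum>q\<in>S. \<Sum>r\<in>S - {p, q}. \<Sum>s\<in>S - {p, q}. ?\<phi> p q r s) = disjoint_mass c S"
    unfolding disjoint_mass_def
  proof (intro sum.cong[OF refl])
    fix p q
    let ?A = "S - {p, q}"
    have "(\<Sum>r\<in>?A. \<Sum>s\<in>?A. ?\<phi> p q r s) = (\<Sum>r\<in>?A. \<Sum>u\<in>S. \<Sum>s\<in>?A. \<Sum>v\<in>S. \<Sum>a\<in>S - {u, v}. \<Sum>b\<in>S - {u, v}. ?w p q u v * ?w r s a b)"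
      by (intro sum.cong refl sum.swap)
    also have "\<dots> = (\<Sum>u\<in>S. \<Sum>r\<in>?A. \<Sum>v\<in>S. \<Sum>s\<in>?A. \<Sum>a\<in>S - {u, v}. \<Sum>b\<in>S - {u, v}. ?w p q u v * ?w r s a b)"
      by (subst sum.swap) (intro sum.cong refl sum.swap)
    also have "\<dots> = (\<Sum>u\<in>S. \<Sum>v\<in>S. \<Sum>r\<in>?A. \<Sum>s\<in>?A. \<Sum>a\<in>S - {u, v}. \<Sum>b\<in>S - {u, v}. ?w p q u v * ?w r s a b)"
      by (intro sum.cong refl sum.swap)
    finally show "(\<Sum>r\<in>?A. \<Sum>s\<in>?A. ?\<phi> p q r s) = (\<Sum>u\<in>S. \<Sum>v\<in>S. ?w p q u v * block_mass c ?A (S - {u, v}))"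
      by (simp add: block_mass_def sum_distrib_left)
  qed
  then have "disjoint_mass c S / card S ^ 4 =
      (\<Sum>p\<in>S. \<Sum>q\<in>S. \<Sum>r\<in>S - {p, q}. \<Sum>s\<in>S - {p, q}. ?\<phi> p q r s) / card S ^ 4"
    by simp
  also have "\<dots> \<le> perm_avg S (\<lambda>\<sigma>. ?\<phi> (\<sigma> i) (\<sigma> k) (\<sigma> i') (\<sigma> k'))"
    using x by (intro perm_avg_four_ge[OF fin, of i k i' k' ?\<phi>] sum_nonneg mult_nonneg_nonneg) auto
  finally have "disjoint_mass c S / card S ^ 4 / card S ^ 4 \<le>
    perm_avg S (\<lambda>\<sigma>. ?\<phi> (\<sigma> i) (\<sigma> k) (\<sigma> i') (\<sigma> k')) / card S ^ 4"
    by (intro divide_right_mono) auto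
  also have "\<dots> = perm_avg S (\<lambda>\<sigma>. ?\<phi> (\<sigma> i) (\<sigma> k) (\<sigma> i') (\<sigma> k') / card S ^ 4)"
    by (simp add: perm_avg_def sum_divide_distrib divide_divide_eq_left mult.commute)
  also have "\<dots> \<le> perm_avg S (\<lambda>\<sigma>. perm_avg S (\<lambda>\<tau>. ?w (\<sigma> i) (\<sigma> k) (\<tau> j) (\<tau> l) * ?w (\<sigma> i') (\<sigma> k') (\<tau> j') (\<tau> l')))"
  proof (rule perm_avg_mono)
    fix \<sigma>
    show "?\<phi> (\<sigma> i) (\<sigma> k) (\<sigma> i') (\<sigma> k') / card S ^ 4 \<le>
      perm_avg S (\<lambda>\<tau>. ?w (\<sigma> i) (\<sigma> k) (\<tau> j) (\<tau> l) * ?w (\<sigma> i') (\<sigma> k') (\<tau> j') (\<tau> l'))"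
      using y by (intro perm_avg_four_ge[OF fin, of j l j' l' "\<lambda>u v a b. ?w (\<sigma> i) (\<sigma> k) u v * ?w (\<sigma> i') (\<sigma> k') a b"]) auto
  qed
  finally show ?thesis by (simp add: power_add[symmetric])
qed

text \<open>Both masses are expanded over ordered pairs of distinct indices. Rows and columns from
  \<open>R\<close> and from \<open>R'\<close> are automatically disjoint, so every term has the same
  lower bound and only the number of terms matters.\<close>

lemma perm_avg_block_mass_product_ge:
  fixes c :: "nat \<Rightarrow> nat \<Rightarrow> real"
  assumes S: "S = R \<union> R'" "R \<inter> R' = {}" and fin: "finite S"
  shows "(card (off_diag R) * card (off_diag R'))\<^sup>2 * (disjoint_mass c S / card S ^ 8) \<le>
    perm_avg S (\<lambda>\<sigma>. perm_avg S (\<lambda>\<tau>. block_mass (\<lambda>i j. c (\<sigma> i) (\<tau> j)) R R * block_mass (\<lambda>i j. c (\<sigma> i) (\<tau> j)) R' R'))"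
proof -
  have finR: "finite R" "finite R'" using fin S by auto
  let ?D = "off_diag R" and ?D' = "off_diag R'"
  let ?w = "\<lambda>\<sigma> \<tau> x y. (mixed_diff c (\<sigma> (fst x)) (\<sigma> (snd x)) (\<tau> (fst y)) (\<tau> (snd y)))\<^sup>2"
  have m: "mixed_diff (\<lambda>i j. c (\<sigma> i) (\<tau> j)) i k j l = mixed_diff c (\<sigma> i) (\<sigma> k) (\<tau> j) (\<tau> l)" for \<sigma> \<tau> i j k l
    by (simp add: mixed_diff_def)
  have prod: "block_mass (\<lambda>i j. c (\<sigma> i) (\<tau> j)) R R * block_mass (\<lambda>i j. c (\<sigma> i) (\<tau> j)) R' R' =
      (\<Sum>x\<in>?D. \<Sum>x'\<in>?D'. \<Sum>y\<in>?D. \<Sum>y'\<in>?D'. ?w \<sigma> \<tau> x y * ?w \<sigma> \<tau> x' y')" for \<sigma> \<tau>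
    unfolding block_mass_off_diag[OF finR(1) finR(1)] block_mass_off_diag[OF finR(2) finR(2)] m[of \<sigma> \<tau>] sum_product ..
  have "(card ?D * card ?D')\<^sup>2 * (disjoint_mass c S / card S ^ 8) =
    (\<Sum>x\<in>?D. \<Sum>x'\<in>?D'. \<Sum>y\<in>?D. \<Sum>y'\<in>?D'. disjoint_mass c S / card S ^ 8)"
    by (simp add: power2_eq_square)
  also have "\<dots> \<le> (\<Sum>x\<in>?D. \<Sum>x'\<in>?D'. \<Sum>y\<in>?D. \<Sum>y'\<in>?D'.
      perm_avg S (\<lambda>\<sigma>. perm_avg S (\<lambda>\<tau>. ?w \<sigma> \<tau> x y * ?w \<sigma> \<tau> x' y')))"
    using S by (intro sum_mono perm_avg_product_ge fin) (auto simp: off_diag_def)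
  also have "\<dots> = perm_avg S (\<lambda>\<sigma>. perm_avg S (\<lambda>\<tau>.
      (\<Sum>x\<in>?D. \<Sum>x'\<in>?D'. \<Sum>y\<in>?D. \<Sum>y'\<in>?D'. ?w \<sigma> \<tau> x y * ?w \<sigma> \<tau> x' y')))"
    by (simp only: perm_avg_sum)
  also have "\<dots> = perm_avg S (\<lambda>\<sigma>. perm_avg S (\<lambda>\<tau>. block_mass (\<lambda>i j. c (\<sigma> i) (\<tau> j)) R R * block_mass (\<lambda>i j. c (\<sigma> i) (\<tau> j)) R' R'))"
    by (simp only: prod)
  finally show ?thesis .
qed

text \<open>Upper and lower bound for the mean product of the masses of the two blocks are compared.
  With n \<ge> 4 each half has at least two elements, so both normalising factors are
  positive.\<close>

theorem disjoint_mass_le: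
  assumes n: "n \<ge> 4" and \<epsilon>: "\<epsilon> \<le> 1"
    and e: "perm_avg {1..n} (\<lambda>p. (dist01 (lin c {1..n} p))\<^sup>2) \<le> \<epsilon>"
  shows "disjoint_mass c {1..n} \<le> 450560 * real n ^ 6 * \<epsilon>"
proof -
  let ?S = "{1..n}"
  define m where "m = n div 2"
  define m' where "m' = n - m"
  define R where "R = {1..m}"
  define R' where "R' = {Suc m..n}"
  have S: "?S = R \<union> R'" "R \<inter> R' = {}" by (auto simp: R_def R'_def m_def)
  have card: "card R = m" "card R' = m'" by (auto simp: R_def R'_def m'_def m_def)
  have m2: "m \<ge> 2" "m' \<ge> 2" "m \<le> n" "m + m' = n" "n \<le> 2 * m + 1" "2 * m \<le> n"
    using n by (auto simp: m_def m'_def)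
  define k where "k = 4 * (real m)\<^sup>2 * (real m - 1)"
  define k' where "k' = 4 * (real m')\<^sup>2 * (real m' - 1)"
  have k0: "k > 0" "k' > 0" using m2 by (auto simp: k_def k'_def)
  have kk: "k = 4 * (card R)\<^sup>2 * (card R - 1)" "k' = 4 * (card R')\<^sup>2 * (card R' - 1)"
    using m2 by (auto simp: k_def k'_def card of_nat_diff)
  have \<epsilon>0: "0 \<le> \<epsilon>" using e perm_avg_nonneg[of ?S "\<lambda>p. (dist01 (lin c ?S p))\<^sup>2"] by simp
  define M where "M = block_mass c ?S ?S"
  have M0: "M \<ge> 0" by (simp add: M_def block_mass_nonneg)
  have "M / (4 * (card ?S)\<^sup>2 * (card ?S - 1)) \<le> 4"
    using variance_le_of_dist01[of ?S "lin c ?S", OF _ e] \<epsilon> by (simp add: variance_lin M_def)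
  then have "M \<le> 16 * (real n)\<^sup>2 * (real n - 1)"
    using n by (simp add: divide_le_eq of_nat_diff)
  \<comment> \<open>For m \<ge> 2 and n \<le> 2 m + 1 one has n \<le> 5 m / 2 and n - 1 \<le> 4 (m -
    1). This is the source of the bound 100 on the block variance and of 880 = 80 + 8 * 100.\<close>
  also have "\<dots> \<le> 16 * (5/2 * real m)\<^sup>2 * (4 * (real m - 1))"
    using m2 by (intro mult_mono power_mono) auto
  also have "\<dots> = 100 * k" by (simp add: k_def power2_eq_square)
  finally have M: "M \<le> 100 * k" .
  have C: "block_mass (\<lambda>i j. c (\<sigma> i) (\<tau> j)) R R / (4 * (card R)\<^sup>2 * (card R - 1)) \<le> 100"
    if "\<sigma> permutes ?S" "\<tau> permutes ?S" for \<sigma> \<tau>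
  proof -
    have "block_mass (\<lambda>i j. c (\<sigma> i) (\<tau> j)) R R \<le> block_mass (\<lambda>i j. c (\<sigma> i) (\<tau> j)) ?S ?S"
      by (intro block_mass_mono) (auto simp: R_def m_def)
    also have "\<dots> = M" unfolding M_def
      using that by (intro block_mass_reindex permutes_imp_bij)
    finally show ?thesis using M k0 unfolding kk[symmetric] by (simp add: divide_le_eq)
  qed
  have "perm_avg ?S (\<lambda>\<sigma>. perm_avg ?S (\<lambda>\<tau>. (block_mass (\<lambda>i j. c (\<sigma> i) (\<tau> j)) R R / k) *
      (block_mass (\<lambda>i j. c (\<sigma> i) (\<tau> j)) R' R' / k'))) \<le> (80 + 8 * 100) * \<epsilon>"
    unfolding kk by (rule split_product_le[OF S _ e C]) auto
  then have "perm_avg ?S (\<lambda>\<sigma>. perm_avg ?S (\<lambda>\<tau>. (1 / (k * k')) * (block_mass (\<lambda>i j. c (\<sigma> i) (\<tau> j)) R R *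
      block_mass (\<lambda>i j. c (\<sigma> i) (\<tau> j)) R' R'))) \<le> 880 * \<epsilon>"
    by simp
  then have "perm_avg ?S (\<lambda>\<sigma>. perm_avg ?S (\<lambda>\<tau>. block_mass (\<lambda>i j. c (\<sigma> i) (\<tau> j)) R R *
      block_mass (\<lambda>i j. c (\<sigma> i) (\<tau> j)) R' R')) \<le> 880 * \<epsilon> * (k * k')"
    unfolding perm_avg_cmult using k0 by (simp add: divide_le_eq)
  with perm_avg_block_mass_product_ge[OF S, of c]
  have "(card (off_diag R) * card (off_diag R'))\<^sup>2 * (disjoint_mass c ?S / card ?S ^ 8) \<le> 880 * \<epsilon> * (k * k')"
    by (meson finite_atLeastAtMost order_trans)
  moreover have "real (card (off_diag R)) = real m * (real m - 1)" "real (card (off_diag R')) = real m' * (real m' - 1)"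
    using m2 card_off_diag[of R] card_off_diag[of R'] unfolding card by (simp_all add: R_def R'_def of_nat_diff)
  moreover define D where "D = disjoint_mass c ?S"
  ultimately have 1: "(real m * (real m - 1) * (real m' * (real m' - 1)))\<^sup>2 * (D / real n ^ 8) \<le>
      880 * \<epsilon> * (k * k')"
    by simp
  define a where "a = (real m)\<^sup>2 * (real m')\<^sup>2 * ((real m - 1) * (real m' - 1))"
  define b where "b = (real m - 1) * (real m' - 1)"
  have a0: "a > 0" using m2 by (simp add: a_def)
  have "(real m * (real m - 1) * (real m' * (real m' - 1)))\<^sup>2 * x = a * (b * x)" for x
    unfolding a_def b_def power2_eq_square by (simp only: ac_simps)
  moreover have "880 * \<epsilon> * (k * k') = a * (14080 * \<epsilon>)"
    unfolding a_def k_def k'_def by simp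
  ultimately have "a * (b * (D / real n ^ 8)) \<le> a * (14080 * \<epsilon>)"
    using 1 by metis
  then have "b * (D / real n ^ 8) \<le> 14080 * \<epsilon>"
    using a0 by (rule mult_left_le_imp_le)
  then have 2: "b * D \<le> 14080 * \<epsilon> * real n ^ 8" using n by (simp add: field_simps)
  \<comment> \<open>Both factors are tight enough down to n = 4; they turn 14080 = 16 * 880 into
    450560 = 32 * 14080.\<close>
  have "(real n / 8) * (real n / 4) \<le> b"
    unfolding b_def using m2 n by (intro mult_mono) auto
  then have "(real n / 8) * (real n / 4) * D \<le> b * D"
    by (intro mult_right_mono) (auto simp: D_def disjoint_mass_def intro!: sum_nonneg mult_nonneg_nonneg block_mass_nonneg)
  with 2 have "(real n)\<^sup>2 * D \<le> (real n)\<^sup>2 * (450560 * real n ^ 6 * \<epsilon>)"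
    by (simp add: power2_eq_square numeral_eq_Suc algebra_simps)
  then show ?thesis using n by (simp add: D_def)
qed

section \<open>Conditioning on one line\<close>

text \<open>Transposing the matrix corresponds to inverting the permutation, which preserves the
  uniform measure and exchanges row and column dictators. Every statement about columns is derived
  from the one about rows in this way.\<close>

definition flipped :: "(nat \<Rightarrow> nat \<Rightarrow> real) \<Rightarrow> nat \<Rightarrow> nat \<Rightarrow> real"
  where "flipped c i j = c j i"

lemma mixed_diff_flipped: "mixed_diff (flipped c) j l i k = mixed_diff c i k j l"
  by (simp add: mixed_diff_def flipped_def)

lemma block_mass_flipped: "block_mass (flipped c) J I = block_mass c I J"
proof -
  have "block_mass (flipped c) J I = (\<Sum>j\<in>J. \<Sum>l\<in>J. \<Sum>i\<in>I. \<Sum>k\<in>I. (mixed_diff c i k j l)\<^sup>2)"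
    by (simp add: block_mass_def mixed_diff_flipped)
  also have "\<dots> = (\<Sum>j\<in>J. \<Sum>i\<in>I. \<Sum>l\<in>J. \<Sum>k\<in>I. (mixed_diff c i k j l)\<^sup>2)"
    by (intro sum.cong refl sum.swap)
  also have "\<dots> = (\<Sum>i\<in>I. \<Sum>j\<in>J. \<Sum>k\<in>I. \<Sum>l\<in>J. (mixed_diff c i k j l)\<^sup>2)"
    by (subst sum.swap) (intro sum.cong refl sum.swap)
  also have "\<dots> = block_mass c I J"
    unfolding block_mass_def by (intro sum.cong refl sum.swap)
  finally show ?thesis .
qed

lemma lin_flipped:
  assumes "p permutes S"
  shows "lin (flipped c) S p = lin c S (inv p)"
  using sum.permute[OF assms, of "\<lambda>i. c i (inv p i)"] permutes_inverses(2)[OF assms]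
  by (simp add: lin_def flipped_def o_def)

lemma perm_avg_lin_flipped: "perm_avg S (\<lambda>p. \<phi> (lin (flipped c) S p)) = perm_avg S (\<lambda>p. \<phi> (lin c S p))"
proof -
  have "perm_avg S (\<lambda>p. \<phi> (lin (flipped c) S p)) = perm_avg S (\<lambda>p. \<phi> (lin c S (inv p)))"
    by (intro perm_avg_cong) (simp add: lin_flipped)
  also have "\<dots> = perm_avg S (\<lambda>p. \<phi> (lin c S p))"
    by (rule perm_avg_inv[of S "\<lambda>p. \<phi> (lin c S p)"])
  finally show ?thesis .
qed

lemma dictator_inv:
  assumes "dictator n g"
  shows "dictator n (\<lambda>p. g (inv p))"
proof -
  obtain C where C: "C \<subseteq> {1..n} \<times> {1..n}"
    "(\<forall>p\<in>C. \<forall>q\<in>C. fst p = fst q) \<or> (\<forall>p\<in>C. \<forall>q\<in>C. snd p = snd q)"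
    "\<And>\<pi>. \<pi> \<in> Sn n \<Longrightarrow> g \<pi> = (\<Sum>(i, j)\<in>C. perm_ind i j \<pi>)"
    using assms unfolding dictator_def by blast
  have "g (inv \<pi>) = (\<Sum>(i, j)\<in>prod.swap ` C. perm_ind i j \<pi>)" if "\<pi> \<in> Sn n" for \<pi>
  proof -
    have \<pi>: "\<pi> permutes {1..n}" using that by (simp add: Sn_def)
    then have "g (inv \<pi>) = (\<Sum>(i, j)\<in>C. perm_ind i j (inv \<pi>))"
      by (intro C) (simp add: Sn_def permutes_inv)
    also have "\<dots> = (\<Sum>(i, j)\<in>C. perm_ind j i \<pi>)"
      using permutes_inv_eq[OF \<pi>] by (intro sum.cong refl) (auto simp: perm_ind_def)
    also have "\<dots> = (\<Sum>(i, j)\<in>prod.swap ` C. perm_ind i j \<pi>)"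
      by (subst sum.reindex) (auto simp: split_def)
    finally show ?thesis .
  qed
  moreover have "prod.swap ` C \<subseteq> {1..n} \<times> {1..n}" using C(1) by auto
  moreover have "(\<forall>p\<in>prod.swap ` C. \<forall>q\<in>prod.swap ` C. fst p = fst q) \<or>
      (\<forall>p\<in>prod.swap ` C. \<forall>q\<in>prod.swap ` C. snd p = snd q)"
    using C(2) by auto
  ultimately show ?thesis unfolding dictator_def by blast
qed

text \<open>The decomposition into the value \<open>b\<close> at \<open>i\<close> and a permutation
  \<open>q\<close> that fixes \<open>i\<close> is conditioning on \<open>p i = b\<close>; all values
  are equally likely.\<close>

lemma perm_avg_condition:
  assumes fin: "finite S" and i: "i \<in> S"
  shows "perm_avg S F = (\<Sum>b\<in>S. perm_avg (S - {i}) (\<lambda>q. F (Transposition.transpose i b \<circ> q))) / card S"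
proof -
  have S: "S = insert i (S - {i})" using i by auto
  have "card S > 0" using assms by (auto simp: card_gt_0_iff)
  then obtain m where m: "card S = Suc m" by (metis Suc_pred)
  have "(\<Sum>p | p permutes S. F p) =
      (\<Sum>b\<in>S. \<Sum>q | q permutes S - {i}. F (Transposition.transpose i b \<circ> q))"
    using sum_over_permutations_insert[of "S - {i}" i F] fin S by simp
  then show ?thesis
    using fin i m by (simp add: perm_avg_def sum_divide_distrib[symmetric])
qed

lemma lin_transpose_compose:
  assumes fin: "finite S" and i: "i \<in> S" and q: "q permutes S - {i}"
  shows "lin c S (Transposition.transpose i b \<circ> q) =
    c i b + lin (\<lambda>k j. c k (Transposition.transpose i b j)) (S - {i}) q"
  using permutes_not_in[OF q, of i] i fin by (simp add: lin_def sum.remove)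

text \<open>\<open>u\<close> is the conditional expectation given the value at \<open>i\<close>.
  Given that value \<open>b\<close>, the other rows are matched uniformly with the columns other
  than \<open>b\<close>, so the conditional variance comes from a block inside
  \<open>(S - {i}) \<times> S\<close>.\<close>

lemma row_conditional_variance:
  assumes fin: "finite S" and i: "i \<in> S"
  obtains u where "perm_avg S (\<lambda>p. (lin c S p - u (p i))\<^sup>2) \<le>
    block_mass c (S - {i}) S / (4 * (card (S - {i}))\<^sup>2 * (card (S - {i}) - 1))"
proof -
  let ?R = "S - {i}" and ?k = "real (4 * (card (S - {i}))\<^sup>2 * (card (S - {i}) - 1))"
  let ?c = "\<lambda>b k j. c k (Transposition.transpose i b j)"
  define u where "u b = c i b + perm_avg ?R (lin (?c b) ?R)" for b
  have finR: "finite ?R" using fin by simp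
  have cardS: "card S > 0" using fin i by (auto simp: card_gt_0_iff)
  have "perm_avg S (\<lambda>p. (lin c S p - u (p i))\<^sup>2) =
    (\<Sum>b\<in>S. perm_avg ?R (\<lambda>q. (lin c S (Transposition.transpose i b \<circ> q) - u ((Transposition.transpose i b \<circ> q) i))\<^sup>2)) / card S"
    by (rule perm_avg_condition[OF fin i])
  also have "\<dots> \<le> (\<Sum>b\<in>S. block_mass c ?R S / ?k) / card S"
  proof (intro divide_right_mono sum_mono)
    fix b assume b: "b \<in> S"
    have "perm_avg ?R (\<lambda>q. (lin c S (Transposition.transpose i b \<circ> q) - u ((Transposition.transpose i b \<circ> q) i))\<^sup>2) =
      perm_avg ?R (\<lambda>q. (lin (?c b) ?R q - perm_avg ?R (lin (?c b) ?R))\<^sup>2)"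
    proof (rule perm_avg_cong)
      fix q assume q: "q permutes ?R"
      then have "q i = i" by (simp add: permutes_not_in)
      then show "(lin c S (Transposition.transpose i b \<circ> q) - u ((Transposition.transpose i b \<circ> q) i))\<^sup>2 =
          (lin (?c b) ?R q - perm_avg ?R (lin (?c b) ?R))\<^sup>2"
        by (simp add: lin_transpose_compose[OF fin i q] u_def)
    qed
    also have "\<dots> = block_mass (?c b) ?R ?R / ?k" by (rule variance_lin[OF finR])
    also have "block_mass (?c b) ?R ?R = block_mass c ?R (S - {b})"
    proof -
      have "bij_betw (Transposition.transpose i b) ?R (S - {b})"
        using b i by (intro bij_betwI[where g = "Transposition.transpose i b"])
          (auto simp: Transposition.transpose_def)
      moreover have "bij_betw (\<lambda>x. x) ?R ?R" by (simp add: bij_betw_def)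
      ultimately show ?thesis using block_mass_reindex[of "\<lambda>x. x"] by blast
    qed
    also have "block_mass c ?R (S - {b}) / ?k \<le> block_mass c ?R S / ?k"
      using fin by (intro divide_right_mono block_mass_mono) auto
    finally show "perm_avg ?R (\<lambda>q. (lin c S (Transposition.transpose i b \<circ> q) - u ((Transposition.transpose i b \<circ> q) i))\<^sup>2)
      \<le> block_mass c ?R S / ?k" .
  qed simp
  also have "\<dots> = block_mass c ?R S / ?k" using cardS by simp
  finally show ?thesis using that by blast
qed

lemma row_indicator_dictator:
  assumes "i \<in> {1..n}"
  shows "dictator n (\<lambda>p. if P (p i) then 1 else 0)"
  unfolding dictator_def
proof (intro exI conjI ballI)
  let ?C = "{i} \<times> {j \<in> {1..n}. P j}"
  show "?C \<subseteq> {1..n} \<times> {1..n}" using assms by auto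
  show "(\<forall>p\<in>?C. \<forall>q\<in>?C. fst p = fst q) \<or> (\<forall>p\<in>?C. \<forall>q\<in>?C. snd p = snd q)" by auto
  fix \<pi> assume "\<pi> \<in> Sn n"
  then have \<pi>: "\<pi> i \<in> {1..n}" using assms permutes_in_image[of \<pi> "{1..n}" i] by (simp add: Sn_def)
  have "(\<Sum>(i, j)\<in>?C. perm_ind i j \<pi>) = (\<Sum>j\<in>{j \<in> {1..n}. P j}. perm_ind i j \<pi>)"
    by (simp add: sum.cartesian_product[symmetric])
  also have "\<dots> = (if P (\<pi> i) then 1 else 0)"
    using \<pi> by (auto simp: perm_ind_def sum.delta')
  finally show "(if P (\<pi> i) then 1 else 0) = (\<Sum>(i, j)\<in>?C. perm_ind i j \<pi>)" by simp
qed

lemma row_dictator: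
  assumes i: "i \<in> {1..n}"
    and e: "perm_avg {1..n} (\<lambda>p. (dist01 (lin c {1..n} p))\<^sup>2) \<le> \<epsilon>"
    and X: "block_mass c ({1..n} - {i}) {1..n} \<le> X * real n ^ 3"
  shows "\<exists>g. dictator n g \<and> perm_avg {1..n} (\<lambda>p. (lin c {1..n} p - g p)\<^sup>2) \<le> 12 * X + 4 * \<epsilon>"
proof -
  let ?S = "{1..n}"
  have n: "n \<ge> 1" using i by simp
  have card: "card (?S - {i}) = n - 1" using i by simp
  obtain u where u: "perm_avg ?S (\<lambda>p. (lin c ?S p - u (p i))\<^sup>2) \<le>
    block_mass c (?S - {i}) ?S / (4 * (card (?S - {i}))\<^sup>2 * (card (?S - {i}) - 1))"
    using row_conditional_variance[of ?S i c] i by auto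
  have "block_mass c (?S - {i}) ?S / (4 * (card (?S - {i}))\<^sup>2 * (card (?S - {i}) - 1)) \<le> 2 * X"
  proof (cases "n \<ge> 3")
    case True
    then obtain k where k: "n = k + 3" using le_Suc_ex[of 3 n] by auto
    have X0: "X \<ge> 0"
      using order_trans[OF block_mass_nonneg X] n by (simp add: zero_le_mult_iff)
    have "real n ^ 3 \<le> 8 * (real (n - 1))\<^sup>2 * real (n - 2)"
      unfolding k by (simp add: power2_eq_square numeral_eq_Suc algebra_simps)
    then have "X * real n ^ 3 \<le> X * (8 * (real (n - 1))\<^sup>2 * real (n - 2))" using X0 by (rule mult_left_mono)
    then have "block_mass c (?S - {i}) ?S \<le> 2 * X * (4 * (real (n - 1))\<^sup>2 * real (n - 2))" using X by linarith
    then show ?thesis unfolding card using True by (simp add: divide_le_eq)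
  next
    \<comment> \<open>For n \<le> 2 the denominator is 0, so the quotient is 0 by the convention for
      division; nothing is random once the value at \<open>i\<close> is known.\<close>
    case False
    have "X \<ge> 0"
      using order_trans[OF block_mass_nonneg X] n by (simp add: zero_le_mult_iff)
    moreover have "n = 1 \<or> n = 2" using False n by auto
    ultimately show ?thesis unfolding card by auto
  qed
  then have u2: "perm_avg ?S (\<lambda>p. (lin c ?S p - u (p i))\<^sup>2) \<le> 2 * X" by (rule order_trans[OF u])
  \<comment> \<open>The conditional expectation is rounded to the nearer of 0 and 1. The rounding
    error is the distance of \<open>u\<close> to {0, 1}, at most that of f plus \<bar>f - u\<bar>;
    squaring with (a + b)^2 \<le> 2 a^2 + 2 b^2 gives 6 and 4.\<close>
  define g :: "(nat \<Rightarrow> nat) \<Rightarrow> real" where "g p = (if u (p i) > 1 / 2 then 1 else 0)" for p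
  have point: "(lin c ?S p - g p)\<^sup>2 \<le> 6 * (lin c ?S p - u (p i))\<^sup>2 + 4 * (dist01 (lin c ?S p))\<^sup>2" for p
  proof -
    define y where "y = lin c ?S p"
    define v where "v = u (p i)"
    have sq: "(a + b)\<^sup>2 \<le> 2 * a\<^sup>2 + 2 * b\<^sup>2" for a b :: real
      using zero_le_power2[of "a - b"] by (simp add: power2_eq_square algebra_simps)
    have "dist01 v \<le> dist01 y + \<bar>y - v\<bar>" by (auto simp: dist01_def)
    then have "(dist01 v)\<^sup>2 \<le> (dist01 y + \<bar>y - v\<bar>)\<^sup>2" using dist01_nonneg by (intro power_mono)
    also have "\<dots> \<le> 2 * (dist01 y)\<^sup>2 + 2 * (y - v)\<^sup>2" using sq[of "dist01 y" "\<bar>y - v\<bar>"] by simp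
    finally have 1: "(dist01 v)\<^sup>2 \<le> 2 * (dist01 y)\<^sup>2 + 2 * (y - v)\<^sup>2" .
    have "\<bar>v - g p\<bar> = dist01 v" unfolding g_def v_def[symmetric] dist01_def by (auto simp: min_def)
    then have "(v - g p)\<^sup>2 = (dist01 v)\<^sup>2" by (metis power2_abs)
    moreover have "(y - g p)\<^sup>2 \<le> 2 * (y - v)\<^sup>2 + 2 * (v - g p)\<^sup>2" using sq[of "y - v" "v - g p"] by simp
    ultimately show ?thesis using 1 unfolding y_def v_def by linarith
  qed
  have "perm_avg ?S (\<lambda>p. (lin c ?S p - g p)\<^sup>2) \<le>
      perm_avg ?S (\<lambda>p. 6 * (lin c ?S p - u (p i))\<^sup>2 + 4 * (dist01 (lin c ?S p))\<^sup>2)"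
    using point by (intro perm_avg_mono)
  also have "\<dots> \<le> 12 * X + 4 * \<epsilon>" using u2 e by (simp add: perm_avg_add perm_avg_cmult)
  finally show ?thesis using row_indicator_dictator[OF i, of "\<lambda>j. u j > 1 / 2"] unfolding g_def by blast
qed

lemma column_dictator:
  assumes j: "j \<in> {1..n}"
    and e: "perm_avg {1..n} (\<lambda>p. (dist01 (lin c {1..n} p))\<^sup>2) \<le> \<epsilon>"
    and X: "block_mass c {1..n} ({1..n} - {j}) \<le> X * real n ^ 3"
  shows "\<exists>g. dictator n g \<and> perm_avg {1..n} (\<lambda>p. (lin c {1..n} p - g p)\<^sup>2) \<le> 12 * X + 4 * \<epsilon>"
proof -
  let ?S = "{1..n}"
  have "perm_avg ?S (\<lambda>p. (dist01 (lin (flipped c) ?S p))\<^sup>2) \<le> \<epsilon>"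
    using e unfolding perm_avg_lin_flipped[of ?S "\<lambda>y. (dist01 y)\<^sup>2"] .
  moreover have "block_mass (flipped c) (?S - {j}) ?S \<le> X * real n ^ 3"
    using X by (simp add: block_mass_flipped)
  ultimately obtain g where g: "dictator n g"
    "perm_avg ?S (\<lambda>p. (lin (flipped c) ?S p - g p)\<^sup>2) \<le> 12 * X + 4 * \<epsilon>"
    using row_dictator[OF j] by blast
  have "perm_avg ?S (\<lambda>p. (lin (flipped c) ?S p - g p)\<^sup>2) =
      perm_avg ?S (\<lambda>p. (lin (flipped c) ?S (inv p) - g (inv p))\<^sup>2)"
    by (rule perm_avg_inv[symmetric])
  also have "\<dots> = perm_avg ?S (\<lambda>p. (lin c ?S p - g (inv p))\<^sup>2)"
    by (intro perm_avg_cong) (simp add: lin_flipped permutes_inv permutes_inv_inv)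
  finally have "perm_avg ?S (\<lambda>p. (lin c ?S p - g (inv p))\<^sup>2) \<le> 12 * X + 4 * \<epsilon>"
    using g(2) by linarith
  with dictator_inv[OF g(1)] show ?thesis by (intro exI[of _ "\<lambda>p. g (inv p)"] conjI)
qed

section \<open>Heavy lines\<close>

text \<open>The counterpart for a column \<open>j\<close> is
  \<open>row_mass (flipped c) J I j\<close>.\<close>

definition row_mass :: "(nat \<Rightarrow> nat \<Rightarrow> real) \<Rightarrow> nat set \<Rightarrow> nat set \<Rightarrow> nat \<Rightarrow> real"
  where "row_mass c I J i = (\<Sum>k\<in>I. \<Sum>j\<in>J. \<Sum>l\<in>J. (mixed_diff c i k j l)\<^sup>2)"

lemma row_mass_nonneg: "0 \<le> row_mass c I J i"
  unfolding row_mass_def by (intro sum_nonneg) simp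

lemma sum_row_mass: "(\<Sum>i\<in>I. row_mass c I J i) = block_mass c I J"
  by (simp add: row_mass_def block_mass_def)

lemma mixed_diff_swap_rows: "(mixed_diff c k i j l)\<^sup>2 = (mixed_diff c i k j l)\<^sup>2"
  by (simp add: mixed_diff_def power2_eq_square algebra_simps)

lemma mixed_diff_swap_columns: "(mixed_diff c i k l j)\<^sup>2 = (mixed_diff c i k j l)\<^sup>2"
  by (simp add: mixed_diff_def power2_eq_square algebra_simps)

lemma row_mass_mono:
  assumes "I \<subseteq> I'" "J \<subseteq> J'" "finite I'" "finite J'"
  shows "row_mass c I J i \<le> row_mass c I' J' i"
proof -
  have "row_mass c I J i = (\<Sum>x\<in>I \<times> J \<times> J. case x of (k, j, l) \<Rightarrow> (mixed_diff c i k j l)\<^sup>2)"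
    by (simp add: row_mass_def sum.cartesian_product)
  also have "\<dots> \<le> (\<Sum>x\<in>I' \<times> J' \<times> J'. case x of (k, j, l) \<Rightarrow> (mixed_diff c i k j l)\<^sup>2)"
    using assms by (intro sum_mono2) auto
  also have "\<dots> = row_mass c I' J' i"
    by (simp add: row_mass_def sum.cartesian_product)
  finally show ?thesis .
qed

text \<open>The lost terms have \<open>x\<close> as their first or as their second row, and by
  symmetry each kind amounts to at most one row mass.\<close>

lemma block_mass_remove_row:
  assumes fin: "finite I"
  shows "block_mass c I J \<le> block_mass c (I - {x}) J + 2 * row_mass c I J x"
proof (cases "x \<in> I")
  case True
  let ?w = "\<lambda>i k. \<Sum>j\<in>J. \<Sum>l\<in>J. (mixed_diff c i k j l)\<^sup>2"
  have "block_mass c I J = (\<Sum>k\<in>I. ?w x k) + (\<Sum>i\<in>I - {x}. \<Sum>k\<in>I. ?w i k)"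
    unfolding block_mass_def using fin True by (rule sum.remove)
  also have "(\<Sum>i\<in>I - {x}. \<Sum>k\<in>I. ?w i k) = (\<Sum>i\<in>I - {x}. ?w i x + (\<Sum>k\<in>I - {x}. ?w i k))"
    using fin True by (intro sum.cong refl sum.remove)
  also have "\<dots> = (\<Sum>i\<in>I - {x}. ?w x i) + block_mass c (I - {x}) J"
    by (simp add: sum.distrib block_mass_def mixed_diff_swap_rows[of c _ x])
  also have "(\<Sum>i\<in>I - {x}. ?w x i) \<le> (\<Sum>i\<in>I. ?w x i)"
    using fin by (intro sum_mono2 sum_nonneg) auto
  finally show ?thesis unfolding row_mass_def by linarith
next
  case False
  then show ?thesis using row_mass_nonneg[of c I J x] by simp
qed

lemma block_mass_remove_column:
  assumes "finite J"
  shows "block_mass c I J \<le> block_mass c I (J - {y}) + 2 * row_mass (flipped c) J I y"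
  using block_mass_remove_row[OF assms, of "flipped c" I y] by (simp add: block_mass_flipped)

lemma block_mass_remove_cross:
  assumes fin: "finite S"
  shows "block_mass c S S \<le> block_mass c (S - {i, k}) (S - {j, l}) +
    2 * (row_mass c S S i + row_mass c S S k + row_mass (flipped c) S S j + row_mass (flipped c) S S l)"
proof -
  have eq: "S - {i, k} = S - {i} - {k}" "S - {j, l} = S - {j} - {l}" by auto
  have "block_mass c S S \<le> block_mass c (S - {i}) S + 2 * row_mass c S S i"
    using fin by (rule block_mass_remove_row)
  moreover have "block_mass c (S - {i}) S \<le> block_mass c (S - {i, k}) S + 2 * row_mass c (S - {i}) S k"
    unfolding eq using fin by (intro block_mass_remove_row) simp
  moreover have "row_mass c (S - {i}) S k \<le> row_mass c S S k" using fin by (intro row_mass_mono) auto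
  moreover have "block_mass c (S - {i, k}) S \<le> block_mass c (S - {i, k}) (S - {j}) + 2 * row_mass (flipped c) S (S - {i, k}) j"
    using fin by (rule block_mass_remove_column)
  moreover have "row_mass (flipped c) S (S - {i, k}) j \<le> row_mass (flipped c) S S j" using fin by (intro row_mass_mono) auto
  moreover have "block_mass c (S - {i, k}) (S - {j}) \<le> block_mass c (S - {i, k}) (S - {j, l}) + 2 * row_mass (flipped c) (S - {j}) (S - {i, k}) l"
    unfolding eq(2) using fin by (intro block_mass_remove_column) simp
  moreover have "row_mass (flipped c) (S - {j}) (S - {i, k}) l \<le> row_mass (flipped c) S S l" using fin by (intro row_mass_mono) auto
  ultimately show ?thesis by (smt (verit))
qed

text \<open>If every line carries at most M / 16, deleting two rows and two columns loses at most 2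
  * 4 * M / 16 = M / 2. Every difference then sees at least M / 2 of disjoint mass, so the disjoint
  mass is at least M^2 / 2.\<close>

lemma heavy_line_exists:
  assumes fin: "finite S" and D: "2 * disjoint_mass c S < (block_mass c S S)\<^sup>2"
  obtains i where "i \<in> S" "block_mass c S S \<le> 16 * row_mass c S S i"
  | j where "j \<in> S" "block_mass c S S \<le> 16 * row_mass (flipped c) S S j"
proof (rule ccontr)
  define M where "M = block_mass c S S"
  let ?w = "\<lambda>i k j l. (mixed_diff c i k j l)\<^sup>2"
  assume "\<not> thesis"
  with that have r: "row_mass c S S i \<le> M / 16" "row_mass (flipped c) S S i \<le> M / 16" if "i \<in> S" for i
    using \<open>i \<in> S\<close> unfolding M_def by force+
  have "M * M = (\<Sum>i\<in>S. \<Sum>k\<in>S. \<Sum>j\<in>S. \<Sum>l\<in>S. ?w i k j l * M)"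
    by (simp add: M_def block_mass_def sum_distrib_right)
  also have "\<dots> \<le> (\<Sum>i\<in>S. \<Sum>k\<in>S. \<Sum>j\<in>S. \<Sum>l\<in>S.
      ?w i k j l * block_mass c (S - {i, k}) (S - {j, l}) + ?w i k j l * (M / 2))"
  proof (intro sum_mono)
    fix i k j l assume ix: "i \<in> S" "k \<in> S" "j \<in> S" "l \<in> S"
    have "M \<le> block_mass c (S - {i, k}) (S - {j, l}) + M / 2"
      using block_mass_remove_cross[OF fin, of c i k j l] r(1)[OF ix(1)] r(1)[OF ix(2)] r(2)[OF ix(3)] r(2)[OF ix(4)]
      unfolding M_def by simp
    then have "?w i k j l * M \<le> ?w i k j l * (block_mass c (S - {i, k}) (S - {j, l}) + M / 2)"
      by (intro mult_left_mono) auto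
    then show "?w i k j l * M \<le> ?w i k j l * block_mass c (S - {i, k}) (S - {j, l}) + ?w i k j l * (M / 2)"
      by (simp add: distrib_left)
  qed
  also have "\<dots> = disjoint_mass c S + M * (M / 2)"
    by (simp only: sum.distrib disjoint_mass_def M_def block_mass_def sum_distrib_right)
  finally show False using D unfolding M_def[symmetric] by (simp add: power2_eq_square)
qed

text \<open>Each difference in row \<open>i\<close> sees the mass \<open>W\<close> outside that row,
  except for what lies in its second row and its two columns. If no other row and no column takes a
  large share of the mass \<open>m\<close> of row \<open>i\<close>, these losses are at most m W (2
  / 8 + 4 / 16), half of m W.\<close>

lemma heavy_row_isolates:
  fixes c :: "nat \<Rightarrow> nat \<Rightarrow> real"
  assumes fin: "finite S" and i: "i \<in> S"
    and heavy: "block_mass c S S \<le> 16 * row_mass c S S i"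
    and n: "card S \<ge> 272"
    and G: "\<And>j. j \<in> S \<Longrightarrow> 16 * (\<Sum>k\<in>S. \<Sum>l\<in>S. (mixed_diff c i k j l)\<^sup>2) \<le> row_mass c S S i"
  shows "row_mass c S S i * block_mass c (S - {i}) S \<le> 2 * disjoint_mass c S"
proof -
  let ?w = "\<lambda>i k j l. (mixed_diff c i k j l)\<^sup>2"
  define m where "m = row_mass c S S i"
  define W where "W = block_mass c (S - {i}) S"
  define h where "h k = (\<Sum>j\<in>S. \<Sum>l\<in>S. ?w i k j l)" for k
  define g where "g j = (\<Sum>k\<in>S. \<Sum>l\<in>S. ?w i k j l)" for j
  define r where "r k = row_mass c (S - {i}) S k" for k
  define s where "s j = row_mass (flipped c) S (S - {i}) j" for j
  have m0: "m \<ge> 0" by (simp add: m_def row_mass_nonneg)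
  have W0: "W \<ge> 0" by (simp add: W_def block_mass_nonneg)
  have r0: "r k \<ge> 0" for k by (simp add: r_def row_mass_nonneg)
  have s0: "s j \<ge> 0" for j by (simp add: s_def row_mass_nonneg)
  have sum_r: "(\<Sum>k\<in>S - {i}. r k) = W" by (simp add: r_def W_def sum_row_mass)
  have sum_s: "(\<Sum>j\<in>S. s j) = W" by (simp add: s_def W_def sum_row_mass block_mass_flipped)
  \<comment> \<open>A single other row needs no hypothesis of its own: the difference of rows
    \<open>i\<close> and \<open>k\<close> passes through every row \<open>q\<close>, and averaging
    over \<open>q\<close> gives card S * h k \<le> 2 m + 2 * 16 m. Hence 272 = 8 * 34.\<close>
  have h: "8 * h k \<le> m" if k: "k \<in> S" for k
  proof -
    have tri: "?w i k j l \<le> 2 * ?w i q j l + 2 * ?w k q j l" for q j l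
    proof -
      have "mixed_diff c i k j l = mixed_diff c i q j l - mixed_diff c k q j l"
        by (simp add: mixed_diff_def)
      moreover have "(a - b)\<^sup>2 \<le> 2 * a\<^sup>2 + 2 * b\<^sup>2" for a b :: real
        using zero_le_power2[of "a + b"] by (simp add: power2_eq_square algebra_simps)
      ultimately show ?thesis by simp
    qed
    have "card S * h k = (\<Sum>q\<in>S. h k)" by simp
    also have "\<dots> \<le> (\<Sum>q\<in>S. \<Sum>j\<in>S. \<Sum>l\<in>S. 2 * ?w i q j l + 2 * ?w k q j l)"
      unfolding h_def by (intro sum_mono tri)
    also have "\<dots> = 2 * m + 2 * row_mass c S S k"
      by (simp add: m_def row_mass_def sum.distrib sum_distrib_left)
    also have "row_mass c S S k \<le> block_mass c S S"
      unfolding sum_row_mass[symmetric] using fin k by (intro member_le_sum row_mass_nonneg) auto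
    also have "\<dots> \<le> 16 * m" using heavy by (simp add: m_def)
    finally have "card S * h k \<le> 34 * m" by simp
    moreover have "272 * h k \<le> card S * h k"
      using n by (intro mult_right_mono) (auto simp: h_def intro!: sum_nonneg)
    ultimately show ?thesis by linarith
  qed
  have point: "block_mass c (S - {i, k}) (S - {j, l}) \<ge> W - 2 * r k - 2 * s j - 2 * s l" for k j l
  proof -
    have eq: "S - {i, k} = S - {i} - {k}" "S - {j, l} = S - {j} - {l}" by auto
    have "W \<le> block_mass c (S - {i, k}) S + 2 * r k"
      unfolding eq W_def r_def using fin by (intro block_mass_remove_row) simp
    moreover have "block_mass c (S - {i, k}) S \<le> block_mass c (S - {i, k}) (S - {j}) + 2 * row_mass (flipped c) S (S - {i, k}) j"
      using fin by (rule block_mass_remove_column)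
    moreover have "row_mass (flipped c) S (S - {i, k}) j \<le> s j"
      unfolding s_def using fin by (intro row_mass_mono) auto
    moreover have "block_mass c (S - {i, k}) (S - {j}) \<le> block_mass c (S - {i, k}) (S - {j, l}) + 2 * row_mass (flipped c) (S - {j}) (S - {i, k}) l"
      unfolding eq(2) using fin by (intro block_mass_remove_column) simp
    moreover have "row_mass (flipped c) (S - {j}) (S - {i, k}) l \<le> s l"
      unfolding s_def using fin by (intro row_mass_mono) auto
    ultimately show ?thesis by (smt (verit))
  qed
  have "(\<Sum>k\<in>S. \<Sum>j\<in>S. \<Sum>l\<in>S. ?w i k j l * (W - 2 * r k - 2 * s j - 2 * s l)) \<le>
      (\<Sum>k\<in>S. \<Sum>j\<in>S. \<Sum>l\<in>S. ?w i k j l * block_mass c (S - {i, k}) (S - {j, l}))"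
    by (intro sum_mono mult_left_mono point) simp
  also have "\<dots> \<le> disjoint_mass c S"
    unfolding disjoint_mass_def
    using fin i by (intro member_le_sum[of i S "\<lambda>i. \<Sum>k\<in>S. \<Sum>j\<in>S. \<Sum>l\<in>S. ?w i k j l * block_mass c (S - {i, k}) (S - {j, l})"])
      (auto intro!: sum_nonneg mult_nonneg_nonneg block_mass_nonneg)
  finally have 1: "(\<Sum>k\<in>S. \<Sum>j\<in>S. \<Sum>l\<in>S. ?w i k j l * (W - 2 * r k - 2 * s j - 2 * s l)) \<le> disjoint_mass c S" .
  have "(\<Sum>k\<in>S. \<Sum>j\<in>S. \<Sum>l\<in>S. ?w i k j l * (W - 2 * r k - 2 * s j - 2 * s l)) =
    (\<Sum>k\<in>S. \<Sum>j\<in>S. \<Sum>l\<in>S. ?w i k j l) * W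
    - 2 * (\<Sum>k\<in>S. \<Sum>j\<in>S. \<Sum>l\<in>S. ?w i k j l * r k)
    - 2 * (\<Sum>k\<in>S. \<Sum>j\<in>S. \<Sum>l\<in>S. ?w i k j l * s j)
    - 2 * (\<Sum>k\<in>S. \<Sum>j\<in>S. \<Sum>l\<in>S. ?w i k j l * s l)"
    by (simp add: right_diff_distrib sum_subtractf sum_distrib_left sum_distrib_right mult.left_commute)
  also have "(\<Sum>k\<in>S. \<Sum>j\<in>S. \<Sum>l\<in>S. ?w i k j l) = m" by (simp add: m_def row_mass_def)
  also have "(\<Sum>k\<in>S. \<Sum>j\<in>S. \<Sum>l\<in>S. ?w i k j l * r k) = (\<Sum>k\<in>S. h k * r k)"
    by (simp add: h_def sum_distrib_right)
  also have "(\<Sum>k\<in>S. \<Sum>j\<in>S. \<Sum>l\<in>S. ?w i k j l * s j) = (\<Sum>j\<in>S. g j * s j)"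
    by (subst sum.swap) (simp add: g_def sum_distrib_right)
  also have "(\<Sum>k\<in>S. \<Sum>j\<in>S. \<Sum>l\<in>S. ?w i k j l * s l) = (\<Sum>k\<in>S. \<Sum>l\<in>S. \<Sum>j\<in>S. ?w i k j l * s l)"
    by (intro sum.cong refl sum.swap)
  also have "\<dots> = (\<Sum>l\<in>S. g l * s l)"
    by (subst sum.swap) (simp add: g_def sum_distrib_right mixed_diff_swap_columns)
  finally have 2: "(\<Sum>k\<in>S. \<Sum>j\<in>S. \<Sum>l\<in>S. ?w i k j l * (W - 2 * r k - 2 * s j - 2 * s l)) =
    m * W - 2 * (\<Sum>k\<in>S. h k * r k) - 4 * (\<Sum>j\<in>S. g j * s j)" by simp
  have "(\<Sum>k\<in>S. h k * r k) = (\<Sum>k\<in>S - {i}. h k * r k)"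
    using fin by (intro sum.mono_neutral_right) (auto simp: h_def)
  also have "\<dots> \<le> (\<Sum>k\<in>S - {i}. m / 8 * r k)"
    using h r0 by (intro sum_mono mult_right_mono) force+
  also have "\<dots> = m / 8 * W" by (simp only: sum_r sum_distrib_left[symmetric])
  finally have 3: "(\<Sum>k\<in>S. h k * r k) \<le> m / 8 * W" .
  have "(\<Sum>j\<in>S. g j * s j) \<le> (\<Sum>j\<in>S. m / 16 * s j)"
    using G s0 by (intro sum_mono mult_right_mono) (force simp: g_def m_def)+
  also have "\<dots> = m / 16 * W" by (simp only: sum_s sum_distrib_left[symmetric])
  finally have 4: "(\<Sum>j\<in>S. g j * s j) \<le> m / 16 * W" .
  have "m * W \<le> 2 * disjoint_mass c S" using 1 2 3 4 by simp
  then show ?thesis by (simp add: m_def W_def)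
qed

section \<open>Large \<open>n \<delta>\<close>\<close>

text \<open>The inequality of the two means, weighted so that a second moment of order \<delta>^2
  yields a first moment of order \<delta>.\<close>

lemma dist01_le_of_square:
  assumes "\<delta> > 0"
  shows "dist01 y \<le> (2 / \<delta>) * (dist01 y)\<^sup>2 + \<delta> / 8"
proof -
  have "0 \<le> (2 / \<delta>) * (dist01 y - \<delta> / 4)\<^sup>2" using assms by simp
  also have "\<dots> = (2 / \<delta>) * (dist01 y)\<^sup>2 - dist01 y + \<delta> / 8"
    using assms by (simp add: power2_eq_square field_simps)
  finally show ?thesis by simp
qed

text \<open>y^2 - y vanishes on {0, 1} and hence compares the second moment of a nearly Boolean
  variable with its mean.\<close>

lemma square_minus_bounds:
  "- dist01 y \<le> y\<^sup>2 - y" "y\<^sup>2 - y \<le> dist01 y + (dist01 y)\<^sup>2"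
proof -
  have "dist01 y = \<bar>y\<bar> \<or> dist01 y = \<bar>y - 1\<bar>" by (auto simp: dist01_def min_def)
  moreover have "y\<^sup>2 - y \<le> \<bar>y\<bar> + \<bar>y\<bar>\<^sup>2" by simp
  moreover have "y\<^sup>2 - y \<le> \<bar>y - 1\<bar> + \<bar>y - 1\<bar>\<^sup>2"
    by (simp add: power2_eq_square algebra_simps abs_if)
  ultimately show "y\<^sup>2 - y \<le> dist01 y + (dist01 y)\<^sup>2" by metis
  show "- dist01 y \<le> y\<^sup>2 - y"
  proof (cases "0 \<le> y \<and> y \<le> 1")
    case True
    have "y\<^sup>2 - y \<ge> - \<bar>y\<bar>" using True by simp
    moreover have "y\<^sup>2 - y \<ge> - \<bar>y - 1\<bar>"
      using True zero_le_power2[of "y - 1"] by (simp add: power2_eq_square algebra_simps)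
    ultimately show ?thesis by (simp add: dist01_def min_def)
  next
    case False
    then have "0 \<le> y * (y - 1)" by (auto simp: zero_le_mult_iff)
    then show ?thesis using dist01_nonneg[of y] by (simp add: power2_eq_square algebra_simps)
  qed
qed

text \<open>The variance is E (F^2 - F) plus \<mu> - \<mu>^2. The first part lies between - \<delta>
  / 4 and \<delta> / 4 + \<epsilon>; the second equals \<delta> - \<delta>^2, which is between
  \<delta> / 2 and \<delta> as \<delta> \<le> 1 / 2.\<close>

lemma variance_bounds:
  assumes fin: "finite R" and \<delta>: "\<delta> = min (perm_avg R F) (1 - perm_avg R F)" "\<delta> > 0"
    and e: "perm_avg R (\<lambda>p. (dist01 (F p))\<^sup>2) \<le> \<epsilon>" and \<epsilon>: "16 * \<epsilon> \<le> \<delta>\<^sup>2"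
  shows "\<delta> / 4 \<le> perm_avg R (\<lambda>p. (F p - perm_avg R F)\<^sup>2)"
    and "perm_avg R (\<lambda>p. (F p - perm_avg R F)\<^sup>2) \<le> 2 * \<delta>"
proof -
  define \<mu> where "\<mu> = perm_avg R F"
  have \<delta>2: "\<delta> \<le> 1 / 2" using \<delta>(1) by (simp add: min_def split: if_splits)
  have "perm_avg R (\<lambda>p. dist01 (F p)) \<le> perm_avg R (\<lambda>p. (2 / \<delta>) * (dist01 (F p))\<^sup>2 + \<delta> / 8)"
    using \<delta>(2) by (intro perm_avg_mono dist01_le_of_square)
  also have "\<dots> = (2 / \<delta>) * perm_avg R (\<lambda>p. (dist01 (F p))\<^sup>2) + \<delta> / 8"
    using fin by (simp only: perm_avg_add perm_avg_cmult perm_avg_const)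
  also have "\<dots> \<le> (2 / \<delta>) * (\<delta>\<^sup>2 / 16) + \<delta> / 8"
    using \<delta>(2) e \<epsilon> by (intro add_right_mono mult_left_mono) auto
  also have "\<dots> = \<delta> / 4" using \<delta>(2) by (simp add: power2_eq_square field_simps)
  finally have d: "perm_avg R (\<lambda>p. dist01 (F p)) \<le> \<delta> / 4" .
  have "perm_avg R (\<lambda>p. - 1 * dist01 (F p)) \<le> perm_avg R (\<lambda>p. (F p)\<^sup>2 - F p)"
    using square_minus_bounds(1) by (intro perm_avg_mono) simp
  then have lower: "- (\<delta> / 4) \<le> perm_avg R (\<lambda>p. (F p)\<^sup>2) - \<mu>"
    unfolding perm_avg_cmult perm_avg_diff \<mu>_def using d by linarith
  have "perm_avg R (\<lambda>p. (F p)\<^sup>2 - F p) \<le> perm_avg R (\<lambda>p. dist01 (F p) + (dist01 (F p))\<^sup>2)"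
    by (intro perm_avg_mono square_minus_bounds(2))
  then have upper: "perm_avg R (\<lambda>p. (F p)\<^sup>2) - \<mu> \<le> \<delta> / 4 + \<epsilon>"
    unfolding perm_avg_add perm_avg_diff \<mu>_def using d e by linarith
  have \<mu>: "\<mu> - \<mu>\<^sup>2 = \<delta> - \<delta>\<^sup>2"
    using \<delta>(1) unfolding \<mu>_def[symmetric] by (auto simp: min_def power2_eq_square algebra_simps)
  have sq: "0 \<le> \<delta>\<^sup>2" "\<delta>\<^sup>2 \<le> \<delta> / 2"
    using \<delta>2 \<delta>(2) mult_left_mono[OF \<delta>2, of \<delta>] by (auto simp: power2_eq_square)
  show "\<delta> / 4 \<le> perm_avg R (\<lambda>p. (F p - perm_avg R F)\<^sup>2)"
    unfolding perm_avg_variance[OF fin] using lower \<mu> sq \<delta>(2) unfolding \<mu>_def by linarith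
  show "perm_avg R (\<lambda>p. (F p - perm_avg R F)\<^sup>2) \<le> 2 * \<delta>"
    unfolding perm_avg_variance[OF fin] using upper \<mu> sq \<delta>(2) \<epsilon> unfolding \<mu>_def by linarith
qed

lemma lin_transpose_diff:
  assumes fin: "finite S" and ik: "i \<in> S" "k \<in> S" "i \<noteq> k"
  shows "lin c S p - lin c S (p \<circ> Transposition.transpose i k) = mixed_diff c i k (p i) (p k)"
proof -
  have "lin c S q = c i (q i) + (c k (q k) + (\<Sum>x\<in>S - {i} - {k}. c x (q x)))" for q
    using fin ik by (simp add: lin_def sum.remove[of S i] sum.remove[of "S - {i}" k])
  moreover have "(\<Sum>x\<in>S - {i} - {k}. c x ((p \<circ> Transposition.transpose i k) x)) = (\<Sum>x\<in>S - {i} - {k}. c x (p x))"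
    by (intro sum.cong refl) (auto simp: Transposition.transpose_def)
  ultimately show ?thesis by (simp add: mixed_diff_def)
qed

section \<open>Mixed differences as differences of two values of f\<close>

lemma dist01_zero [simp]: "dist01 0 = 0"
  by (simp add: dist01_def)

lemma dist01_abs_diff_le: "dist01 \<bar>x - y\<bar> \<le> dist01 x + dist01 y"
proof -
  have "dist01 x = \<bar>x\<bar> \<or> dist01 x = \<bar>x - 1\<bar>" "dist01 y = \<bar>y\<bar> \<or> dist01 y = \<bar>y - 1\<bar>"
    by (auto simp: dist01_def min_def)
  moreover have "dist01 \<bar>x - y\<bar> \<le> \<bar>x - y\<bar>" "dist01 \<bar>x - y\<bar> \<le> \<bar>\<bar>x - y\<bar> - 1\<bar>"
    by (simp_all add: dist01_def)
  ultimately show ?thesis by (elim disjE) (simp_all, linarith+)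
qed

lemma perm_avg_dist01_transpose:
  assumes ik: "i \<in> S" "k \<in> S"
  shows "perm_avg S (\<lambda>p. (dist01 (lin c S (p \<circ> Transposition.transpose i k)))\<^sup>2) =
    perm_avg S (\<lambda>p. (dist01 (lin c S p))\<^sup>2)"
  using perm_avg_compose_right[OF permutes_swap_id[OF ik], of "\<lambda>p. (dist01 (lin c S p))\<^sup>2"] .

text \<open>For uniform \<open>p\<close>, the permutations before and after the exchange are both
  uniform, so for fixed rows the mean squared distance is at most 4 \<epsilon>. Absolute values are
  taken because a difference of Boolean values may be -1.\<close>

lemma sum_dist01_mixed_diff_le:
  assumes e: "perm_avg {1..n} (\<lambda>p. (dist01 (lin c {1..n} p))\<^sup>2) \<le> \<epsilon>"
  shows "(\<Sum>i\<in>{1..n}. \<Sum>k\<in>{1..n}. \<Sum>j\<in>{1..n}. \<Sum>l\<in>{1..n}. (dist01 \<bar>mixed_diff c i k j l\<bar>)\<^sup>2) \<le> 4 * real n ^ 4 * \<epsilon>"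
proof -
  let ?S = "{1..n}"
  let ?d = "\<lambda>i k j l. (dist01 \<bar>mixed_diff c i k j l\<bar>)\<^sup>2"
  have \<epsilon>0: "0 \<le> \<epsilon>" using e perm_avg_nonneg[of ?S "\<lambda>p. (dist01 (lin c ?S p))\<^sup>2"] by simp
  have d0: "?d i k j j = 0" "?d i i j l = 0" for i k j l by (simp_all add: dist01_def)
  have pair: "(\<Sum>j\<in>?S. \<Sum>l\<in>?S. ?d i k j l) \<le> 4 * (real n)\<^sup>2 * \<epsilon>" if ik: "i \<in> ?S" "k \<in> ?S" for i k
  proof (cases "i = k")
    case True
    then show ?thesis using \<epsilon>0 d0(2)[of k] by simp
  next
    case False
    have "perm_avg ?S (\<lambda>p. ?d i k (p i) (p k)) \<le> perm_avg ?S (\<lambda>p. 2 * (dist01 (lin c ?S p))\<^sup>2 +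
        2 * (dist01 (lin c ?S (p \<circ> Transposition.transpose i k)))\<^sup>2)"
    proof (rule perm_avg_mono)
      fix p
      define x where "x = lin c ?S p"
      define y where "y = lin c ?S (p \<circ> Transposition.transpose i k)"
      have "mixed_diff c i k (p i) (p k) = x - y"
        unfolding x_def y_def using lin_transpose_diff[of ?S i k c p] ik False by simp
      then have "?d i k (p i) (p k) \<le> (dist01 x + dist01 y)\<^sup>2"
        using dist01_abs_diff_le[of x y] dist01_nonneg by (simp add: power_mono)
      also have "\<dots> \<le> 2 * (dist01 x)\<^sup>2 + 2 * (dist01 y)\<^sup>2"
        using zero_le_power2[of "dist01 x - dist01 y"] by (simp add: power2_eq_square algebra_simps)
      finally show "?d i k (p i) (p k) \<le> 2 * (dist01 (lin c ?S p))\<^sup>2 +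
        2 * (dist01 (lin c ?S (p \<circ> Transposition.transpose i k)))\<^sup>2" unfolding x_def y_def .
    qed
    also have "\<dots> \<le> 4 * \<epsilon>"
      unfolding perm_avg_add perm_avg_cmult perm_avg_dist01_transpose[OF ik] using e by simp
    finally have "(\<Sum>j\<in>?S. \<Sum>l\<in>?S - {j}. ?d i k j l) / (n * (n - 1)) \<le> 4 * \<epsilon>"
      using perm_avg_two[of ?S i k "?d i k"] ik False by simp
    moreover have "n \<ge> 2" using ik False by auto
    ultimately have "(\<Sum>j\<in>?S. \<Sum>l\<in>?S - {j}. ?d i k j l) \<le> 4 * \<epsilon> * (n * (n - 1))"
      by (simp add: divide_le_eq)
    also have "\<dots> \<le> 4 * \<epsilon> * (real n)\<^sup>2"
      using \<epsilon>0 by (intro mult_left_mono) (auto simp: power2_eq_square mult_left_mono)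
    also have "(\<Sum>j\<in>?S. \<Sum>l\<in>?S - {j}. ?d i k j l) = (\<Sum>j\<in>?S. \<Sum>l\<in>?S. ?d i k j l)"
      by (intro sum.cong[OF refl] sum.mono_neutral_left) (auto simp: d0)
    finally show ?thesis by (simp add: mult_ac)
  qed
  have "(\<Sum>i\<in>?S. \<Sum>k\<in>?S. \<Sum>j\<in>?S. \<Sum>l\<in>?S. ?d i k j l) \<le> (\<Sum>i\<in>?S. \<Sum>k\<in>?S. 4 * (real n)\<^sup>2 * \<epsilon>)"
    by (intro sum_mono pair)
  also have "\<dots> = 4 * real n ^ 4 * \<epsilon>" by (simp add: power2_eq_square numeral_eq_Suc)
  finally show ?thesis .
qed

text \<open>On the event \<open>p i = j\<close> the difference is at most 1 plus the two distances.
  The event has probability 1 / n, which accounts for 2 n^2; the distances are averaged without the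
  event, so \<epsilon> appears with n^3.\<close>

lemma entry_mass_le:
  assumes e: "perm_avg {1..n} (\<lambda>p. (dist01 (lin c {1..n} p))\<^sup>2) \<le> \<epsilon>"
    and i: "i \<in> {1..n}" and j: "j \<in> {1..n}"
  shows "(\<Sum>k\<in>{1..n}. \<Sum>l\<in>{1..n}. (mixed_diff c i k j l)\<^sup>2) \<le> 2 * (real n)\<^sup>2 + 8 * real n ^ 3 * \<epsilon>"
proof -
  let ?S = "{1..n}"
  let ?w = "\<lambda>k j l. (mixed_diff c i k j l)\<^sup>2"
  have \<epsilon>0: "0 \<le> \<epsilon>" using e perm_avg_nonneg[of ?S "\<lambda>p. (dist01 (lin c ?S p))\<^sup>2"] by simp
  have n: "n \<ge> 1" using i by simp
  have row: "(\<Sum>l\<in>?S. ?w k j l) \<le> 2 * real n + 8 * (real n)\<^sup>2 * \<epsilon>" if k: "k \<in> ?S" for k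
  proof (cases "i = k")
    case True
    then show ?thesis using \<epsilon>0 by simp
  next
    case False
    have "perm_avg ?S (\<lambda>p. (if p i = j then ?w k (p i) (p k) else 0)) \<le>
      perm_avg ?S (\<lambda>p. (2 * (if p i = j then 1 else 0) + 4 * (dist01 (lin c ?S p))\<^sup>2) +
        4 * (dist01 (lin c ?S (p \<circ> Transposition.transpose i k)))\<^sup>2)"
    proof (rule perm_avg_mono)
      fix p
      define x where "x = lin c ?S p"
      define y where "y = lin c ?S (p \<circ> Transposition.transpose i k)"
      have D: "mixed_diff c i k (p i) (p k) = x - y"
        unfolding x_def y_def using lin_transpose_diff[of ?S i k c p] i k False by simp
      have "(x - y)\<^sup>2 \<le> (1 + dist01 x + dist01 y)\<^sup>2"
        using power_mono[OF abs_diff_le_dist01[of x y], of 2] by simp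
      also have "\<dots> \<le> 2 + 4 * (dist01 x)\<^sup>2 + 4 * (dist01 y)\<^sup>2"
        using zero_le_power2[of "1 - (dist01 x + dist01 y)"] zero_le_power2[of "dist01 x - dist01 y"]
        by (simp add: power2_eq_square algebra_simps)
      finally have "(if p i = j then ?w k (p i) (p k) else 0) \<le>
          (2 * (if p i = j then 1 else 0) + 4 * (dist01 x)\<^sup>2) + 4 * (dist01 y)\<^sup>2"
        unfolding D by auto
      then show "(if p i = j then ?w k (p i) (p k) else 0) \<le> (2 * (if p i = j then 1 else 0) +
        4 * (dist01 (lin c ?S p))\<^sup>2) + 4 * (dist01 (lin c ?S (p \<circ> Transposition.transpose i k)))\<^sup>2"
        unfolding x_def y_def .
    qed
    also have "\<dots> \<le> 2 * perm_avg ?S (\<lambda>p. if p i = j then 1 else 0) + 8 * \<epsilon>"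
      unfolding perm_avg_add perm_avg_cmult perm_avg_dist01_transpose[OF i k] using e by simp
    also have "perm_avg ?S (\<lambda>p. if p i = j then 1 else 0) = 1 / n"
      using perm_avg_one[of ?S i "\<lambda>x. if x = j then 1 else 0"] i j by simp
    also have "perm_avg ?S (\<lambda>p. (if p i = j then ?w k (p i) (p k) else 0)) =
        (\<Sum>x\<in>?S. \<Sum>l\<in>?S - {x}. (if x = j then ?w k x l else 0)) / (n * (n - 1))"
      using perm_avg_two[of ?S i k "\<lambda>x l. if x = j then ?w k x l else 0"] i k False by simp
    also have "(\<Sum>x\<in>?S. \<Sum>l\<in>?S - {x}. (if x = j then ?w k x l else 0)) =
        (\<Sum>x\<in>?S. if x = j then (\<Sum>l\<in>?S - {j}. ?w k j l) else 0)"
      by (intro sum.cong refl) auto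
    also have "\<dots> = (\<Sum>l\<in>?S - {j}. ?w k j l)" using j by simp
    also have "\<dots> = (\<Sum>l\<in>?S. ?w k j l)"
      by (intro sum.mono_neutral_left) auto
    finally have 1: "(\<Sum>l\<in>?S. ?w k j l) / (n * (n - 1)) \<le> 2 * (1 / n) + 8 * \<epsilon>" .
    have n2: "n \<ge> 2" using i k False by auto
    have "(\<Sum>l\<in>?S. ?w k j l) \<le> (2 * (1 / n) + 8 * \<epsilon>) * (n * (n - 1))"
      using 1 n2 by (simp add: divide_le_eq)
    also have "\<dots> \<le> (2 * (1 / n) + 8 * \<epsilon>) * (n * n)"
      using \<epsilon>0 by (intro mult_left_mono) (auto simp: mult_left_mono)
    also have "\<dots> = 2 * real n + 8 * (real n)\<^sup>2 * \<epsilon>" using n by (simp add: field_simps power2_eq_square)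
    finally show ?thesis .
  qed
  have "(\<Sum>k\<in>?S. \<Sum>l\<in>?S. ?w k j l) \<le> (\<Sum>k\<in>?S. 2 * real n + 8 * (real n)\<^sup>2 * \<epsilon>)"
    by (intro sum_mono row)
  also have "\<dots> = 2 * (real n)\<^sup>2 + 8 * real n ^ 3 * \<epsilon>"
    by (simp add: power2_eq_square numeral_eq_Suc algebra_simps)
  finally show ?thesis .
qed

text \<open>The row has mass at least n^3 \<delta> / 32. The share of one column, taken 16 times, is
  at most 32 n^2 + 128 n^3 \<epsilon>; the thresholds 2048 and 8192 make each term at most n^3
  \<delta> / 64. Finally 28835840 = 2 * 32 * 450560.\<close>

lemma dense_row:
  fixes c :: "nat \<Rightarrow> nat \<Rightarrow> real"
  assumes e: "perm_avg {1..n} (\<lambda>p. (dist01 (lin c {1..n} p))\<^sup>2) \<le> \<epsilon>"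
    and \<epsilon>: "8192 * \<epsilon> \<le> \<delta>" "\<epsilon> \<le> 1" and \<delta>: "0 < \<delta>" "\<delta> \<le> 1 / 2" "2048 \<le> real n * \<delta>"
    and M: "real n ^ 3 * \<delta> / 2 \<le> block_mass c {1..n} {1..n}"
    and i: "i \<in> {1..n}" and heavy: "block_mass c {1..n} {1..n} \<le> 16 * row_mass c {1..n} {1..n} i"
  shows "block_mass c ({1..n} - {i}) {1..n} \<le> (28835840 * \<epsilon> / \<delta>) * real n ^ 3"
proof -
  let ?S = "{1..n}"
  have \<epsilon>0: "0 \<le> \<epsilon>" using e perm_avg_nonneg[of ?S "\<lambda>p. (dist01 (lin c ?S p))\<^sup>2"] by simp
  have n: "n \<ge> 4096"
  proof -
    have "real n * \<delta> \<le> real n * (1 / 2)" using \<delta> by (intro mult_left_mono) auto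
    then show ?thesis using \<delta>(3) by simp
  qed
  define m where "m = row_mass c ?S ?S i"
  have m: "real n ^ 3 * \<delta> \<le> 32 * m" using M heavy by (simp add: m_def)
  have "16 * (\<Sum>k\<in>?S. \<Sum>l\<in>?S. (mixed_diff c i k j l)\<^sup>2) \<le> m" if j: "j \<in> ?S" for j
  proof -
    have "(real n)\<^sup>2 * 2048 \<le> (real n)\<^sup>2 * (real n * \<delta>)" using \<delta>(3) by (intro mult_left_mono) auto
    then have 1: "2048 * (real n)\<^sup>2 \<le> real n ^ 3 * \<delta>" by (simp add: power2_eq_square numeral_eq_Suc algebra_simps)
    have "real n ^ 3 * (8192 * \<epsilon>) \<le> real n ^ 3 * \<delta>" using \<epsilon>(1) by (intro mult_left_mono) auto
    then have 2: "8192 * (real n ^ 3 * \<epsilon>) \<le> real n ^ 3 * \<delta>" by simp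
    show ?thesis using entry_mass_le[OF e i j] 1 2 m by linarith
  qed
  then have "m * block_mass c (?S - {i}) ?S \<le> 2 * disjoint_mass c ?S"
    unfolding m_def using heavy i n by (intro heavy_row_isolates) auto
  also have "\<dots> \<le> 2 * (450560 * real n ^ 6 * \<epsilon>)"
    using disjoint_mass_le[OF _ \<epsilon>(2) e] n by (simp add: mult_ac)
  finally have 1: "m * block_mass c (?S - {i}) ?S \<le> 901120 * real n ^ 6 * \<epsilon>" by simp
  define W where "W = block_mass c (?S - {i}) ?S"
  have "(real n ^ 3 * \<delta>) * W \<le> (32 * m) * W"
    using m by (intro mult_right_mono) (auto simp: W_def block_mass_nonneg)
  also have "\<dots> \<le> 28835840 * (real n ^ 6 * \<epsilon>)" using 1 by (simp add: W_def mult_ac)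
  also have "\<dots> = (real n ^ 3 * \<delta>) * ((28835840 * \<epsilon> / \<delta>) * real n ^ 3)"
    using \<delta> by (simp add: power_add[symmetric] field_simps)
  finally show ?thesis
    unfolding W_def by (rule mult_left_le_imp_le) (use \<delta> n in simp)
qed

lemma dense_regime:
  fixes c :: "nat \<Rightarrow> nat \<Rightarrow> real"
  assumes e: "perm_avg {1..n} (\<lambda>p. (dist01 (lin c {1..n} p))\<^sup>2) \<le> \<epsilon>"
    and \<epsilon>: "10 ^ 7 * \<epsilon> \<le> \<delta>\<^sup>2" and \<delta>: "0 < \<delta>" "\<delta> \<le> 1 / 2" "2048 \<le> real n * \<delta>"
    and M: "real n ^ 3 * \<delta> / 2 \<le> block_mass c {1..n} {1..n}"
  shows "(\<exists>i\<in>{1..n}. block_mass c ({1..n} - {i}) {1..n} \<le> (28835840 * \<epsilon> / \<delta>) * real n ^ 3) \<or>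
    (\<exists>j\<in>{1..n}. block_mass c {1..n} ({1..n} - {j}) \<le> (28835840 * \<epsilon> / \<delta>) * real n ^ 3)"
proof -
  let ?S = "{1..n}"
  define M where "M = block_mass c ?S ?S"
  have n: "n \<ge> 4096"
  proof -
    have "real n * \<delta> \<le> real n * (1 / 2)" using \<delta> by (intro mult_left_mono) auto
    then show ?thesis using \<delta>(3) by simp
  qed
  have "\<delta>\<^sup>2 \<le> \<delta> / 2" using \<delta> mult_left_mono[OF \<delta>(2), of \<delta>] by (simp add: power2_eq_square)
  then have \<epsilon>': "8192 * \<epsilon> \<le> \<delta>" "\<epsilon> \<le> 1" using \<epsilon> \<delta> by auto
  have "(real n ^ 3 * \<delta> / 2)\<^sup>2 \<le> M\<^sup>2" using M \<delta> by (intro power_mono) (auto simp: M_def)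
  then have M2: "real n ^ 6 * \<delta>\<^sup>2 \<le> 4 * M\<^sup>2" by (simp add: power_mult_distrib power_divide power_mult[symmetric])
  have "disjoint_mass c ?S \<le> 450560 * (real n ^ 6 * \<epsilon>)"
    using disjoint_mass_le[OF _ \<epsilon>'(2) e] n by (simp add: mult_ac)
  moreover have "real n ^ 6 * (10 ^ 7 * \<epsilon>) \<le> real n ^ 6 * \<delta>\<^sup>2" using \<epsilon> by (intro mult_left_mono) auto
  moreover have "0 < real n ^ 6 * \<delta>\<^sup>2" using n \<delta> by simp
  \<comment> \<open>Twice the disjoint mass is at most 901120 n^6 \<epsilon>, while M^2 is at least
    a quarter of 10^7 n^6 \<epsilon>; strictness comes from \<delta> > 0, so \<epsilon> = 0 is
    covered.\<close>
  ultimately have "2 * disjoint_mass c ?S < M\<^sup>2" using M2 by simp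
  then consider (1) i where "i \<in> ?S" "M \<le> 16 * row_mass c ?S ?S i"
    | (2) j where "j \<in> ?S" "M \<le> 16 * row_mass (flipped c) ?S ?S j"
    using heavy_line_exists[of ?S c] unfolding M_def by blast
  then show ?thesis
  proof cases
    case (1 i)
    then show ?thesis
      using dense_row[OF e \<epsilon>' \<delta> M, of i] by (auto simp: M_def)
  next
    case (2 j)
    have e': "perm_avg ?S (\<lambda>p. (dist01 (lin (flipped c) ?S p))\<^sup>2) \<le> \<epsilon>"
      using e unfolding perm_avg_lin_flipped[of ?S "\<lambda>y. (dist01 y)\<^sup>2"] .
    have "block_mass (flipped c) (?S - {j}) ?S \<le> (28835840 * \<epsilon> / \<delta>) * real n ^ 3"
      using 2 M by (intro dense_row[OF e' \<epsilon>' \<delta>]) (auto simp: M_def block_mass_flipped)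
    then show ?thesis using 2 by (auto simp: block_mass_flipped)
  qed
qed

section \<open>Bounded \<open>n \<delta>\<close>, large \<open>n\<close>\<close>

text \<open>If every point failed, F / (2 A) + G / (2 B) would exceed 1 everywhere, although its
  average is at most 1.\<close>

lemma exists_below_twice_averages:
  fixes F G :: "'a \<Rightarrow> real" and A B :: real
  assumes fin: "finite X" and ne: "X \<noteq> {}"
    and F: "\<And>x. x \<in> X \<Longrightarrow> 0 \<le> F x" "sum F X \<le> A * card X" and A: "A > 0"
    and G: "\<And>x. x \<in> X \<Longrightarrow> 0 \<le> G x" "sum G X \<le> B * card X" and B: "B \<ge> 0"
  shows "\<exists>x\<in>X. F x \<le> 2 * A \<and> G x \<le> 2 * B"
proof (rule ccontr)
  assume "\<not> ?thesis"
  then have *: "F x > 2 * A \<or> G x > 2 * B" if "x \<in> X" for x using that by force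
  have card: "real (card X) > 0" using fin ne by (simp add: card_gt_0_iff)
  show False
  proof (cases "B = 0")
    \<comment> \<open>Exact Boolean functions lead to B = 0, where one cannot divide by B; then
      \<open>G\<close> vanishes and \<open>F\<close> alone is averaged.\<close>
    case True
    then have "sum G X = 0" using G by (intro antisym sum_nonneg) auto
    then have "G x = 0" if "x \<in> X" for x
      using sum_nonneg_eq_0_iff[of X G] fin G(1) that by auto
    then have "F x > 2 * A" if "x \<in> X" for x using *[OF that] that True by auto
    then have "(\<Sum>x\<in>X. 2 * A) \<le> sum F X" by (intro sum_mono) force
    then have "2 * (A * card X) \<le> A * card X" using F(2) by (simp add: mult_ac)
    moreover have "0 < A * card X" using A card by simp
    ultimately show False by linarith
  next
    case False
    then have B: "B > 0" using B by simp
    have "1 < F x / (2 * A) + G x / (2 * B)" if "x \<in> X" for x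
    proof -
      have "0 \<le> F x / (2 * A)" "0 \<le> G x / (2 * B)" using F(1) G(1) that A B by simp_all
      moreover have "1 < F x / (2 * A) \<or> 1 < G x / (2 * B)"
        using *[OF that] A B by (simp add: less_divide_eq)
      ultimately show ?thesis by linarith
    qed
    then have "(\<Sum>x\<in>X. 1) < (\<Sum>x\<in>X. F x / (2 * A) + G x / (2 * B))"
      using fin ne by (intro sum_strict_mono) auto
    also have "\<dots> = sum F X / (2 * A) + sum G X / (2 * B)"
      by (simp add: sum.distrib sum_divide_distrib)
    also have "sum F X / (2 * A) \<le> (A * card X) / (2 * A)"
      using F(2) A by (intro divide_right_mono) auto
    also have "sum G X / (2 * B) \<le> (B * card X) / (2 * B)"
      using G(2) B by (intro divide_right_mono) auto
    finally show False using A B by simp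
  qed
qed

lemma pairwise_collinear_imp_line:
  assumes "\<And>p q. p \<in> Z \<Longrightarrow> q \<in> Z \<Longrightarrow> fst p = fst q \<or> snd p = snd q"
  shows "(\<forall>p\<in>Z. \<forall>q\<in>Z. fst p = fst q) \<or> (\<forall>p\<in>Z. \<forall>q\<in>Z. snd p = snd q)"
proof (rule ccontr)
  assume "\<not> ?thesis"
  then obtain p q r s where *: "p \<in> Z" "q \<in> Z" "fst p \<noteq> fst q" "r \<in> Z" "s \<in> Z" "snd r \<noteq> snd s"
    by blast
  have "snd p = snd q" "fst r = fst s" using assms * by blast+
  moreover have "fst r = fst p \<or> snd r = snd p" "fst r = fst q \<or> snd r = snd q"
    "fst s = fst p \<or> snd s = snd p" "fst s = fst q \<or> snd s = snd q"
    using assms * by blast+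
  ultimately show False using * by metis
qed

lemma block_mass_le_entries:
  assumes fin: "finite I" "finite J" and card: "card I \<le> n" "card J \<le> n"
    and b: "\<And>i k j l. mixed_diff c i k j l = b i j + b k l - b i l - b k j"
    and B: "(\<Sum>i\<in>I. \<Sum>j\<in>J. (b i j)\<^sup>2) \<le> B"
  shows "block_mass c I J \<le> 16 * (real n)\<^sup>2 * B"
proof -
  let ?T = "\<Sum>i\<in>I. \<Sum>j\<in>J. (b i j)\<^sup>2"
  have T0: "0 \<le> ?T" by (intro sum_nonneg) simp
  have sq: "(p + q - r - s)\<^sup>2 \<le> 4 * p\<^sup>2 + 4 * q\<^sup>2 + 4 * r\<^sup>2 + 4 * s\<^sup>2" for p q r s :: real
  proof -
    have "4 * p\<^sup>2 + 4 * q\<^sup>2 + 4 * r\<^sup>2 + 4 * s\<^sup>2 - (p + q - r - s)\<^sup>2 =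
      (p - q)\<^sup>2 + (p + r)\<^sup>2 + (p + s)\<^sup>2 + (q + r)\<^sup>2 + (q + s)\<^sup>2 + (r - s)\<^sup>2"
      by (simp add: power2_eq_square algebra_simps)
    then show ?thesis by (smt (verit) zero_le_power2)
  qed
  have "block_mass c I J \<le> (\<Sum>i\<in>I. \<Sum>k\<in>I. \<Sum>j\<in>J. \<Sum>l\<in>J.
      4 * (b i j)\<^sup>2 + 4 * (b k l)\<^sup>2 + 4 * (b i l)\<^sup>2 + 4 * (b k j)\<^sup>2)"
    unfolding block_mass_def b by (intro sum_mono sq)
  also have "\<dots> = 16 * (card I * card J) * ?T"
  proof -
    have "(\<Sum>i\<in>I. \<Sum>k\<in>I. \<Sum>j\<in>J. \<Sum>l\<in>J. (b i j)\<^sup>2) = card I * card J * ?T"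
      by (simp add: sum_distrib_left mult_ac)
    moreover have "(\<Sum>i\<in>I. \<Sum>k\<in>I. \<Sum>j\<in>J. \<Sum>l\<in>J. (b k l)\<^sup>2) = card I * card J * ?T"
      by (simp add: sum_distrib_left mult_ac)
    moreover have "(\<Sum>i\<in>I. \<Sum>k\<in>I. \<Sum>j\<in>J. \<Sum>l\<in>J. (b i l)\<^sup>2) = card I * card J * ?T"
      by (simp add: sum_distrib_left mult_ac)
    moreover have "(\<Sum>i\<in>I. \<Sum>k\<in>I. \<Sum>j\<in>J. \<Sum>l\<in>J. (b k j)\<^sup>2) = card I * card J * ?T"
      by (simp add: sum_distrib_left mult_ac)
    ultimately show ?thesis by (simp only: sum.distrib sum_distrib_left[symmetric])
  qed
  also have "\<dots> \<le> 16 * (real n * real n) * ?T"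
  proof -
    have "real (card I) * real (card J) \<le> real n * real n" using card by (intro mult_mono) auto
    then show ?thesis using T0 by (simp add: mult_right_mono)
  qed
  also have "\<dots> \<le> 16 * (real n * real n) * B" using B by (intro mult_left_mono) auto
  finally show ?thesis by (simp add: power2_eq_square)
qed

lemma block_mass_ge_entry:
  assumes fin: "finite I" "finite J" and k: "k \<in> I" and l: "l \<in> J" and Y: "Y \<subseteq> I" and V: "V \<subseteq> J"
  shows "(\<Sum>y\<in>Y. \<Sum>v\<in>V. (mixed_diff c k y l v)\<^sup>2) \<le> block_mass c I J"
proof -
  have "(\<Sum>y\<in>Y. \<Sum>v\<in>V. (mixed_diff c k y l v)\<^sup>2) \<le> (\<Sum>y\<in>I. \<Sum>v\<in>J. (mixed_diff c k y l v)\<^sup>2)"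
    using fin Y V by (intro order_trans[OF sum_mono2[of I Y] sum_mono] sum_mono2 sum_nonneg) auto
  also have "\<dots> \<le> (\<Sum>y\<in>I. \<Sum>j\<in>J. \<Sum>v\<in>J. (mixed_diff c k y j v)\<^sup>2)"
    using fin l by (intro sum_mono member_le_sum[of l J "\<lambda>j. \<Sum>v\<in>J. (mixed_diff c k y j v)\<^sup>2" for y] sum_nonneg) auto
  also have "\<dots> \<le> block_mass c I J"
    unfolding block_mass_def
    using fin k by (intro member_le_sum[of k I "\<lambda>k. \<Sum>y\<in>I. \<Sum>j\<in>J. \<Sum>v\<in>J. (mixed_diff c k y j v)\<^sup>2"] sum_nonneg) auto
  finally show ?thesis .
qed

text \<open>Each of the two entries is compared with all of \<open>X \<times> U\<close>. Once
  \<open>x\<close> and \<open>u\<close> are used for the first entry, at least \<open>m\<close> rows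
  and \<open>m\<close> columns remain for the second, which explains the \<open>+ 1\<close>. This
  gives m^4 products, each at least 1 / 16.\<close>

lemma two_disjoint_entries_disjoint_mass:
  fixes c :: "nat \<Rightarrow> nat \<Rightarrow> real"
  assumes fin: "finite S" and ik: "i \<in> S" "k \<in> S" "i \<noteq> k" and jl: "j \<in> S" "l \<in> S" "j \<noteq> l"
    and XU: "X \<subseteq> S" "U \<subseteq> S" "i \<notin> X" "k \<notin> X" "j \<notin> U" "l \<notin> U"
    and m: "real m + 1 \<le> card X" "real m + 1 \<le> card U"
    and big: "\<And>x u. x \<in> X \<Longrightarrow> u \<in> U \<Longrightarrow> 1 / 2 \<le> \<bar>mixed_diff c i x j u\<bar>"
      "\<And>x u. x \<in> X \<Longrightarrow> u \<in> U \<Longrightarrow> 1 / 2 \<le> \<bar>mixed_diff c k x l u\<bar>"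
  shows "real m ^ 4 / 16 \<le> disjoint_mass c S"
proof -
  have finXU: "finite X" "finite U" using fin XU finite_subset by auto
  have quarter: "1 / 4 \<le> z\<^sup>2" if "1 / 2 \<le> \<bar>z\<bar>" for z :: real
    using power_mono[OF that, of 2] by (simp add: power2_eq_square)
  have inner: "(real m)\<^sup>2 / 4 \<le> block_mass c (S - {i, x}) (S - {j, u})" if "x \<in> X" "u \<in> U" for x u
  proof -
    have c: "real m \<le> real (card (X - {x}))" "real m \<le> real (card (U - {u}))"
      using m that finXU by (simp_all add: card_Diff_singleton)
    have "(real m)\<^sup>2 / 4 \<le> real (card (X - {x})) * real (card (U - {u})) / 4"
      unfolding power2_eq_square using c by (intro divide_right_mono mult_mono) auto
    also have "\<dots> = (\<Sum>y\<in>X - {x}. \<Sum>v\<in>U - {u}. 1 / 4)" by simp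
    also have "\<dots> \<le> (\<Sum>y\<in>X - {x}. \<Sum>v\<in>U - {u}. (mixed_diff c k y l v)\<^sup>2)"
      using big(2) by (intro sum_mono quarter) auto
    also have "\<dots> \<le> block_mass c (S - {i, x}) (S - {j, u})"
      using that ik jl XU fin by (intro block_mass_ge_entry) auto
    finally show ?thesis .
  qed
  have "real m ^ 4 / 16 = real m * real m * ((1 / 4) * ((real m)\<^sup>2 / 4))"
    by (simp add: power2_eq_square numeral_eq_Suc)
  also have "\<dots> \<le> real (card X) * real (card U) * ((1 / 4) * ((real m)\<^sup>2 / 4))"
    using m by (intro mult_right_mono mult_mono) auto
  also have "\<dots> = (\<Sum>x\<in>X. \<Sum>u\<in>U. (1 / 4) * ((real m)\<^sup>2 / 4))" by simp
  also have "\<dots> \<le> (\<Sum>x\<in>X. \<Sum>u\<in>U. (mixed_diff c i x j u)\<^sup>2 * block_mass c (S - {i, x}) (S - {j, u}))"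
    using big(1) inner by (intro sum_mono mult_mono quarter) auto
  also have "\<dots> \<le> (\<Sum>x\<in>S. \<Sum>u\<in>S. (mixed_diff c i x j u)\<^sup>2 * block_mass c (S - {i, x}) (S - {j, u}))"
    using fin XU by (intro order_trans[OF sum_mono2[of S X] sum_mono] sum_mono2 sum_nonneg mult_nonneg_nonneg block_mass_nonneg) auto
  also have "\<dots> \<le> (\<Sum>x\<in>S. \<Sum>j\<in>S. \<Sum>u\<in>S. (mixed_diff c i x j u)\<^sup>2 * block_mass c (S - {i, x}) (S - {j, u}))"
    using fin jl by (intro sum_mono member_le_sum[of j S "\<lambda>j. \<Sum>u\<in>S. (mixed_diff c i x j u)\<^sup>2 * block_mass c (S - {i, x}) (S - {j, u})" for x]
      sum_nonneg mult_nonneg_nonneg block_mass_nonneg) auto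
  also have "\<dots> \<le> disjoint_mass c S"
    unfolding disjoint_mass_def
    using fin ik by (intro member_le_sum[of i S "\<lambda>i. \<Sum>x\<in>S. \<Sum>j\<in>S. \<Sum>u\<in>S. (mixed_diff c i x j u)\<^sup>2 * block_mass c (S - {i, x}) (S - {j, u})"]
      sum_nonneg mult_nonneg_nonneg block_mass_nonneg) auto
  finally show ?thesis .
qed

lemma sparse_regime:
  fixes c :: "nat \<Rightarrow> nat \<Rightarrow> real"
  assumes e: "perm_avg {1..n} (\<lambda>p. (dist01 (lin c {1..n} p))\<^sup>2) \<le> \<epsilon>"
    and n: "n \<ge> 300000" and \<epsilon>: "10 ^ 9 * ((real n)\<^sup>2 * \<epsilon>) \<le> 1"
    and M: "block_mass c {1..n} {1..n} \<le> 16384 * (real n)\<^sup>2"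
  shows "(\<exists>i\<in>{1..n}. block_mass c ({1..n} - {i}) {1..n} \<le> 128 * real n ^ 4 * \<epsilon>) \<or>
    (\<exists>j\<in>{1..n}. block_mass c {1..n} ({1..n} - {j}) \<le> 128 * real n ^ 4 * \<epsilon>)"
proof -
  let ?S = "{1..n}"
  have \<epsilon>0: "0 \<le> \<epsilon>" using e perm_avg_nonneg[of ?S "\<lambda>p. (dist01 (lin c ?S p))\<^sup>2"] by simp
  let ?F = "\<lambda>x. \<Sum>i\<in>?S. \<Sum>j\<in>?S. (mixed_diff c i (fst x) j (snd x))\<^sup>2"
  let ?G = "\<lambda>x. \<Sum>i\<in>?S. \<Sum>j\<in>?S. (dist01 \<bar>mixed_diff c i (fst x) j (snd x)\<bar>)\<^sup>2"
  have reorder: "(\<Sum>x\<in>?S \<times> ?S. \<Sum>i\<in>?S. \<Sum>j\<in>?S. H i (fst x) j (snd x)) =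
    (\<Sum>i\<in>?S. \<Sum>k\<in>?S. \<Sum>j\<in>?S. \<Sum>l\<in>?S. H i k j l)" for H :: "nat \<Rightarrow> nat \<Rightarrow> nat \<Rightarrow> nat \<Rightarrow> real"
  proof -
    have pairs: "(\<Sum>x\<in>?S \<times> ?S. K (fst x) (snd x)) = (\<Sum>k\<in>?S. \<Sum>l\<in>?S. K k l)"
      for K :: "nat \<Rightarrow> nat \<Rightarrow> real"
      by (simp add: sum.cartesian_product split_def)
    have "(\<Sum>x\<in>?S \<times> ?S. \<Sum>i\<in>?S. \<Sum>j\<in>?S. H i (fst x) j (snd x)) =
        (\<Sum>k\<in>?S. \<Sum>l\<in>?S. \<Sum>i\<in>?S. \<Sum>j\<in>?S. H i k j l)"
      by (rule pairs[of "\<lambda>k l. \<Sum>i\<in>?S. \<Sum>j\<in>?S. H i k j l"])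
    also have "\<dots> = (\<Sum>k\<in>?S. \<Sum>i\<in>?S. \<Sum>l\<in>?S. \<Sum>j\<in>?S. H i k j l)"
      by (intro sum.cong refl sum.swap)
    also have "\<dots> = (\<Sum>i\<in>?S. \<Sum>k\<in>?S. \<Sum>j\<in>?S. \<Sum>l\<in>?S. H i k j l)"
      by (subst sum.swap) (intro sum.cong refl sum.swap)
    finally show ?thesis .
  qed
  \<comment> \<open>Averaging over the reference entry makes the squares of the normalised matrix
    sum to a constant and its distances to integers to O(n^2 \<epsilon>). Both bounds are needed for
    the same reference.\<close>
  have "\<exists>x\<in>?S \<times> ?S. ?F x \<le> 2 * 16384 \<and> ?G x \<le> 2 * (4 * (real n)\<^sup>2 * \<epsilon>)"
  proof (rule exists_below_twice_averages)
    show "sum ?F (?S \<times> ?S) \<le> 16384 * real (card (?S \<times> ?S))"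
      unfolding reorder[of "\<lambda>i k j l. (mixed_diff c i k j l)\<^sup>2"]
      using M by (simp add: block_mass_def card_cartesian_product power2_eq_square)
    show "sum ?G (?S \<times> ?S) \<le> 4 * (real n)\<^sup>2 * \<epsilon> * real (card (?S \<times> ?S))"
      unfolding reorder[of "\<lambda>i k j l. (dist01 \<bar>mixed_diff c i k j l\<bar>)\<^sup>2"]
      using sum_dist01_mixed_diff_le[OF e]
      by (simp add: card_cartesian_product power2_eq_square numeral_eq_Suc mult_ac)
  qed (use n \<epsilon>0 in \<open>auto intro!: sum_nonneg\<close>)
  then obtain i0 j0 where ref: "i0 \<in> ?S" "j0 \<in> ?S" "?F (i0, j0) \<le> 32768" "?G (i0, j0) \<le> 8 * (real n)\<^sup>2 * \<epsilon>"
    by auto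
  define b where "b i j = mixed_diff c i i0 j j0" for i j
  have F: "(\<Sum>i\<in>?S. \<Sum>j\<in>?S. (b i j)\<^sup>2) \<le> 32768" using ref(3) by (simp add: b_def)
  have G: "(\<Sum>i\<in>?S. \<Sum>j\<in>?S. (dist01 \<bar>b i j\<bar>)\<^sup>2) \<le> 8 * (real n)\<^sup>2 * \<epsilon>" using ref(4) by (simp add: b_def)
  have bD: "mixed_diff c i k j l = b i j + b k l - b i l - b k j" for i k j l
    by (simp add: b_def mixed_diff_def)
  have entry: "dist01 \<bar>b i j\<bar> \<le> 1 / 10" if "i \<in> ?S" "j \<in> ?S" for i j
  proof -
    have "(dist01 \<bar>b i j\<bar>)\<^sup>2 \<le> (\<Sum>j\<in>?S. (dist01 \<bar>b i j\<bar>)\<^sup>2)"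
      using that by (intro member_le_sum) auto
    also have "\<dots> \<le> (\<Sum>i\<in>?S. \<Sum>j\<in>?S. (dist01 \<bar>b i j\<bar>)\<^sup>2)"
      using that by (intro member_le_sum sum_nonneg) auto
    also have "\<dots> \<le> (1 / 10)\<^sup>2" using G \<epsilon> by (simp add: power2_eq_square)
    finally show ?thesis by (rule power2_le_imp_le) simp
  qed
  \<comment> \<open>Entries that round to a nonzero integer. Since n^2 \<epsilon> \<le> 10^-9, every
    entry is within 1 / 10 of its rounding, and there are at most 4 * 32768 elements.\<close>
  define Z where "Z = {x \<in> ?S \<times> ?S. \<bar>b (fst x) (snd x)\<bar> > 1 / 2}"
  have finZ: "finite Z" by (simp add: Z_def)
  have in_Z: "9 / 10 \<le> \<bar>b i j\<bar>" if "(i, j) \<in> Z" for i j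
  proof -
    have "1 / 2 < \<bar>b i j\<bar>" "dist01 \<bar>b i j\<bar> \<le> 1 / 10" using that entry[of i j] by (auto simp: Z_def)
    moreover have "dist01 \<bar>b i j\<bar> = \<bar>b i j\<bar> \<or> dist01 \<bar>b i j\<bar> = \<bar>\<bar>b i j\<bar> - 1\<bar>"
      by (auto simp: dist01_def min_def)
    ultimately show ?thesis by linarith
  qed
  have dist_small: "dist01 \<bar>b i j\<bar> = \<bar>b i j\<bar>" if "i \<in> ?S" "j \<in> ?S" "(i, j) \<notin> Z" for i j
    using that by (auto simp: Z_def dist01_def min_def)
  then have off_Z: "\<bar>b i j\<bar> \<le> 1 / 10" if "i \<in> ?S" "j \<in> ?S" "(i, j) \<notin> Z" for i j
    using that entry[of i j] by simp
  have "real (card Z) / 4 = (\<Sum>x\<in>Z. 1 / 4)" by simp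
  also have "\<dots> \<le> (\<Sum>x\<in>Z. (b (fst x) (snd x))\<^sup>2)"
  proof (rule sum_mono)
    fix x assume "x \<in> Z"
    then have "1 / 2 \<le> \<bar>b (fst x) (snd x)\<bar>" by (simp add: Z_def)
    from power_mono[OF this, of 2] show "1 / 4 \<le> (b (fst x) (snd x))\<^sup>2" by (simp add: power2_eq_square)
  qed
  also have "\<dots> \<le> (\<Sum>x\<in>?S \<times> ?S. (b (fst x) (snd x))\<^sup>2)" by (intro sum_mono2) (auto simp: Z_def)
  also have "\<dots> = (\<Sum>i\<in>?S. \<Sum>j\<in>?S. (b i j)\<^sup>2)" by (simp add: sum.cartesian_product split_def)
  finally have cardZ: "card Z \<le> 131072" using F by simp
  have collinear: "fst p = fst q \<or> snd p = snd q" if pq: "p \<in> Z" "q \<in> Z" for p q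
  proof (rule ccontr)
    assume neq: "\<not> ?thesis"
    let ?X = "?S - fst ` Z" and ?U = "?S - snd ` Z"
    define m where "m = n div 2"
    \<comment> \<open>At most 131072 rows and as many columns meet \<open>Z\<close>; from n = 300000
      on, more than half of the rows and of the columns avoid it.\<close>
    have "card (fst ` Z) \<le> 131072" "card (snd ` Z) \<le> 131072"
      using cardZ card_image_le[OF finZ, of fst] card_image_le[OF finZ, of snd] by linarith+
    then have "card ?X \<ge> n - 131072" "card ?U \<ge> n - 131072"
      using diff_card_le_card_Diff[of "fst ` Z" ?S] diff_card_le_card_Diff[of "snd ` Z" ?S] finZ by auto
    then have card: "real m + 1 \<le> card ?X" "real m + 1 \<le> card ?U"
      using n by (simp_all add: m_def)
    have big: "1 / 2 \<le> \<bar>mixed_diff c i x j u\<bar>" if "(i, j) \<in> Z" "x \<in> ?X" "u \<in> ?U" for i j x u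
    proof -
      have S: "i \<in> ?S" "j \<in> ?S" "x \<in> ?S" "u \<in> ?S" using that by (auto simp: Z_def)
      have "(i, u) \<notin> Z" "(x, j) \<notin> Z" "(x, u) \<notin> Z" using that by force+
      then have "\<bar>b i u\<bar> \<le> 1 / 10" "\<bar>b x j\<bar> \<le> 1 / 10" "\<bar>b x u\<bar> \<le> 1 / 10" 
        using off_Z[OF S(1,4)] off_Z[OF S(3,2)] off_Z[OF S(3,4)] by blast+
      moreover have "9 / 10 \<le> \<bar>b i j\<bar>" using in_Z that by simp
      ultimately show ?thesis unfolding bD[of i x j u] by linarith
    qed
    have mem: "fst p \<in> ?S" "snd p \<in> ?S" "fst q \<in> ?S" "snd q \<in> ?S"
      "fst p \<in> fst ` Z" "snd p \<in> snd ` Z" "fst q \<in> fst ` Z" "snd q \<in> snd ` Z"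
      using pq by (auto simp: Z_def)
    have "real m ^ 4 / 16 \<le> disjoint_mass c ?S"
    proof (rule two_disjoint_entries_disjoint_mass[of ?S "fst p" "fst q" "snd p" "snd q" ?X ?U])
      show "1 / 2 \<le> \<bar>mixed_diff c (fst p) x (snd p) u\<bar>" if "x \<in> ?X" "u \<in> ?U" for x u
        using big[of "fst p" "snd p"] pq that by simp
      show "1 / 2 \<le> \<bar>mixed_diff c (fst q) x (snd q) u\<bar>" if "x \<in> ?X" "u \<in> ?U" for x u
        using big[of "fst q" "snd q"] pq that by simp
    qed (use mem neq card in \<open>simp_all\<close>)
    also have "\<dots> \<le> 450560 * real n ^ 6 * \<epsilon>"
    proof (rule disjoint_mass_le[OF _ _ e])
      have "1 * \<epsilon> \<le> (10 ^ 9 * (real n)\<^sup>2) * \<epsilon>"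
        using \<epsilon>0 n by (intro mult_right_mono) (auto simp: power2_eq_square intro: order_trans[of _ "real n"])
      then show "\<epsilon> \<le> 1" using \<epsilon> by simp
    qed (use n in simp)
    also have "\<dots> = 450560 * real n ^ 4 * ((real n)\<^sup>2 * \<epsilon>)" by (simp add: power_add[symmetric])
    also have "\<dots> \<le> 450560 * real n ^ 4 * (1 / 10 ^ 9)"
      using \<epsilon> by (intro mult_left_mono) auto
    \<comment> \<open>As n \<le> 3 m, the right side is at most 81 * 2816 m^4, below 390625 m^4: the
      disjoint mass is too large for \<epsilon>.\<close>
    finally have 1: "390625 * real m ^ 4 \<le> 2816 * real n ^ 4" by simp
    have "real n \<le> 3 * real m" using n by (simp add: m_def)
    then have "real n ^ 4 \<le> (3 * real m) ^ 4" by (intro power_mono) auto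
    then have "real n ^ 4 \<le> 81 * real m ^ 4" by (simp add: power_mult_distrib)
    moreover have "real m ^ 4 > 0" using n by (simp add: m_def)
    ultimately show False using 1 by linarith
  qed
  have small: "(\<Sum>i\<in>I. \<Sum>j\<in>J. (b i j)\<^sup>2) \<le> 8 * (real n)\<^sup>2 * \<epsilon>"
    if IJ: "I \<subseteq> ?S" "J \<subseteq> ?S" and Z: "\<And>i j. i \<in> I \<Longrightarrow> j \<in> J \<Longrightarrow> (i, j) \<notin> Z" for I J
  proof -
    have "(\<Sum>i\<in>I. \<Sum>j\<in>J. (b i j)\<^sup>2) = (\<Sum>i\<in>I. \<Sum>j\<in>J. (dist01 \<bar>b i j\<bar>)\<^sup>2)"
    proof (intro sum.cong refl)
      fix i j assume "i \<in> I" "j \<in> J"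
      then have "dist01 \<bar>b i j\<bar> = \<bar>b i j\<bar>" using IJ Z by (intro dist_small) auto
      then show "(b i j)\<^sup>2 = (dist01 \<bar>b i j\<bar>)\<^sup>2" by simp
    qed
    also have "\<dots> \<le> (\<Sum>i\<in>?S. \<Sum>j\<in>J. (dist01 \<bar>b i j\<bar>)\<^sup>2)"
      using IJ by (intro sum_mono2 sum_nonneg) auto
    also have "\<dots> \<le> (\<Sum>i\<in>?S. \<Sum>j\<in>?S. (dist01 \<bar>b i j\<bar>)\<^sup>2)"
      using IJ by (intro sum_mono sum_mono2) auto
    finally show ?thesis using G by linarith
  qed
  have mass: "block_mass c I J \<le> 128 * real n ^ 4 * \<epsilon>"
    if IJ: "I \<subseteq> ?S" "J \<subseteq> ?S" and Z: "\<And>i j. i \<in> I \<Longrightarrow> j \<in> J \<Longrightarrow> (i, j) \<notin> Z" for I J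
  proof -
    have "block_mass c I J \<le> 16 * (real n)\<^sup>2 * (8 * (real n)\<^sup>2 * \<epsilon>)"
      using IJ card_mono[of ?S I] card_mono[of ?S J]
      by (intro block_mass_le_entries[OF _ _ _ _ bD small[OF IJ Z]]) (auto intro: finite_subset)
    also have "\<dots> = 128 * real n ^ 4 * \<epsilon>" by (simp add: power2_eq_square numeral_eq_Suc)
    finally show ?thesis .
  qed
  show ?thesis
  proof (cases "Z = {}")
    case True
    \<comment> \<open>Without large entries any line will do.\<close>
    then have "block_mass c (?S - {1}) ?S \<le> 128 * real n ^ 4 * \<epsilon>" by (intro mass) auto
    then show ?thesis using n by (intro disjI1 bexI[of _ 1]) auto
  next
    case False
    then obtain i j where ij: "(i, j) \<in> Z" by auto
    then have S: "i \<in> ?S" "j \<in> ?S" by (auto simp: Z_def)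
    from pairwise_collinear_imp_line[of Z, OF collinear]
    show ?thesis
    proof
      assume "\<forall>p\<in>Z. \<forall>q\<in>Z. fst p = fst q"
      then have "\<And>x y. (x, y) \<in> Z \<Longrightarrow> x = i" using ij by force
      then have "block_mass c (?S - {i}) ?S \<le> 128 * real n ^ 4 * \<epsilon>" by (intro mass) auto
      then show ?thesis using S by blast
    next
      assume "\<forall>p\<in>Z. \<forall>q\<in>Z. snd p = snd q"
      then have "\<And>x y. (x, y) \<in> Z \<Longrightarrow> y = j" using ij by force
      then have "block_mass c ?S (?S - {j}) \<le> 128 * real n ^ 4 * \<epsilon>" by (intro mass) auto
      then show ?thesis using S by blast
    qed
  qed
qed

section \<open>Bounded \<open>n\<close>\<close>

lemma ex_permutes_map:
  assumes "finite S" "distinct xs" "set xs \<subseteq> S" "distinct ys" "set ys \<subseteq> S" "length xs = length ys"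
  shows "\<exists>p. p permutes S \<and> map p xs = ys"
  using assms
proof (induction xs arbitrary: S ys)
  case Nil
  then show ?case by (intro exI[of _ id] conjI permutes_id) simp
next
  case (Cons x xs)
  then obtain y ys' where ys: "ys = y # ys'" by (cases ys) auto
  let ?S = "S - {x}" and ?t = "Transposition.transpose x y"
  have t: "?t permutes S" using Cons.prems ys by (intro permutes_swap_id) auto
  have sub: "set (map ?t ys') \<subseteq> ?S" and dist: "distinct (map ?t ys')"
    using Cons.prems ys by (auto simp: Transposition.transpose_def distinct_map)
  have "\<exists>p. p permutes ?S \<and> map p xs = map ?t ys'"
    by (rule Cons.IH[OF _ _ _ dist sub]) (use Cons.prems ys in auto)
  then obtain p where p: "p permutes ?S" "map p xs = map ?t ys'" by blast
  have "?t \<circ> p permutes S" using t p by (intro permutes_compose) (auto intro: permutes_subset)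
  moreover have "map (?t \<circ> p) xs = ys'"
    using arg_cong[OF p(2), of "map ?t"] by (simp add: o_def)
  moreover have "(?t \<circ> p) x = y" using p(1) by (simp add: permutes_not_in)
  ultimately have "?t \<circ> p permutes S \<and> map (?t \<circ> p) (x # xs) = ys"
    by (simp only: list.map ys simp_thms)
  then show ?case by blast
qed

lemma lin_diff_on:
  assumes fin: "finite S" and T: "T \<subseteq> S" and q: "\<And>x. x \<in> S - T \<Longrightarrow> p x = q x"
  shows "lin c S p - lin c S q = (\<Sum>x\<in>T. c x (p x) - c x (q x))"
proof -
  have "lin c S r = (\<Sum>x\<in>S - T. c x (r x)) + (\<Sum>x\<in>T. c x (r x))" for r
    unfolding lin_def using fin T by (rule sum.subset_diff[rotated])
  moreover have "(\<Sum>x\<in>S - T. c x (p x)) = (\<Sum>x\<in>S - T. c x (q x))" using q by (intro sum.cong) auto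
  ultimately show ?thesis by (simp add: sum_subtractf)
qed

section \<open>Functions close to {0, 1} at every permutation\<close>

context
  fixes c :: "nat \<Rightarrow> nat \<Rightarrow> real" and S :: "nat set"
  assumes fin: "finite S" and near: "\<And>p. p permutes S \<Longrightarrow> dist01 (lin c S p) \<le> 1 / 20"
begin

text \<open>A combination of differences realised by one change of permutation cannot contain two
  terms of size at least 9 / 10; most exclusions below rest on this.\<close>

lemma lin_diff_le:
  assumes "p permutes S" "q permutes S"
  shows "lin c S p - lin c S q \<le> 11 / 10"
  using abs_diff_le_dist01[of "lin c S p" "lin c S q"] near[OF assms(1)] near[OF assms(2)] by linarith

lemma two_rows:
  assumes "{i, k} \<subseteq> S" "{j, l} \<subseteq> S"
  shows "\<bar>mixed_diff c i k j l\<bar> \<le> 1 / 10 \<or> 9 / 10 \<le> \<bar>mixed_diff c i k j l\<bar>"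
    and "mixed_diff c i k j l \<le> 11 / 10"
proof -
  have "(\<bar>mixed_diff c i k j l\<bar> \<le> 1 / 10 \<or> 9 / 10 \<le> \<bar>mixed_diff c i k j l\<bar>) \<and> mixed_diff c i k j l \<le> 11 / 10"
  proof (cases "i = k \<or> j = l")
    case False
    then obtain p where p: "p permutes S" "map p [i, k] = [j, l]"
      using ex_permutes_map[OF fin, of "[i, k]" "[j, l]"] assms by auto
    define x where "x = lin c S p"
    define y where "y = lin c S (p \<circ> Transposition.transpose i k)"
    have q: "p \<circ> Transposition.transpose i k permutes S"
      using assms p(1) by (intro permutes_compose permutes_swap_id) auto
    have D: "mixed_diff c i k j l = x - y"
      unfolding x_def y_def using lin_transpose_diff[OF fin, of i k c p] p(2) assms False by simp
    have "dist01 \<bar>x - y\<bar> \<le> 1 / 10"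
      using dist01_abs_diff_le[of x y] near[OF p(1)] near[OF q] unfolding x_def y_def by linarith
    then have "\<bar>x - y\<bar> \<le> 1 / 10 \<or> 9 / 10 \<le> \<bar>x - y\<bar>" by (auto simp: dist01_def min_def split: if_splits)
    then show ?thesis unfolding D x_def y_def using lin_diff_le[OF p(1) q] by simp
  qed auto
  then show "\<bar>mixed_diff c i k j l\<bar> \<le> 1 / 10 \<or> 9 / 10 \<le> \<bar>mixed_diff c i k j l\<bar>"
    and "mixed_diff c i k j l \<le> 11 / 10" by auto
qed

text \<open>A cyclic exchange on three rows: the entry in row \<open>k\<close> and column
  \<open>j2\<close> occurs in both differences with opposite signs and cancels.\<close>

lemma three_rows:
  assumes "distinct [i, k, r]" "{i, k, r} \<subseteq> S" "distinct [j1, j2, j3]" "{j1, j2, j3} \<subseteq> S"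
  shows "mixed_diff c i k j1 j2 + mixed_diff c r k j2 j3 \<le> 11 / 10"
proof -
  obtain p where p: "p permutes S" "map p [i, k, r] = [j1, j3, j2]"
    using ex_permutes_map[OF fin, of "[i, k, r]" "[j1, j3, j2]"] assms by auto
  define q where "q = p \<circ> (Transposition.transpose i r \<circ> Transposition.transpose k r)"
  have q: "q permutes S" unfolding q_def using assms p(1)
    by (intro permutes_compose permutes_swap_id) auto
  have qv: "q i = j2" "q k = j1" "q r = j3"
    using p(2) assms(1) by (auto simp: q_def Transposition.transpose_def)
  have "lin c S p - lin c S q = (\<Sum>x\<in>{i, k, r}. c x (p x) - c x (q x))"
    using assms by (intro lin_diff_on[OF fin]) (auto simp: q_def Transposition.transpose_def)
  also have "\<dots> = mixed_diff c i k j1 j2 + mixed_diff c r k j2 j3"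
    using assms(1) p(2) qv by (simp add: mixed_diff_def)
  finally show ?thesis using lin_diff_le[OF p(1) q] by simp
qed

text \<open>The two exchanges involve disjoint rows, so they can be made at once.\<close>

lemma four_rows:
  assumes "distinct [i, k, r, s]" "{i, k, r, s} \<subseteq> S" "distinct [j, l, u, v]" "{j, l, u, v} \<subseteq> S"
  shows "mixed_diff c i k j l + mixed_diff c r s u v \<le> 11 / 10"
proof -
  obtain p where p: "p permutes S" "map p [i, k, r, s] = [j, l, u, v]"
    using ex_permutes_map[OF fin, of "[i, k, r, s]" "[j, l, u, v]"] assms by auto
  define q where "q = p \<circ> (Transposition.transpose i k \<circ> Transposition.transpose r s)"
  have q: "q permutes S" unfolding q_def using assms p(1)
    by (intro permutes_compose permutes_swap_id) auto
  have qv: "q i = l" "q k = j" "q r = v" "q s = u"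
    using p(2) assms(1) by (auto simp: q_def Transposition.transpose_def)
  have "lin c S p - lin c S q = (\<Sum>x\<in>{i, k, r, s}. c x (p x) - c x (q x))"
    using assms by (intro lin_diff_on[OF fin]) (auto simp: q_def Transposition.transpose_def)
  also have "\<dots> = mixed_diff c i k j l + mixed_diff c r s u v"
    using assms(1) p(2) qv by (simp add: mixed_diff_def)
  finally show ?thesis using lin_diff_le[OF p(1) q] by simp
qed

text \<open>
  Rounded to integers, every row minus row \<open>k\<close> is constant or the indicator of one fixed set \<open>A\<close> of columns
  plus a constant: any other shape contradicts the bound on the differences that involve three rows.
\<close>

lemma near_block_structure:
  assumes ik: "i \<in> S" "k \<in> S" and ab: "a \<in> S" "b \<in> S" and big: "mixed_diff c i k a b > 1 / 2"
  defines "A \<equiv> {j \<in> S. mixed_diff c i k j b > 1 / 2}"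
    and "I \<equiv> {r \<in> S. mixed_diff c r k a b > 1 / 2}"
  assumes r: "r \<in> S" and j: "j \<in> S"
  shows "\<bar>mixed_diff c r k j b - (if r \<in> I \<and> j \<in> A then 1 else 0)\<bar> \<le> 1 / 5"
proof -
  let ?D = "mixed_diff c"
  define \<phi> where "\<phi> j = ?D i k j b" for j
  define \<psi> where "\<psi> j = ?D r k j b" for j
  have diff: "?D i k j l = \<phi> j - \<phi> l" "?D r k j l = \<psi> j - \<psi> l" "?D i r j b = \<phi> j - \<psi> j" for j l
    by (simp_all add: \<phi>_def \<psi>_def mixed_diff_def)
  have swap: "?D i r b j = - ?D i r j b" for j by (simp add: mixed_diff_def)
  have bk: "b \<notin> A" "\<phi> b = 0" "\<psi> b = 0" by (simp_all add: A_def \<phi>_def \<psi>_def)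
  have ik': "i \<noteq> k" and ab': "a \<noteq> b" using big by auto
  have aA: "a \<in> A" using ab big by (simp add: A_def)
  have \<phi>a: "9 / 10 \<le> \<phi> a" using two_rows(1)[of i k a b] ik ab big by (auto simp: \<phi>_def)
  have \<phi>A: "9 / 10 \<le> \<phi> l \<and> \<phi> l \<le> 11 / 10" if "l \<in> A" for l
    using two_rows[of i k l b] ik ab that by (auto simp: \<phi>_def A_def)
  have \<phi>0: "\<bar>\<phi> l\<bar> \<le> 1 / 10" if "l \<in> S" "l \<notin> A" for l
  proof -
    have "\<phi> a - \<phi> l \<le> 11 / 10" using two_rows(2)[of i k a l] ik ab that by (simp add: diff)
    then show ?thesis using two_rows(1)[of i k l b] ik ab that \<phi>a by (auto simp: \<phi>_def A_def)
  qed
  consider "r = k" | "r = i" | "r \<noteq> k" "r \<noteq> i" by blast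
  then show ?thesis
  proof cases
    case 1
    then show ?thesis by (simp add: I_def)
  next
    case 2
    then have "r \<in> I" using ik big by (simp add: I_def)
    moreover have "\<bar>\<phi> j - (if j \<in> A then 1 else 0)\<bar> \<le> 1 / 5"
    proof (cases "j \<in> A")
      case True
      have "\<bar>\<phi> j - 1\<bar> \<le> 1 / 5" using \<phi>A[OF True] by linarith
      then show ?thesis using True by simp
    next
      case False
      have "\<bar>\<phi> j\<bar> \<le> 1 / 5" using \<phi>0[OF j False] by linarith
      then show ?thesis using False by simp
    qed
    ultimately show ?thesis using 2 by (simp add: \<phi>_def)
  next
    case 3
    have near\<psi>: "\<bar>\<psi> l\<bar> \<le> 1 / 10 \<or> 9 / 10 \<le> \<bar>\<psi> l\<bar>" if "l \<in> S" for l
      using two_rows(1)[of r k l b] ik ab r that by (simp add: \<psi>_def)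
    \<comment> \<open>The two cyclic exchanges bound \<psi> l from above by 3 / 10 and from below by
      - 1 / 5, so the dichotomy leaves only values near 0.\<close>
    have \<psi>0: "\<bar>\<psi> l\<bar> \<le> 1 / 10" if l: "l \<in> S" "l \<notin> A" for l
    proof (cases "l = b")
      case False
      have "a \<noteq> l" using aA l by auto
      have "?D i k a l + ?D r k l b \<le> 11 / 10"
        using 3 ik ik' ab ab' r l False \<open>a \<noteq> l\<close> by (intro three_rows) auto
      moreover have "?D i k a b + ?D r k b l \<le> 11 / 10"
        using 3 ik ik' ab ab' r l False \<open>a \<noteq> l\<close> by (intro three_rows) auto
      ultimately show ?thesis using near\<psi>[OF l(1)] \<phi>0[OF l] \<phi>a bk by (auto simp: diff)
    qed (simp add: bk)
    \<comment> \<open>Inside \<open>A\<close> a jump of \<psi> by about 1 between two columns would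
      add up with the jump of \<phi> from \<open>A\<close> to \<open>b\<close> in a cyclic
      exchange.\<close>
    have const: "\<bar>\<psi> l - \<psi> l'\<bar> \<le> 1 / 10" if l: "l \<in> A" "l' \<in> A" for l l'
    proof -
      have upper: "\<psi> l - \<psi> l' < 9 / 10" if l: "l \<in> A" "l' \<in> A" for l l'
      proof (cases "l = l'")
        case False
        have "?D r k l l' + ?D i k l' b \<le> 11 / 10"
          using 3 ik ik' ab r l False bk by (intro three_rows) (auto simp: A_def)
        then show ?thesis using \<phi>A[OF l(2)] bk by (simp add: diff)
      qed simp
      have "\<bar>\<psi> l - \<psi> l'\<bar> \<le> 1 / 10 \<or> 9 / 10 \<le> \<bar>\<psi> l - \<psi> l'\<bar>"
        using two_rows(1)[of r k l l'] ik r l by (simp add: diff A_def)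
      then show ?thesis using upper[OF l] upper[OF l(2,1)] by linarith
    qed
    \<comment> \<open>The difference of rows \<open>i\<close> and \<open>r\<close> excludes values
      of \<psi> near -1 on \<open>A\<close>; the value at \<open>a\<close> then decides whether
      \<open>r\<close> belongs to \<open>I\<close>.\<close>
    have lower: "\<psi> l < 9 / 10 \<longrightarrow> \<bar>\<psi> l\<bar> \<le> 1 / 10" if l: "l \<in> A" for l
    proof -
      have "\<phi> l - \<psi> l \<le> 11 / 10" using two_rows(2)[of i r l b] ik ab r l by (simp add: diff A_def)
      then show ?thesis using near\<psi>[of l] \<phi>A[OF l] l by (auto simp: A_def)
    qed
    show ?thesis
    proof (cases "j \<in> A")
      case False
      then show ?thesis using \<psi>0[OF j False] by (simp add: \<psi>_def)
    next
      case True
      show ?thesis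
      proof (cases "r \<in> I")
        case True
        then have "9 / 10 \<le> \<psi> a" using lower[OF aA] by (auto simp: I_def \<psi>_def)
        moreover have "\<psi> j \<le> 11 / 10" using two_rows(2)[of r k j b] ik ab r j by (simp add: \<psi>_def)
        ultimately have "\<bar>\<psi> j - 1\<bar> \<le> 1 / 5" using const[OF \<open>j \<in> A\<close> aA] by linarith
        then show ?thesis using True \<open>j \<in> A\<close> by (simp add: \<psi>_def)
      next
        case False
        then have "\<bar>\<psi> a\<bar> \<le> 1 / 10" using lower[OF aA] r by (auto simp: I_def \<psi>_def)
        then have "\<bar>\<psi> j\<bar> \<le> 1 / 5" using const[OF \<open>j \<in> A\<close> aA] by linarith
        then show ?thesis using False by (simp add: \<psi>_def)
      qed
    qed
  qed
qed

text \<open>After rounding, f counts up to a constant the rows of \<open>I\<close> that are mapped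
  into \<open>A\<close>. If \<open>I\<close>, \<open>A\<close> and their complements all had a
  second element, two simultaneous exchanges would change the count by 2. So one of the four sets is
  a singleton, and deleting its line makes the rounded matrix a row function or a column
  function.\<close>

lemma near_boolean_line:
  assumes ne: "S \<noteq> {}"
  shows "(\<exists>x\<in>S. \<forall>i\<in>S - {x}. \<forall>k\<in>S - {x}. \<forall>j\<in>S. \<forall>l\<in>S. \<bar>mixed_diff c i k j l\<bar> \<le> 1 / 2) \<or>
    (\<exists>y\<in>S. \<forall>i\<in>S. \<forall>k\<in>S. \<forall>j\<in>S - {y}. \<forall>l\<in>S - {y}. \<bar>mixed_diff c i k j l\<bar> \<le> 1 / 2)"
proof (cases "\<exists>i\<in>S. \<exists>k\<in>S. \<exists>a\<in>S. \<exists>b\<in>S. \<bar>mixed_diff c i k a b\<bar> > 1 / 2")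
  case False
  then have "\<forall>i\<in>S. \<forall>k\<in>S. \<forall>a\<in>S. \<forall>b\<in>S. \<bar>mixed_diff c i k a b\<bar> \<le> 1 / 2" by (meson not_le)
  then show ?thesis using ne by (intro disjI1) auto
next
  case True
  then obtain i k a' b' where ik: "i \<in> S" "k \<in> S" and ab': "a' \<in> S" "b' \<in> S" "\<bar>mixed_diff c i k a' b'\<bar> > 1 / 2"
    by blast
  have "mixed_diff c i k b' a' = - mixed_diff c i k a' b'" by (simp add: mixed_diff_def)
  then obtain a b where ab: "a \<in> S" "b \<in> S" and big: "mixed_diff c i k a b > 1 / 2"
    using ab' by (cases "mixed_diff c i k a' b' > 1 / 2") force+
  let ?D = "mixed_diff c"
  define A where "A = {j \<in> S. ?D i k j b > 1 / 2}"
  define I where "I = {r \<in> S. ?D r k a b > 1 / 2}"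
  define t :: "nat \<Rightarrow> nat \<Rightarrow> real" where "t r j = (if r \<in> I \<and> j \<in> A then 1 else 0)" for r j
  have block: "\<bar>?D r k j b - t r j\<bar> \<le> 1 / 5" if "r \<in> S" "j \<in> S" for r j
    using near_block_structure[OF ik ab big that] unfolding t_def A_def I_def .
  \<comment> \<open>Four errors of 1 / 5 stay below 9 / 10, so the dichotomy for mixed differences
    still recovers the rounded value 0 or 1.\<close>
  have D: "\<bar>?D r s j l - (t r j - t r l - t s j + t s l)\<bar> \<le> 4 / 5"
    if "r \<in> S" "s \<in> S" "j \<in> S" "l \<in> S" for r s j l
  proof -
    have "?D r s j l = ?D r k j b - ?D r k l b - ?D s k j b + ?D s k l b" by (simp add: mixed_diff_def)
    then show ?thesis using block[of r j] block[of r l] block[of s j] block[of s l] that by linarith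
  qed
  have small: "\<bar>?D r s j l\<bar> \<le> 1 / 2" if "r \<in> S" "s \<in> S" "j \<in> S" "l \<in> S" "t r j - t r l - t s j + t s l = 0" for r s j l
    using D[OF that(1-4)] that(5) two_rows(1)[of r s j l] that(1-4) by auto
  have large: "9 / 10 \<le> ?D r s j l" if "r \<in> S" "s \<in> S" "j \<in> S" "l \<in> S" "t r j - t r l - t s j + t s l = 1" for r s j l
  proof -
    have "1 / 5 \<le> ?D r s j l" using D[OF that(1-4)] unfolding that(5) by linarith
    then show ?thesis using two_rows(1)[of r s j l] that(1-4) by auto
  qed
  have mem: "i \<in> I" "k \<in> S - I" "a \<in> A" "b \<in> S - A" "I \<subseteq> S" "A \<subseteq> S"
    using ik ab big by (auto simp: I_def A_def)
  have "I = {i} \<or> S - I = {k} \<or> A = {a} \<or> S - A = {b}"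
  proof (rule ccontr)
    assume "\<not> ?thesis"
    then obtain i' k' a' b' where *: "i' \<in> I" "i' \<noteq> i" "k' \<in> S - I" "k' \<noteq> k" "a' \<in> A" "a' \<noteq> a" "b' \<in> S - A" "b' \<noteq> b"
      using mem(1-4) by blast
    have "?D i k a b + ?D i' k' a' b' \<le> 11 / 10"
      using * mem by (intro four_rows) auto
    moreover have "9 / 10 \<le> ?D i k a b" using mem by (intro large) (auto simp: t_def)
    moreover have "9 / 10 \<le> ?D i' k' a' b'" using * mem by (intro large) (auto simp: t_def)
    ultimately show False by linarith
  qed
  then consider "I = {i}" | "S - I = {k}" | "A = {a}" | "S - A = {b}" by blast
  then show ?thesis
  proof cases
    case 1
    then show ?thesis using ik by (intro disjI1 bexI[of _ i] ballI small) (auto simp: t_def)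
  next
    case 2
    then have "r \<in> I" if "r \<in> S - {k}" for r using that by blast
    then show ?thesis using ik by (intro disjI1 bexI[of _ k] ballI small) (auto simp: t_def)
  next
    case 3
    then show ?thesis using ab by (intro disjI2 bexI[of _ a] ballI small) (auto simp: t_def)
  next
    case 4
    then have "j \<in> A" if "j \<in> S - {b}" for j using that by blast
    then show ?thesis using ab by (intro disjI2 bexI[of _ b] ballI small) (auto simp: t_def)
  qed
qed

end

text \<open>A difference of absolute value at most 1 / 2 equals in size its own distance to {0, 1},
  so the bound on those distances becomes a bound on the mass.\<close>

lemma block_mass_small_entries:
  assumes e: "perm_avg {1..n} (\<lambda>p. (dist01 (lin c {1..n} p))\<^sup>2) \<le> \<epsilon>"
    and IJ: "I \<subseteq> {1..n}" "J \<subseteq> {1..n}"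
    and small: "\<And>i k j l. i \<in> I \<Longrightarrow> k \<in> I \<Longrightarrow> j \<in> J \<Longrightarrow> l \<in> J \<Longrightarrow> \<bar>mixed_diff c i k j l\<bar> \<le> 1 / 2"
  shows "block_mass c I J \<le> 4 * real n ^ 4 * \<epsilon>"
proof -
  let ?S = "{1..n}"
  let ?d = "\<lambda>i k j l. (dist01 \<bar>mixed_diff c i k j l\<bar>)\<^sup>2"
  have fin: "finite I" "finite J" using IJ by (auto intro: finite_subset)
  have "block_mass c I J = (\<Sum>i\<in>I. \<Sum>k\<in>I. \<Sum>j\<in>J. \<Sum>l\<in>J. ?d i k j l)"
    unfolding block_mass_def
  proof (intro sum.cong refl)
    fix i k j l assume "i \<in> I" "k \<in> I" "j \<in> J" "l \<in> J"
    then have "dist01 \<bar>mixed_diff c i k j l\<bar> = \<bar>mixed_diff c i k j l\<bar>"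
      using small[of i k j l] by (auto simp: dist01_def min_def)
    then show "(mixed_diff c i k j l)\<^sup>2 = ?d i k j l" by simp
  qed
  also have "\<dots> = (\<Sum>x\<in>I \<times> I \<times> J \<times> J. case x of (i, k, j, l) \<Rightarrow> ?d i k j l)"
    by (simp add: sum.cartesian_product)
  also have "\<dots> \<le> (\<Sum>x\<in>?S \<times> ?S \<times> ?S \<times> ?S. case x of (i, k, j, l) \<Rightarrow> ?d i k j l)"
    using IJ by (intro sum_mono2) auto
  also have "\<dots> = (\<Sum>i\<in>?S. \<Sum>k\<in>?S. \<Sum>j\<in>?S. \<Sum>l\<in>?S. ?d i k j l)"
    by (simp add: sum.cartesian_product)
  also have "\<dots> \<le> 4 * real n ^ 4 * \<epsilon>" by (rule sum_dist01_mixed_diff_le[OF e])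
  finally show ?thesis .
qed

lemma small_regime:
  assumes n: "n \<ge> 1" and e: "perm_avg {1..n} (\<lambda>p. (dist01 (lin c {1..n} p))\<^sup>2) \<le> \<epsilon>"
    and \<epsilon>: "400 * fact n * \<epsilon> \<le> 1"
  shows "(\<exists>i\<in>{1..n}. block_mass c ({1..n} - {i}) {1..n} \<le> 4 * real n ^ 4 * \<epsilon>) \<or>
    (\<exists>j\<in>{1..n}. block_mass c {1..n} ({1..n} - {j}) \<le> 4 * real n ^ 4 * \<epsilon>)"
proof -
  let ?S = "{1..n}"
  \<comment> \<open>One summand is at most the whole sum, n! times the average; 400 is the square of
    20.\<close>
  have near: "dist01 (lin c ?S p) \<le> 1 / 20" if p: "p permutes ?S" for p
  proof -
    have "(dist01 (lin c ?S p))\<^sup>2 \<le> (\<Sum>p | p permutes ?S. (dist01 (lin c ?S p))\<^sup>2)"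
      using p finite_permutations[of ?S]
      by (intro member_le_sum[of p "{p. p permutes ?S}" "\<lambda>p. (dist01 (lin c ?S p))\<^sup>2"]) auto
    also have "\<dots> = fact n * perm_avg ?S (\<lambda>p. (dist01 (lin c ?S p))\<^sup>2)" by (simp add: perm_avg_def)
    also have "\<dots> \<le> fact n * \<epsilon>" using e by (intro mult_left_mono) auto
    also have "\<dots> \<le> (1 / 20)\<^sup>2" using \<epsilon> by (simp add: power2_eq_square)
    finally show ?thesis by (rule power2_le_imp_le) simp
  qed
  have "?S \<noteq> {}" using n by simp
  from near_boolean_line[OF _ near this] show ?thesis
  proof
    assume "\<exists>x\<in>?S. \<forall>i\<in>?S - {x}. \<forall>k\<in>?S - {x}. \<forall>j\<in>?S. \<forall>l\<in>?S. \<bar>mixed_diff c i k j l\<bar> \<le> 1 / 2"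
    then obtain x where x: "x \<in> ?S"
      "\<And>i k j l. i \<in> ?S - {x} \<Longrightarrow> k \<in> ?S - {x} \<Longrightarrow> j \<in> ?S \<Longrightarrow> l \<in> ?S \<Longrightarrow> \<bar>mixed_diff c i k j l\<bar> \<le> 1 / 2"
      by meson
    have "block_mass c (?S - {x}) ?S \<le> 4 * real n ^ 4 * \<epsilon>"
      by (rule block_mass_small_entries[OF e _ _ x(2)]) auto
    then show ?thesis using x(1) by blast
  next
    assume "\<exists>y\<in>?S. \<forall>i\<in>?S. \<forall>k\<in>?S. \<forall>j\<in>?S - {y}. \<forall>l\<in>?S - {y}. \<bar>mixed_diff c i k j l\<bar> \<le> 1 / 2"
    then obtain y where y: "y \<in> ?S"
      "\<And>i k j l. i \<in> ?S \<Longrightarrow> k \<in> ?S \<Longrightarrow> j \<in> ?S - {y} \<Longrightarrow> l \<in> ?S - {y} \<Longrightarrow> \<bar>mixed_diff c i k j l\<bar> \<le> 1 / 2"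
      by meson
    have "block_mass c ?S (?S - {y}) \<le> 4 * real n ^ 4 * \<epsilon>"
      by (rule block_mass_small_entries[OF e _ _ y(2)]) auto
    then show ?thesis using y(1) by blast
  qed simp
qed

section \<open>Conclusion\<close>

text \<open>The constant 3 * 10^7 covers 28835840 from large n \<delta>. In the other cases the
  bound has n^4 \<epsilon>, and n \<le> 2048 / \<delta> trades one factor n for 1 / \<delta>, at a
  cost of at most 128 * 2048.\<close>

lemma dictator_line_exists:
  fixes c :: "nat \<Rightarrow> nat \<Rightarrow> real"
  assumes n: "n \<ge> 1" and e: "perm_avg {1..n} (\<lambda>p. (dist01 (lin c {1..n} p))\<^sup>2) \<le> \<epsilon>"
    and \<delta>: "\<delta> = min (perm_avg {1..n} (lin c {1..n})) (1 - perm_avg {1..n} (lin c {1..n}))" "\<delta> > 0"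
    and \<epsilon>: "10 ^ 16 * \<epsilon> \<le> \<delta>\<^sup>2" and small: "n < 300000 \<Longrightarrow> 400 * fact n * \<epsilon> \<le> 1"
  shows "(\<exists>i\<in>{1..n}. block_mass c ({1..n} - {i}) {1..n} \<le> (3 * 10 ^ 7 * \<epsilon> / \<delta>) * real n ^ 3) \<or>
    (\<exists>j\<in>{1..n}. block_mass c {1..n} ({1..n} - {j}) \<le> (3 * 10 ^ 7 * \<epsilon> / \<delta>) * real n ^ 3)"
proof -
  let ?S = "{1..n}" and ?X = "(3 * 10 ^ 7 * \<epsilon> / \<delta>) * real n ^ 3"
  have \<epsilon>0: "0 \<le> \<epsilon>" using e perm_avg_nonneg[of ?S "\<lambda>p. (dist01 (lin c ?S p))\<^sup>2"] by simp
  have \<delta>2: "\<delta> \<le> 1 / 2" using \<delta>(1) by (simp add: min_def split: if_splits)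
  define V where "V = perm_avg ?S (\<lambda>p. (lin c ?S p - perm_avg ?S (lin c ?S))\<^sup>2)"
  define M where "M = block_mass c ?S ?S"
  have "16 * \<epsilon> \<le> \<delta>\<^sup>2" using \<epsilon> \<epsilon>0 by simp
  from variance_bounds[OF _ \<delta> e this] have V: "\<delta> / 4 \<le> V" "V \<le> 2 * \<delta>" by (simp_all add: V_def)
  have VM: "V = M / (4 * (real n)\<^sup>2 * real (n - 1))" by (simp add: V_def M_def variance_lin)
  \<comment> \<open>For n = 1 the denominator is 0 and hence V = 0, against V \<ge> \<delta> /
    4.\<close>
  have "n \<noteq> 1" using V \<delta>(2) VM by auto
  then have n2: "n \<ge> 2" using n by simp
  then have M: "M = V * (4 * (real n)\<^sup>2 * (real n - 1))" using VM by (simp add: of_nat_diff)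
  have mono: "x * (\<epsilon> / \<delta>) * real n ^ 3 \<le> ?X" if "x \<le> 3 * 10 ^ 7" for x
  proof -
    have "x * (\<epsilon> / \<delta> * real n ^ 3) \<le> (3 * 10 ^ 7) * (\<epsilon> / \<delta> * real n ^ 3)"
      using that \<epsilon>0 \<delta>(2) by (intro mult_right_mono) auto
    then show ?thesis by simp
  qed
  show ?thesis
  proof (cases "2048 \<le> real n * \<delta>")
    case True
    have "real n ^ 3 * \<delta> / 2 = (\<delta> / 4) * (4 * (real n)\<^sup>2 * (real n / 2))"
      by (simp add: power2_eq_square numeral_eq_Suc)
    also have "\<dots> \<le> M"
      unfolding M using V(1) \<delta>(2) n2 by (intro mult_mono) auto
    finally have "real n ^ 3 * \<delta> / 2 \<le> block_mass c ?S ?S" by (simp add: M_def)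
    moreover have "10 ^ 7 * \<epsilon> \<le> \<delta>\<^sup>2" using \<epsilon> \<epsilon>0 by simp
    moreover have "28835840 * \<epsilon> / \<delta> * real n ^ 3 \<le> ?X" using mono[of 28835840] by simp
    ultimately show ?thesis
      using dense_regime[OF e _ \<delta>(2) \<delta>2 True] by (meson order_trans)
  next
    case False
    then have n\<delta>: "real n \<le> 2048 / \<delta>" using \<delta>(2) by (simp add: field_simps)
    have bound: "a * real n ^ 4 * \<epsilon> \<le> ?X" if "0 \<le> a" "a \<le> 128" for a
    proof -
      have "a * real n ^ 4 * \<epsilon> = (a * real n ^ 3 * \<epsilon>) * real n" by (simp add: numeral_eq_Suc)
      also have "\<dots> \<le> (a * real n ^ 3 * \<epsilon>) * (2048 / \<delta>)"
        using n\<delta> \<epsilon>0 that by (intro mult_left_mono) auto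
      also have "\<dots> = (a * 2048) * (\<epsilon> / \<delta>) * real n ^ 3" by simp
      also have "\<dots> \<le> ?X" using that by (intro mono) auto
      finally show ?thesis .
    qed
    show ?thesis
    proof (cases "n < 300000")
      case True
      then show ?thesis
        using small_regime[OF n e small[OF True]] order_trans[OF _ bound[of 4]] by auto
    next
      case False
      have "(real n * \<delta>)\<^sup>2 \<le> 2048\<^sup>2"
        using \<open>\<not> 2048 \<le> real n * \<delta>\<close> \<delta>(2) by (intro power_mono) auto
      moreover have "(real n)\<^sup>2 * (10 ^ 16 * \<epsilon>) \<le> (real n)\<^sup>2 * \<delta>\<^sup>2"
        using \<epsilon> by (intro mult_left_mono) auto
      \<comment> \<open>Here 10^16 n^2 \<epsilon> \<le> 2048^2, which is below 10^7.\<close>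
      ultimately have "10 ^ 9 * ((real n)\<^sup>2 * \<epsilon>) \<le> 1" by (simp add: power_mult_distrib)
      moreover have "block_mass c ?S ?S \<le> 16384 * (real n)\<^sup>2"
      proof -
        have "M \<le> (2 * \<delta>) * (4 * (real n)\<^sup>2 * real n)"
          unfolding M using V n2 \<delta>(2) by (intro mult_mono) auto
        also have "\<dots> = (8 * (real n)\<^sup>2) * (real n * \<delta>)" by simp
        also have "\<dots> \<le> (8 * (real n)\<^sup>2) * 2048"
          using \<open>\<not> 2048 \<le> real n * \<delta>\<close> by (intro mult_left_mono) auto
        finally show ?thesis by (simp add: M_def)
      qed
      ultimately show ?thesis
        using sparse_regime[OF e] False order_trans[OF _ bound[of 128]] by auto
    qed
  qed
qed

lemma linear_on_Sn_lin:
  assumes "linear_on_Sn n f"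
  obtains c where "\<And>p. p permutes {1..n} \<Longrightarrow> f p = lin c {1..n} p"
proof -
  obtain c where c: "\<And>p. p \<in> Sn n \<Longrightarrow> f p = (\<Sum>i\<in>{1..n}. \<Sum>j\<in>{1..n}. c i j * perm_ind i j p)"
    using assms unfolding linear_on_Sn_def by blast
  have "f p = lin c {1..n} p" if p: "p permutes {1..n}" for p
  proof -
    have "(\<Sum>j\<in>{1..n}. c i j * perm_ind i j p) = c i (p i)" if "i \<in> {1..n}" for i
    proof -
      have "(\<Sum>j\<in>{1..n}. c i j * perm_ind i j p) = (\<Sum>j\<in>{1..n}. if p i = j then c i j else 0)"
        by (intro sum.cong) (auto simp: perm_ind_def)
      also have "\<dots> = c i (p i)" using permutes_in_image[OF p, of i] that by (simp add: sum.delta)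
      finally show ?thesis .
    qed
    then show ?thesis using c[of p] p unfolding lin_def Sn_def by simp
  qed
  then show ?thesis by (rule that)
qed

theorem theorem1p6:
  shows "\<exists>K K' :: real. K > 0 \<and> K' > 0 \<and>
    (\<forall>(n :: nat) (\<epsilon> :: real) (\<delta> :: real) (f :: (nat \<Rightarrow> nat) \<Rightarrow> real).
      n \<ge> 1 \<longrightarrow> \<epsilon> \<ge> 0 \<longrightarrow> \<delta> > 0 \<longrightarrow> \<delta> \<ge> K * sqrt \<epsilon> \<longrightarrow>
      linear_on_Sn n f \<longrightarrow>
      expect n (\<lambda>\<pi>. (dist01 (f \<pi>))\<^sup>2) \<le> \<epsilon> \<longrightarrow>
      \<delta> \<le> expect n f \<longrightarrow> expect n f \<le> 1 - \<delta> \<longrightarrow>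
      (\<exists>g. dictator n g \<and> expect n (\<lambda>\<pi>. (f \<pi> - g \<pi>)\<^sup>2) \<le> K' * \<epsilon> / \<delta>))"
proof -
  define N :: nat where "N = 300000"
  \<comment> \<open>The power of ten serves large n; the factorial is the worst case of the
    pointwise estimate for n below \<open>N\<close>.\<close>
  define K :: real where "K = 10 ^ 16 + 400 * fact N"
  have fact0: "(0 :: real) \<le> fact N" by simp
  have K16: "10 ^ 16 \<le> K" unfolding K_def using fact0 by simp
  then have K1: "K \<ge> 1" by simp
  have main: "\<exists>g. dictator n g \<and> expect n (\<lambda>\<pi>. (f \<pi> - g \<pi>)\<^sup>2) \<le> 4 * 10 ^ 8 * \<epsilon> / \<delta>"
    if n: "n \<ge> 1" and \<epsilon>0: "\<epsilon> \<ge> 0" and \<delta>0: "\<delta> > 0" and \<delta>K: "\<delta> \<ge> K * sqrt \<epsilon>"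
      and lin: "linear_on_Sn n f" and e: "expect n (\<lambda>\<pi>. (dist01 (f \<pi>))\<^sup>2) \<le> \<epsilon>"
      and mean: "\<delta> \<le> expect n f" "expect n f \<le> 1 - \<delta>" for n \<epsilon> \<delta> and f :: "(nat \<Rightarrow> nat) \<Rightarrow> real"
  proof -
    let ?S = "{1..n}"
    obtain c where c: "\<And>p. p permutes ?S \<Longrightarrow> f p = lin c ?S p" using linear_on_Sn_lin[OF lin] by blast
    \<comment> \<open>The exact distance of the mean from {0, 1}; it is at least \<delta>, so a
      bound by \<epsilon> / \<delta>' implies the one by \<epsilon> / \<delta>.\<close>
    define \<delta>' where "\<delta>' = min (perm_avg ?S (lin c ?S)) (1 - perm_avg ?S (lin c ?S))"
    have "expect n f = perm_avg ?S (lin c ?S)"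
      unfolding expect_eq_perm_avg using c by (intro perm_avg_cong)
    then have \<delta>\<delta>': "\<delta> \<le> \<delta>'" using mean by (simp add: \<delta>'_def)
    then have \<delta>'0: "0 < \<delta>'" using \<delta>0 by simp
    have \<delta>'2: "\<delta>' \<le> 1 / 2" by (simp add: \<delta>'_def min_def)
    have e': "perm_avg ?S (\<lambda>p. (dist01 (lin c ?S p))\<^sup>2) \<le> \<epsilon>"
    proof -
      have "perm_avg ?S (\<lambda>p. (dist01 (lin c ?S p))\<^sup>2) = expect n (\<lambda>\<pi>. (dist01 (f \<pi>))\<^sup>2)"
        unfolding expect_eq_perm_avg by (intro perm_avg_cong) (simp add: c)
      then show ?thesis using e by simp
    qed
    have "(K * sqrt \<epsilon>)\<^sup>2 \<le> \<delta>'\<^sup>2" using \<delta>K \<delta>\<delta>' K1 \<epsilon>0 by (intro power_mono) auto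
    then have "K\<^sup>2 * \<epsilon> \<le> \<delta>'\<^sup>2" using \<epsilon>0 by (simp add: power_mult_distrib)
    moreover have "K * \<epsilon> \<le> K\<^sup>2 * \<epsilon>"
      using K1 \<epsilon>0 by (intro mult_right_mono) (auto simp: power2_eq_square)
    ultimately have K\<epsilon>: "K * \<epsilon> \<le> \<delta>'\<^sup>2" by linarith
    have "10 ^ 16 * \<epsilon> \<le> K * \<epsilon>" using K16 \<epsilon>0 by (rule mult_right_mono)
    then have \<epsilon>: "10 ^ 16 * \<epsilon> \<le> \<delta>'\<^sup>2" using K\<epsilon> by linarith
    have "\<delta>'\<^sup>2 \<le> 1" using \<delta>'0 \<delta>'2 by (simp add: power_le_one)
    have small: "400 * fact n * \<epsilon> \<le> 1" if "n < 300000"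
    proof -
      have "n \<le> N" using that by (simp add: N_def)
      then have "(fact n :: real) \<le> fact N" by (rule fact_mono)
      then have "400 * fact n \<le> K" unfolding K_def by simp
      then have "400 * fact n * \<epsilon> \<le> K * \<epsilon>" using \<epsilon>0 by (rule mult_right_mono)
      then show ?thesis using K\<epsilon> \<open>\<delta>'\<^sup>2 \<le> 1\<close> by linarith
    qed
    define X where "X = 3 * 10 ^ 7 * \<epsilon> / \<delta>'"
    from dictator_line_exists[OF n e' \<delta>'_def \<delta>'0 \<epsilon> small]
    obtain g where g: "dictator n g" "perm_avg ?S (\<lambda>p. (lin c ?S p - g p)\<^sup>2) \<le> 12 * X + 4 * \<epsilon>"
      unfolding X_def using row_dictator[OF _ e'] column_dictator[OF _ e'] by blast
    have "expect n (\<lambda>\<pi>. (f \<pi> - g \<pi>)\<^sup>2) = perm_avg ?S (\<lambda>p. (lin c ?S p - g p)\<^sup>2)"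
      unfolding expect_eq_perm_avg by (intro perm_avg_cong) (simp add: c)
    also have "\<dots> \<le> 12 * X + 4 * \<epsilon>" by (rule g(2))
    \<comment> \<open>12 * 3 * 10^7 = 3.6 * 10^8, and the remaining 4 \<epsilon> is absorbed because
      \<epsilon> \<le> \<epsilon> / \<delta>'.\<close>
    also have "\<dots> \<le> 4 * 10 ^ 8 * (\<epsilon> / \<delta>')"
    proof -
      have "\<epsilon> \<le> \<epsilon> / \<delta>'" using \<delta>'0 \<delta>'2 \<epsilon>0 by (simp add: le_divide_eq mult_left_le)
      moreover have "X = 3 * 10 ^ 7 * (\<epsilon> / \<delta>')" by (simp add: X_def)
      moreover have "0 \<le> \<epsilon> / \<delta>'" using \<delta>'0 \<epsilon>0 by simp
      ultimately show ?thesis by simp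
    qed
    also have "\<dots> \<le> 4 * 10 ^ 8 * (\<epsilon> / \<delta>)"
      using \<delta>\<delta>' \<delta>0 \<epsilon>0 by (intro mult_left_mono divide_left_mono) auto
    finally show ?thesis using g(1) by (intro exI[of _ g]) simp
  qed
  show ?thesis
    using K1 main by (intro exI[of _ K] exI[of _ "4 * 10 ^ 8"] conjI allI impI) simp_all
qed

end
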